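(* There is a unique bilinear pairing $\langle\cdot,\cdot\rangle:{}_{D'}\mathbf W\times{}_D\mathbf W\to\mathbb C$ such that $\langle\mathbf 1',\mathbf 1\rangle=1$ and such that for all $\chi\in{}_D\mathbf W$, $\chi'\in{}_{D'}\mathbf W$: (i) for $z\in D$, as sections of $K$ on $D$, $\langle\chi',e(z)\chi\rangle=-\langle i'(z)\chi',\chi\rangle$; (ii) for $z'\in D'$, as sections of $K$ on $D'$, $\langle e'(z')\chi',\chi\rangle=-\langle\chi',i(z')\chi\rangle$; (iii) for every regular vector field $X$ on $\mathbb P$ and every natural number $N$, for $z\in D$ and $z'\in D'$, $$\langle\chi',\boldsymbol{\mathcal L}_X^Ne(z)\chi\rangle=\mathcal L_X^N\langle\chi',e(z)\chi\rangle=-\mathcal L_X^N\langle i'(z)\chi',\chi\rangle=-\langle\boldsymbol{\mathcal L}_X^Ni'(z)\chi',\chi\rangle,$$ $$\langle\boldsymbol{\mathcal L}_X^Ne'(z')\chi',\chi\rangle=\mathcal L_X^N\langle e'(z')\chi',\chi\rangle=-\mathcal L_X^N\langle\chi',i(z')\chi\rangle=-\langle\chi',\boldsymbol{\mathcal L}_X^Ni(z')\chi\rangle .$$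
   Context: $\mathbb P$ is a complex projective line, $K$ its canonical bundle. $\gamma\subset\mathbb P$ is a smooth simple closed curve separating $\mathbb P$ into two domains $D$ and $D'$ (each biholomorphic to a disc). ${}_D\mathbf K$ (resp. ${}_{D'}\mathbf K$) is the space of meromorphic 1-forms on $\mathbb P$ with all residues zero and all poles in $D$ (resp. $D'$); ${}_D\mathbf W=S^*({}_D\mathbf K)$, ${}_{D'}\mathbf W=S^*({}_{D'}\mathbf K)$, with vacuum vectors $\mathbf 1$ and $\mathbf 1'$ (the element $1\in\mathbb C$ of each). For $z\in D$, $e(z):{}_D\mathbf W\to{}_D\mathbf W\otimes K_z$ is multiplication by $e_z=-\frac{du}{(u-u(z))^2}\otimes du_z$, where $u$ is any coordinate (meromorphic function with exactly one, simple, pole) regular at $z$; $e_z$ does not depend on $u$. For $z\notin D$, $i(z):{}_D\mathbf W\to{}_D\mathbf W\otimes K_z$ is the derivation with $i(z)\mathbf 1=0$ and $i(z)\alpha=-\alpha(z)$ for $\alpha\in{}_D\mathbf K$. Likewise, with the roles of $D$ and $D'$ exchanged, $e'(z')$ (for $z'\in D'$) and $i'(z)$ (for $z\notin D'$) act on ${}_{D'}\mathbf W$ by the same formulas. $\boldsymbol{\mathcal L}_X$ denotes the derivative (Lie derivative in the variable $z$) of an operator-valued section of $K$ along a regular vector field $X$; $\mathcal L_X$ is the Lie derivative of scalar-valued sections of $K$. *)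

theory Defs
  imports "HOL-Complex_Analysis.Complex_Analysis" "HOL-Library.Poly_Mapping"
    "HOL-Library.Multiset" "HOL-Library.FuncSet"
begin

section \<open>The projective line, 1-forms and vector fields\<close>

text \<open>
  The projective line is the Riemann sphere: \<open>Some z\<close> is the finite point \<open>z\<close> and \<open>None\<close> is the
  point at infinity. Every point \<open>p\<close> gets a distinguished coordinate regular at \<open>p\<close>: the standard
  coordinate \<open>z\<close> if \<open>p\<close> is finite, and \<open>w = 1/z\<close> if \<open>p\<close> is the point at infinity.
\<close>

type_synonym point = "complex option"

definition sphere_topology :: "point topology" where
  "sphere_topology = Alexandroff_compactification euclidean"

definition coord_dom :: "point \<Rightarrow> point set" where
  "coord_dom p = (case p of Some _ \<Rightarrow> - {None} | None \<Rightarrow> - {Some 0})"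

definition coord :: "point \<Rightarrow> point \<Rightarrow> complex" where
  "coord p q = (case q of
     Some x \<Rightarrow> (case p of Some _ \<Rightarrow> x | None \<Rightarrow> 1 / x)
   | None \<Rightarrow> 0)"

definition base :: "point \<Rightarrow> complex" where
  "base p = coord p p"

text \<open>
  A section of \<open>K\<close> is a function \<open>s\<close> on points: \<open>s p\<close> is the element \<open>s p \<cdot> du\<^sub>p\<close> of the line \<open>K\<^sub>p\<close>,
  where \<open>u\<close> is the distinguished coordinate at \<open>p\<close>. (So \<open>K\<^sub>p\<close> is identified with \<open>\<complex>\<close>, and
  \<open>W \<otimes> K\<^sub>p\<close> with \<open>W\<close>.) Likewise a vector field is a function \<open>X\<close>, standing for \<open>X p \<cdot> \<partial>/\<partial>u\<close> at \<open>p\<close>.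
  The functions below are the coefficients of a section, resp. vector field, with respect to
  \<open>du\<close>, resp. \<open>\<partial>/\<partial>u\<close>, as functions of the distinguished coordinate \<open>u\<close> at \<open>p\<close>. For \<open>u = w\<close> they come
  from \<open>dz = - dw / w\<^sup>2\<close> and \<open>\<partial>/\<partial>z = - w\<^sup>2 \<partial>/\<partial>w\<close>.
\<close>

definition form_coeff :: "point \<Rightarrow> (point \<Rightarrow> complex) \<Rightarrow> complex \<Rightarrow> complex" where
  "form_coeff p s = (case p of
     Some _ \<Rightarrow> (\<lambda>z. s (Some z))
   | None \<Rightarrow> (\<lambda>w. if w = 0 then s None else - s (Some (1 / w)) / w ^ 2))"

definition vec_coeff :: "point \<Rightarrow> (point \<Rightarrow> complex) \<Rightarrow> complex \<Rightarrow> complex" where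
  "vec_coeff p X = (case p of
     Some _ \<Rightarrow> (\<lambda>z. X (Some z))
   | None \<Rightarrow> (\<lambda>w. if w = 0 then X None else - (w ^ 2) * X (Some (1 / w))))"

definition regular_vector_field :: "(point \<Rightarrow> complex) \<Rightarrow> bool" where
  "regular_vector_field X \<longleftrightarrow> (\<forall>p. vec_coeff p X analytic_on {base p})"

text \<open>In a coordinate \<open>u\<close>: the Lie derivative of \<open>f du\<close> along \<open>X \<partial>/\<partial>u\<close> is \<open>(X f' + X' f) du\<close>.\<close>

definition lie :: "(point \<Rightarrow> complex) \<Rightarrow> (point \<Rightarrow> complex) \<Rightarrow> point \<Rightarrow> complex" where
  "lie X s p = vec_coeff p X (base p) * deriv (form_coeff p s) (base p)
             + deriv (vec_coeff p X) (base p) * form_coeff p s (base p)"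

definition has_lie :: "(point \<Rightarrow> complex) \<Rightarrow> (point \<Rightarrow> complex) \<Rightarrow> point \<Rightarrow> complex \<Rightarrow> bool" where
  "has_lie X s p l \<longleftrightarrow> form_coeff p s field_differentiable (at (base p)) \<and> lie X s p = l"


section \<open>Curves\<close>

text \<open>\<open>F n\<close> is the \<open>n\<close>-th derivative of \<open>\<gamma>\<close>, read in the distinguished coordinate at \<open>\<gamma> t\<close>.\<close>

definition smooth_immersion_at :: "(real \<Rightarrow> point) \<Rightarrow> real \<Rightarrow> bool" where
  "smooth_immersion_at \<gamma> t \<longleftrightarrow>
     (\<exists>\<epsilon>>0. \<exists>F :: nat \<Rightarrow> real \<Rightarrow> complex. F 1 t \<noteq> 0 \<and>
        (\<forall>s\<in>{t - \<epsilon><..<t + \<epsilon>}. \<gamma> s \<in> coord_dom (\<gamma> t) \<and> F 0 s = coord (\<gamma> t) (\<gamma> s) \<and>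
           (\<forall>n. (F n has_vector_derivative F (Suc n) s) (at s))))"

definition smooth_simple_closed_curve :: "(real \<Rightarrow> point) \<Rightarrow> bool" where
  "smooth_simple_closed_curve \<gamma> \<longleftrightarrow>
     (\<forall>t. \<gamma> (t + 1) = \<gamma> t) \<and> inj_on \<gamma> {0..<1} \<and> (\<forall>t. smooth_immersion_at \<gamma> t)"

definition sphere_domain :: "point set \<Rightarrow> bool" where
  "sphere_domain D \<longleftrightarrow> D \<noteq> {} \<and> openin sphere_topology D \<and> connectedin sphere_topology D"

definition separates_into :: "point set \<Rightarrow> point set \<Rightarrow> point set \<Rightarrow> bool" where
  "separates_into \<Gamma> D D' \<longleftrightarrow>
     sphere_domain D \<and> sphere_domain D' \<and> D \<inter> D' = {} \<and> D \<union> D' = - \<Gamma>"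


section \<open>The complex vector space of meromorphic 1-forms\<close>

class complex_vector = ab_group_add +
  fixes scaleC :: "complex \<Rightarrow> 'a \<Rightarrow> 'a" (infixr \<open>*\<^sub>C\<close> 75)
  assumes scaleC_add_right: "c *\<^sub>C (x + y) = c *\<^sub>C x + c *\<^sub>C y"
    and scaleC_add_left: "(c + d) *\<^sub>C x = c *\<^sub>C x + d *\<^sub>C x"
    and scaleC_scaleC: "c *\<^sub>C d *\<^sub>C x = (c * d) *\<^sub>C x"
    and scaleC_one: "1 *\<^sub>C x = x"

text \<open>A meromorphic form is normalised to take the value \<open>0\<close> at its poles.\<close>

definition meromorphic_section :: "(point \<Rightarrow> complex) \<Rightarrow> bool" where
  "meromorphic_section s \<longleftrightarrow> (\<forall>p. form_coeff p s nicely_meromorphic_on {base p})"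

lemma base_simps [simp]: "base (Some z) = z" "base None = 0"
  by (simp_all add: base_def coord_def)

lemma form_coeff_base [simp]: "form_coeff p s (base p) = s p"
  by (cases p) (simp_all add: form_coeff_def)

lemma form_coeff_Some [simp]: "form_coeff (Some z) s = (\<lambda>x. s (Some x))"
  by (simp add: form_coeff_def)

lemma form_coeff_None: "form_coeff None s = (\<lambda>w. if w = 0 then s None else - s (Some (1 / w)) / w ^ 2)"
  by (simp add: form_coeff_def)

typedef mform = "{s. meromorphic_section s}"
  morphisms form_val Abs_mform
proof
  have "form_coeff p (\<lambda>_. 0) = (\<lambda>_. 0)" for p
    by (cases p) (auto simp: form_coeff_def)
  then show "(\<lambda>_. 0) \<in> {s. meromorphic_section s}"
    by (auto simp: meromorphic_section_def)
qed

setup_lifting type_definition_mform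

text \<open>
  The sum of two forms is defined off the poles by pointwise addition and extended over the
  removable singularities this leaves.
\<close>

definition tidy :: "(point \<Rightarrow> complex) \<Rightarrow> point \<Rightarrow> complex" where
  "tidy s p = remove_sings (form_coeff p s) (base p)"

lemma eventually_form_coeff_tidy:
  assumes "\<And>p. form_coeff p s meromorphic_on {base p}"
  shows "eventually (\<lambda>x. form_coeff p (tidy s) x = form_coeff p s x) (at (base p))"
proof (cases p)
  case (Some z)
  have "isolated_singularity_at (form_coeff p s) (base p)"
    using assms[of p] meromorphic_on_isolated_singularity by blast
  from eventually_remove_sings_eq_at[OF this] show ?thesis
    by eventually_elim (simp add: Some tidy_def)
next
  case None
  have "isolated_singularity_at (form_coeff None s) 0"
    using assms[of None] meromorphic_on_isolated_singularity by fastforce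
  then have "eventually (\<lambda>w. form_coeff None s analytic_on {w}) (at 0)"
    using isolated_singularity_at_altdef by blast
  moreover have "eventually (\<lambda>w::complex. w \<noteq> 0) (at 0)"
    by (simp add: eventually_at_filter)
  ultimately have "eventually (\<lambda>w. form_coeff None (tidy s) w = form_coeff None s w) (at 0)"
  proof eventually_elim
    case (elim w)
    have "(\<lambda>x. - form_coeff None s (1 / x) / x ^ 2) analytic_on {1 / w}"
    proof (intro analytic_intros)
      have "(form_coeff None s \<circ> (\<lambda>x. 1 / x)) analytic_on {1 / w}"
        using elim by (intro analytic_on_compose analytic_intros) auto
      then show "(\<lambda>x. form_coeff None s (1 / x)) analytic_on {1 / w}"
        by (simp add: o_def)
    qed (use elim in auto)
    moreover have "(\<lambda>x. s (Some x)) analytic_on {1 / w} \<longleftrightarrow>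
        (\<lambda>x. - form_coeff None s (1 / x) / x ^ 2) analytic_on {1 / w}"
    proof (rule analytic_at_cong)
      have "eventually (\<lambda>x. x \<in> - {0}) (nhds (1 / w))"
        using elim by (intro eventually_nhds_in_open) auto
      then show "eventually (\<lambda>x. s (Some x) = - form_coeff None s (1 / x) / x ^ 2) (nhds (1 / w))"
        by eventually_elim (auto simp: form_coeff_None field_simps)
    qed simp
    ultimately have "remove_sings (\<lambda>x. s (Some x)) (1 / w) = s (Some (1 / w))"
      by (intro remove_sings_at_analytic) simp
    then show ?case
      using elim by (simp add: form_coeff_None tidy_def)
  qed
  then show ?thesis by (simp add: None)
qed

lemma meromorphic_section_tidy:
  assumes "\<And>p. form_coeff p s meromorphic_on {base p}"
  shows "meromorphic_section (tidy s)"
  unfolding meromorphic_section_def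
proof
  fix p
  let ?f = "form_coeff p (tidy s)" and ?g = "remove_sings (form_coeff p s)"
  have g: "?g nicely_meromorphic_on {base p}"
    using assms by (rule remove_sings_nicely_meromorphic)
  have "isolated_singularity_at (form_coeff p s) (base p)"
    using assms[of p] meromorphic_on_isolated_singularity by blast
  from eventually_remove_sings_eq_at[OF this] eventually_form_coeff_tidy[OF assms, of p]
  have ev: "eventually (\<lambda>x. ?f x = ?g x) (at (base p))"
    by eventually_elim simp
  have val: "?f (base p) = ?g (base p)"
    by (simp add: tidy_def)
  have "?f meromorphic_on {base p} \<longleftrightarrow> ?g meromorphic_on {base p}"
    by (intro meromorphic_on_cong) (use ev in auto)
  then have mero: "?f meromorphic_on {base p}"
    using g unfolding nicely_meromorphic_on_def by blast
  have pole: "is_pole ?f (base p) \<longleftrightarrow> is_pole ?g (base p)"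
    by (rule is_pole_cong[OF ev refl])
  have lim: "(?f \<longlongrightarrow> c) (at (base p)) \<longleftrightarrow> (?g \<longlongrightarrow> c) (at (base p))" for c
    by (rule tendsto_cong[OF ev])
  have "is_pole ?g (base p) \<and> ?g (base p) = 0 \<or> (?g \<longlongrightarrow> ?g (base p)) (at (base p))"
    using g unfolding nicely_meromorphic_on_def by blast
  then have "is_pole ?f (base p) \<and> ?f (base p) = 0 \<or> (?f \<longlongrightarrow> ?f (base p)) (at (base p))"
    unfolding pole lim val .
  with mero show "?f nicely_meromorphic_on {base p}"
    unfolding nicely_meromorphic_on_def by blast
qed

lemma form_coeff_add: "form_coeff p (\<lambda>q. s q + t q) = (\<lambda>x. form_coeff p s x + form_coeff p t x)"
  by (cases p) (auto simp: form_coeff_def fun_eq_iff field_simps)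

lemma form_coeff_cmult: "form_coeff p (\<lambda>q. c * s q) = (\<lambda>x. c * form_coeff p s x)"
  by (cases p) (auto simp: form_coeff_def fun_eq_iff field_simps)

lemma form_coeff_zero: "form_coeff p (\<lambda>q. 0) = (\<lambda>x. 0)"
  by (cases p) (auto simp: form_coeff_def fun_eq_iff)

lemma meromorphic_section_zero: "meromorphic_section (\<lambda>q. 0)"
  by (auto simp: meromorphic_section_def form_coeff_zero)

lemma meromorphic_section_cmult:
  "meromorphic_section s \<Longrightarrow> meromorphic_section (\<lambda>q. c * s q)"
  by (auto simp: meromorphic_section_def form_coeff_cmult)

lemma meromorphic_sectionD:
  "meromorphic_section s \<Longrightarrow> form_coeff p s meromorphic_on {base p}"
  by (auto simp: meromorphic_section_def nicely_meromorphic_on_def)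

lemma meromorphic_add_aux:
  assumes "meromorphic_section s" "meromorphic_section t"
  shows "form_coeff p (\<lambda>q. s q + t q) meromorphic_on {base p}"
  unfolding form_coeff_add using assms by (intro meromorphic_on_add meromorphic_sectionD)

lemma remove_sings_nice:
  assumes "f nicely_meromorphic_on {z}"
  shows "remove_sings f z = f z"
  using assms by (auto simp: nicely_meromorphic_on_def)

lemma tidy_eq: "meromorphic_section s \<Longrightarrow> tidy s = s"
  by (auto simp: tidy_def fun_eq_iff meromorphic_section_def remove_sings_nice)

lemma tidy_add_tidy:
  assumes "\<And>p. form_coeff p s meromorphic_on {base p}"
  shows "tidy (\<lambda>q. tidy s q + t q) = tidy (\<lambda>q. s q + t q)"
proof
  fix p
  show "tidy (\<lambda>q. tidy s q + t q) p = tidy (\<lambda>q. s q + t q) p"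
    unfolding tidy_def[of _ p] form_coeff_add
  proof (rule remove_sings_cong)
    show "eventually (\<lambda>x. form_coeff p (tidy s) x + form_coeff p t x
        = form_coeff p s x + form_coeff p t x) (at (base p))"
      using eventually_form_coeff_tidy[OF assms, of p] by eventually_elim simp
  qed simp
qed

instantiation mform :: complex_vector
begin

lift_definition zero_mform :: mform is "\<lambda>_. 0"
  by (auto simp: meromorphic_section_def form_coeff_zero)

lift_definition plus_mform :: "mform \<Rightarrow> mform \<Rightarrow> mform" is "\<lambda>s t. tidy (\<lambda>p. s p + t p)"
  by (auto intro!: meromorphic_section_tidy meromorphic_add_aux)

lift_definition scaleC_mform :: "complex \<Rightarrow> mform \<Rightarrow> mform" is "\<lambda>c s p. c * s p"
  by (simp add: meromorphic_section_cmult)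

definition uminus_mform :: "mform \<Rightarrow> mform" where "uminus_mform \<alpha> = (-1) *\<^sub>C \<alpha>"

definition minus_mform :: "mform \<Rightarrow> mform \<Rightarrow> mform" where
  "minus_mform \<alpha> \<beta> = \<alpha> + (- \<beta>)"

instance
proof
  fix \<alpha> \<beta> \<rho> :: mform and c d :: complex
  show "\<alpha> + \<beta> + \<rho> = \<alpha> + (\<beta> + \<rho>)"
  proof transfer
    fix s t r assume *: "meromorphic_section s" "meromorphic_section t"
      "meromorphic_section r"
    have "tidy (\<lambda>p. tidy (\<lambda>p. t p + r p) p + s p) = tidy (\<lambda>p. t p + r p + s p)"
      using * by (intro tidy_add_tidy meromorphic_add_aux) auto
    moreover have "tidy (\<lambda>p. tidy (\<lambda>p. s p + t p) p + r p) = tidy (\<lambda>p. s p + t p + r p)"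
      using * by (intro tidy_add_tidy meromorphic_add_aux) auto
    ultimately show "tidy (\<lambda>p. tidy (\<lambda>p. s p + t p) p + r p) = tidy (\<lambda>p. s p + tidy (\<lambda>p. t p + r p) p)"
      by (simp add: add_ac)
  qed
  show "\<alpha> + \<beta> = \<beta> + \<alpha>"
    by transfer (simp add: add.commute)
  show "0 + \<alpha> = \<alpha>"
    by transfer (simp add: tidy_eq)
  show "- \<alpha> + \<alpha> = 0"
    unfolding uminus_mform_def
    by transfer (simp add: tidy_eq meromorphic_section_zero)
  show "\<alpha> - \<beta> = \<alpha> + - \<beta>"
    by (rule minus_mform_def)
  show "c *\<^sub>C (\<alpha> + \<beta>) = c *\<^sub>C \<alpha> + c *\<^sub>C \<beta>"
  proof transfer
    fix c s t assume *: "meromorphic_section s" "meromorphic_section t"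
    have "meromorphic_section (tidy (\<lambda>p. s p + t p))"
      using * by (intro meromorphic_section_tidy meromorphic_add_aux) auto
    from tidy_eq[OF meromorphic_section_cmult[OF this, of c]]
    have "(\<lambda>p. c * tidy (\<lambda>p. s p + t p) p) = tidy (\<lambda>p. c * tidy (\<lambda>p. s p + t p) p)" by (rule sym)
    also have "\<dots> = tidy (\<lambda>p. c * s p + c * t p)"
    proof
      fix p
      have "eventually (\<lambda>x. form_coeff p (tidy (\<lambda>p. s p + t p)) x = form_coeff p (\<lambda>p. s p + t p) x)
          (at (base p))"
        using * by (intro eventually_form_coeff_tidy meromorphic_add_aux) auto
      then show "tidy (\<lambda>p. c * tidy (\<lambda>p. s p + t p) p) p = tidy (\<lambda>p. c * s p + c * t p) p"
        unfolding tidy_def[of _ p] distrib_left[symmetric] form_coeff_cmult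
        by (intro remove_sings_cong) (auto elim: eventually_mono)
    qed
    finally show "(\<lambda>p. c * tidy (\<lambda>p. s p + t p) p) = tidy (\<lambda>p. c * s p + c * t p)" .
  qed
  show "(c + d) *\<^sub>C \<alpha> = c *\<^sub>C \<alpha> + d *\<^sub>C \<alpha>"
  proof transfer
    fix c d s assume "meromorphic_section s"
    then have "tidy (\<lambda>p. (c + d) * s p) = (\<lambda>p. (c + d) * s p)"
      by (intro tidy_eq meromorphic_section_cmult) auto
    then show "(\<lambda>p. (c + d) * s p) = tidy (\<lambda>p. c * s p + d * s p)"
      by (simp add: distrib_right)
  qed
  show "c *\<^sub>C d *\<^sub>C \<alpha> = (c * d) *\<^sub>C \<alpha>"
    by transfer (simp add: mult.assoc)
  show "1 *\<^sub>C \<alpha> = \<alpha>"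
    by transfer simp
qed

end

definition form_residue :: "mform \<Rightarrow> point \<Rightarrow> complex" where
  "form_residue \<alpha> p = residue (form_coeff p (form_val \<alpha>)) (base p)"

definition form_pole :: "mform \<Rightarrow> point \<Rightarrow> bool" where
  "form_pole \<alpha> p \<longleftrightarrow> is_pole (form_coeff p (form_val \<alpha>)) (base p)"

definition forms_K :: "point set \<Rightarrow> mform set" where
  "forms_K D = {\<alpha>. (\<forall>p. form_residue \<alpha> p = 0) \<and> (\<forall>p. form_pole \<alpha> p \<longrightarrow> p \<in> D)}"

text \<open>
  \<open>kernel p\<close> is the form \<open>e\<^sub>p = - du / (u - u(p))\<^sup>2\<close> (tensored with \<open>du\<^sub>p\<close>) for the distinguished
  coordinate \<open>u\<close> at \<open>p\<close>. For \<open>p = Some a\<close> it is \<open>- dz / (z - a)\<^sup>2\<close>, which is \<open>dw / (1 - a w)\<^sup>2\<close>, with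
  value \<open>1\<close> at infinity; for \<open>p = None\<close> it is \<open>- dw / w\<^sup>2 = dz\<close>. Poles get the value \<open>0\<close>.
\<close>

lift_definition kernel :: "point \<Rightarrow> mform" is
  "\<lambda>p q. case (p, q) of
     (Some a, Some x) \<Rightarrow> - 1 / (x - a) ^ 2
   | (Some a, None) \<Rightarrow> 1
   | (None, Some x) \<Rightarrow> 1
   | (None, None) \<Rightarrow> 0"
proof -
  have nice: "(\<lambda>x::complex. - 1 / (x - a) ^ 2) nicely_meromorphic_on {z}" for a z
  proof (cases "z = a")
    case True
    have "is_pole (\<lambda>x. (- 1) / (x - a) ^ 2) a"
      by (rule is_pole_basic[of _ UNIV]) auto
    then show ?thesis
      using True by (auto simp: nicely_meromorphic_on_def intro!: meromorphic_intros)
  next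
    case False
    then show ?thesis
      by (intro analytic_on_imp_nicely_meromorphic_on analytic_intros) auto
  qed
  fix p :: point
  let ?s = "\<lambda>q. case (p, q) of (Some a, Some x) \<Rightarrow> - 1 / (x - a) ^ 2
      | (Some a, None) \<Rightarrow> 1 | (None, Some x) \<Rightarrow> 1 | (None, None) \<Rightarrow> (0::complex)"
  have "form_coeff q ?s nicely_meromorphic_on {base q}" for q
  proof (cases p; cases q)
    fix a x assume "p = Some a" "q = Some x"
    then show ?thesis using nice[of a x] by simp
  next
    fix a assume pq: "p = Some a" "q = None"
    have "form_coeff q ?s = (\<lambda>w. 1 / (1 - a * w) ^ 2)"
    proof
      fix w
      have "(1 / w - a) ^ 2 * w ^ 2 = (1 - a * w) ^ 2" if "w \<noteq> 0"
        using that by (simp add: power_mult_distrib[symmetric] algebra_simps)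
      then show "form_coeff q ?s w = 1 / (1 - a * w) ^ 2"
        by (simp add: pq form_coeff_None)
    qed
    moreover have "(\<lambda>w. 1 / (1 - a * w) ^ 2) nicely_meromorphic_on {0}"
      by (intro analytic_on_imp_nicely_meromorphic_on analytic_intros) auto
    ultimately show ?thesis by (simp add: pq)
  next
    fix x assume "p = None" "q = Some x"
    then show ?thesis by (simp add: nicely_meromorphic_on_const)
  next
    assume pq: "p = None" "q = None"
    have "form_coeff q ?s = (\<lambda>w. - 1 / (w - 0) ^ 2)"
      by (auto simp: pq form_coeff_None)
    then show ?thesis using nice[of 0 0] by (simp add: pq)
  qed
  then show "meromorphic_section ?s"
    by (simp add: meromorphic_section_def)
qed

text \<open>
  Independence of the coordinate: any coordinate is a Moebius function \<open>u\<close> of \<open>z\<close>, and it gives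
  the same \<open>- du / (u - u(y))\<^sup>2 \<otimes> du\<^sub>y\<close>.
\<close>

lemma kernel_any_coordinate:
  fixes a b c d x y :: complex
  defines "u \<equiv> \<lambda>z. (a * z + b) / (c * z + d)"
  assumes "a * d - b * c \<noteq> 0" "c * x + d \<noteq> 0" "c * y + d \<noteq> 0" "x \<noteq> y"
  shows "- deriv u x / (u x - u y) ^ 2 * deriv u y = form_val (kernel (Some y)) (Some x)"
proof -
  have der: "deriv u z = (a * d - b * c) / (c * z + d) ^ 2" if "c * z + d \<noteq> 0" for z
    unfolding u_def using that
    by (intro DERIV_imp_deriv) (auto intro!: derivative_eq_intros simp: field_simps power2_eq_square)
  have diff: "u x - u y = (a * d - b * c) * (x - y) / ((c * x + d) * (c * y + d))"
    unfolding u_def using assms by (simp add: field_simps)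
  show ?thesis
    unfolding diff der[OF assms(3)] der[OF assms(4)] kernel.rep_eq
    using assms by (simp add: power_mult_distrib power_divide divide_simps) (simp add: power2_eq_square)
qed


section \<open>Symmetric algebras\<close>

text \<open>
  The symmetric algebra of a complex vector space \<open>V\<close>: the free commutative algebra on the set \<open>V\<close>
  (its monomials are the finite multisets of elements of \<open>V\<close>) modulo the ideal that makes the
  inclusion of generators linear.
\<close>

definition sym_relators :: "('v::complex_vector multiset \<Rightarrow>\<^sub>0 complex) set" where
  "sym_relators =
     {Poly_Mapping.single {#a + b#} 1 - Poly_Mapping.single {#a#} 1 - Poly_Mapping.single {#b#} 1 | a b. True}
   \<union> {Poly_Mapping.single {#c *\<^sub>C a#} 1 - Poly_Mapping.single {#a#} c | a c. True}"

definition sym_ideal :: "('v::complex_vector multiset \<Rightarrow>\<^sub>0 complex) set" where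
  "sym_ideal = module.span (*) sym_relators"

lemma module_ring: "module ((*) :: 'a::comm_ring_1 \<Rightarrow> 'a \<Rightarrow> 'a)"
  by standard (simp_all add: algebra_simps)

lemma sym_ideal_zero: "0 \<in> sym_ideal"
  and sym_ideal_add: "p \<in> sym_ideal \<Longrightarrow> q \<in> sym_ideal \<Longrightarrow> p + q \<in> sym_ideal"
  and sym_ideal_mult: "p \<in> sym_ideal \<Longrightarrow> r * p \<in> sym_ideal"
  and sym_ideal_uminus: "p \<in> sym_ideal \<Longrightarrow> - p \<in> sym_ideal"
  unfolding sym_ideal_def
  by (rule module.span_zero[OF module_ring] module.span_add[OF module_ring]
      module.span_scale[OF module_ring] module.span_neg[OF module_ring]; assumption?)+

lemma sym_ideal_diff: "p \<in> sym_ideal \<Longrightarrow> q \<in> sym_ideal \<Longrightarrow> p - q \<in> sym_ideal"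
  using sym_ideal_add[OF _ sym_ideal_uminus] by fastforce

lemma lookup_times_empty:
  fixes p q :: "'v multiset \<Rightarrow>\<^sub>0 complex"
  shows "Poly_Mapping.lookup (p * q) {#} = Poly_Mapping.lookup p {#} * Poly_Mapping.lookup q {#}"
proof -
  have "Sum_any (\<lambda>m. Poly_Mapping.lookup q m when {#} = l + m) = (Poly_Mapping.lookup q {#} when l = {#})" for l :: "'v multiset"
  proof (cases "l = {#}")
    case True
    have "Sum_any (\<lambda>m. Poly_Mapping.lookup q m when {#} = l + m) = Sum_any (\<lambda>m. Poly_Mapping.lookup q m when m = {#})"
      by (rule Sum_any.cong) (auto simp: True when_def)
    then show ?thesis by (simp add: True)
  qed simp
  then have "Poly_Mapping.lookup (p * q) {#} = Sum_any (\<lambda>l. Poly_Mapping.lookup p l * (Poly_Mapping.lookup q {#} when l = {#}))"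
    by (simp add: lookup_mult)
  also have "\<dots> = Sum_any (\<lambda>l. Poly_Mapping.lookup p l * Poly_Mapping.lookup q {#} when l = {#})"
    by (rule Sum_any.cong) (auto simp: when_def)
  finally show ?thesis by simp
qed

lemma lookup_sym_ideal:
  fixes p :: "'v::complex_vector multiset \<Rightarrow>\<^sub>0 complex"
  assumes "p \<in> sym_ideal"
  shows "Poly_Mapping.lookup p {#} = 0"
proof -
  have "p \<in> module.span (*) sym_relators"
    using assms by (simp add: sym_ideal_def)
  then show ?thesis
  proof (induction rule: module.span_induct_alt[OF module_ring, consumes 1, case_names base step])
    case (step c x y)
    then have "Poly_Mapping.lookup x {#} = 0"
      by (auto simp: sym_relators_def lookup_minus lookup_single)
    with step show ?case
      by (simp add: lookup_add lookup_times_empty)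
  qed simp
qed

quotient_type (overloaded) 'v sym = "'v::complex_vector multiset \<Rightarrow>\<^sub>0 complex" / "\<lambda>p q. p - q \<in> sym_ideal"
proof (rule equivpI)
  show "reflp (\<lambda>p q. p - q \<in> (sym_ideal :: ('v multiset \<Rightarrow>\<^sub>0 complex) set))"
    by (auto intro!: reflpI sym_ideal_zero)
  show "symp (\<lambda>p q. p - q \<in> (sym_ideal :: ('v multiset \<Rightarrow>\<^sub>0 complex) set))"
    by (intro sympI) (drule sym_ideal_uminus, simp)
  show "transp (\<lambda>p q. p - q \<in> (sym_ideal :: ('v multiset \<Rightarrow>\<^sub>0 complex) set))"
    by (intro transpI) (drule (1) sym_ideal_add, simp)
qed

instantiation sym :: (complex_vector) comm_ring_1
begin

lift_definition zero_sym :: "'a sym" is 0 .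
lift_definition one_sym :: "'a sym" is 1 .

lift_definition plus_sym :: "'a sym \<Rightarrow> 'a sym \<Rightarrow> 'a sym" is "(+)"
  by (drule (1) sym_ideal_add) (simp add: algebra_simps)

lift_definition minus_sym :: "'a sym \<Rightarrow> 'a sym \<Rightarrow> 'a sym" is "(-)"
  by (drule (1) sym_ideal_diff) (simp add: algebra_simps)

lift_definition uminus_sym :: "'a sym \<Rightarrow> 'a sym" is uminus
  by (drule sym_ideal_uminus) (simp add: algebra_simps)

lift_definition times_sym :: "'a sym \<Rightarrow> 'a sym \<Rightarrow> 'a sym" is "(*)"
proof -
  fix p p' q q' :: "'a multiset \<Rightarrow>\<^sub>0 complex"
  assume "p - p' \<in> sym_ideal" "q - q' \<in> sym_ideal"
  then have "q * (p - p') + p' * (q - q') \<in> sym_ideal"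
    by (intro sym_ideal_add sym_ideal_mult)
  then show "p * q - p' * q' \<in> sym_ideal"
    by (simp add: algebra_simps)
qed

instance
proof
  fix a b c :: "'a sym"
  show "a * b * c = a * (b * c)"
    by transfer (simp add: mult.assoc sym_ideal_zero)
  show "a * b = b * a"
    by transfer (simp add: mult.commute sym_ideal_zero)
  show "1 * a = a"
    by transfer (simp add: sym_ideal_zero)
  show "(a + b) * c = a * c + b * c"
    by transfer (simp add: distrib_right sym_ideal_zero)
  show "a + b + c = a + (b + c)"
    by transfer (simp add: add.assoc sym_ideal_zero)
  show "a + b = b + a"
    by transfer (simp add: add.commute sym_ideal_zero)
  show "0 + a = a"
    by transfer (simp add: sym_ideal_zero)
  show "- a + a = 0"
    by transfer (simp add: sym_ideal_zero)
  show "a - b = a + - b"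
    by transfer (simp add: sym_ideal_zero)
  show "(0 :: 'a sym) \<noteq> 1"
  proof transfer
    have "Poly_Mapping.lookup (0 - 1 :: 'a multiset \<Rightarrow>\<^sub>0 complex) {#} \<noteq> 0"
      by (simp add: lookup_minus lookup_one)
    then show "0 - 1 \<notin> (sym_ideal :: ('a multiset \<Rightarrow>\<^sub>0 complex) set)"
      using lookup_sym_ideal by blast
  qed
qed

end

lift_definition sconst :: "complex \<Rightarrow> 'v::complex_vector sym" is "Poly_Mapping.single {#}" .

lift_definition sgen :: "'v::complex_vector \<Rightarrow> 'v sym" is "\<lambda>v. Poly_Mapping.single {#v#} 1" .

lift_definition vacuum_part :: "'v::complex_vector sym \<Rightarrow> complex" is "\<lambda>p. Poly_Mapping.lookup p {#}"
  by (drule lookup_sym_ideal) (simp add: lookup_minus)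

text \<open>
  For a subspace \<open>V\<close>, the symmetric algebra of \<open>V\<close> is the subalgebra of the symmetric algebra of the
  whole space that \<open>V\<close> generates (a linear injection induces an injection of symmetric algebras).
\<close>

inductive_set Sym :: "'v::complex_vector set \<Rightarrow> 'v sym set" for V where
  gen: "v \<in> V \<Longrightarrow> sgen v \<in> Sym V"
| const: "sconst c \<in> Sym V"
| add: "x \<in> Sym V \<Longrightarrow> y \<in> Sym V \<Longrightarrow> x + y \<in> Sym V"
| mult: "x \<in> Sym V \<Longrightarrow> y \<in> Sym V \<Longrightarrow> x * y \<in> Sym V"

definition derivation_on :: "'v::complex_vector sym set \<Rightarrow> ('v sym \<Rightarrow> 'v sym) \<Rightarrow> bool" where
  "derivation_on W d \<longleftrightarrow>
     (\<forall>x\<in>W. \<forall>y\<in>W. d (x + y) = d x + d y) \<and>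
     (\<forall>c. \<forall>x\<in>W. d (sconst c * x) = sconst c * d x) \<and>
     (\<forall>x\<in>W. \<forall>y\<in>W. d (x * y) = d x * y + x * d y)"

definition bilinear_on :: "'v::complex_vector sym set \<Rightarrow> 'v sym set \<Rightarrow> ('v sym \<times> 'v sym \<Rightarrow> complex) \<Rightarrow> bool" where
  "bilinear_on W' W B \<longleftrightarrow>
     (\<forall>x\<in>W'. \<forall>x'\<in>W'. \<forall>y\<in>W. B (x + x', y) = B (x, y) + B (x', y)) \<and>
     (\<forall>c. \<forall>x\<in>W'. \<forall>y\<in>W. B (sconst c * x, y) = c * B (x, y)) \<and>
     (\<forall>x\<in>W'. \<forall>y\<in>W. \<forall>y'\<in>W. B (x, y + y') = B (x, y) + B (x, y')) \<and>
     (\<forall>c. \<forall>x\<in>W'. \<forall>y\<in>W. B (x, sconst c * y) = c * B (x, y))"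


section \<open>The spaces W, the operators e and i, and derivatives of operator-valued sections\<close>

definition space_W :: "point set \<Rightarrow> mform sym set" where
  "space_W D = Sym (forms_K D)"

definition creation :: "point \<Rightarrow> mform sym \<Rightarrow> mform sym" where
  "creation z \<phi> = sgen (kernel z) * \<phi>"

definition annihilation :: "point set \<Rightarrow> point \<Rightarrow> mform sym \<Rightarrow> mform sym" where
  "annihilation D z = (THE d. d \<in> space_W D \<rightarrow>\<^sub>E space_W D \<and> derivation_on (space_W D) d \<and>
     d 1 = 0 \<and> (\<forall>\<alpha>\<in>forms_K D. d (sgen \<alpha>) = - sconst (form_val \<alpha> z)))"

text \<open>
  The correlation functions of an element \<open>\<phi>\<close> of \<open>space_W D\<close>: the vacuum part of
  \<open>i(p\<^sub>1) \<cdots> i(p\<^sub>n) \<phi>\<close>, for points \<open>p\<^sub>1, \<dots>, p\<^sub>n\<close> outside \<open>D\<close>. On a product of \<open>n\<close> forms this is, up to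
  the sign \<open>(-1)\<^sup>n\<close>, the symmetrised product of their values at \<open>p\<^sub>1, \<dots>, p\<^sub>n\<close>. Together they determine
  \<open>\<phi>\<close>. Derivatives of sections with values in the infinite-dimensional space \<open>space_W D\<close> are taken
  with respect to pointwise convergence of all correlation functions; for forms this is
  pointwise convergence outside \<open>D\<close>.
\<close>

definition correlation :: "point set \<Rightarrow> point list \<Rightarrow> mform sym \<Rightarrow> complex" where
  "correlation D ps \<phi> = vacuum_part (foldr (annihilation D) ps \<phi>)"

definition lie_op ::
    "point set \<Rightarrow> (point \<Rightarrow> complex) \<Rightarrow> (point \<Rightarrow> mform sym \<Rightarrow> mform sym) \<Rightarrow> point \<Rightarrow> mform sym \<Rightarrow> mform sym" where
  "lie_op D X A z \<phi> = (THE v. v \<in> space_W D \<and>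
     (\<forall>ps. set ps \<subseteq> - D \<longrightarrow> has_lie X (\<lambda>q. correlation D ps (A q \<phi>)) z (correlation D ps v)))"

end

theory Submission
  imports Defs
begin

text \<open>
  The form \<open>e\<^sub>z\<close> is a symmetric kernel \<open>e(z, z')\<close>, and its derivatives in \<open>z\<close> at the points of \<open>D\<close>
  span the residueless forms with poles in \<open>D\<close>: principal parts can be cancelled one by one, and a
  form without poles vanishes by Liouville's theorem. So there is at most one pairing \<open>b\<close> of forms
  with \<open>b(\<alpha>', \<partial>\<^sub>z\<^sup>n e\<^sub>z) = \<partial>\<^sup>n \<alpha>' (z)\<close>, and it exists, and satisfies the same rule in its other argument,
  because mixed derivatives of the kernel commute. The adjunction between creation and annihilation
  forces the pairing of symmetric algebras to be the extension of \<open>b\<close> by iterated contraction.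
  For constant vector fields \<open>L\<^sub>X\<^sup>N e(z)\<close> is multiplication by \<open>\<partial>\<^sub>z\<^sup>N e\<^sub>z\<close>, so the Lie derivatives in
  (iii) reach all generators, which gives uniqueness.

  The operators \<open>L\<^sub>X\<^sup>N e(z)\<close> and \<open>L\<^sub>X\<^sup>N i(z)\<close> are characterised through correlation functions. These
  separate elements: an element killed by all \<open>i(p)\<close> is killed by the Euler derivation, hence constant.
\<close>

subsection \<open>Linear maps out of a symmetric algebra\<close>

text \<open>Two obstacles shape the proof. Both \<open>annihilation\<close> and
  \<open>lie_op\<close> are definite descriptions with values in an infinite-dimensional space, so
  each value has to be exhibited and shown to be unique. Their dependence on the point is therefore
  reduced to scalars: a correlation function of \<open>e(z) x\<close> is a fixed combination of
  values of \<open>e\<^sub>z\<close> at points outside \<open>D\<close>, which by symmetry of the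
  kernel are values at \<open>z\<close> of fixed forms, and \<open>i(z) x\<close> is a finite sum of
  values at \<open>z\<close> of fixed forms times fixed elements. All differentiation then concerns
  ordinary forms at regular points. The other obstacle is that forms take the value \<open>0\<close>
  at their poles, so evaluation at a point is not linear on all forms, while derivations are
  constructed on the symmetric algebra of all forms. Functionals are therefore extended linearly
  from the relevant subspace \<open>V\<close>; on \<open>Sym V\<close> the choice of the extension
  has no effect.\<close>

interpretation cv: vector_space "scaleC :: complex \<Rightarrow> 'v \<Rightarrow> 'v::complex_vector"
  by standard (simp_all add: scaleC_add_right scaleC_add_left scaleC_scaleC scaleC_one)

definition smono :: "'v::complex_vector multiset \<Rightarrow> 'v sym" where
  "smono M = prod_mset (image_mset sgen M)"

lemma smono_simps [simp]:
  "smono {#} = 1" "smono (M + N) = smono M * smono N" "smono (add_mset v M) = sgen v * smono M"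
  by (simp_all add: smono_def)

lemma sconst_add: "sconst (a + b) = sconst a + sconst b"
  by transfer (simp add: single_add sym_ideal_zero)

lemma sconst_mult: "sconst (a * b) = sconst a * sconst b"
  by transfer (simp add: mult_single sym_ideal_zero)

lemma sconst_0 [simp]: "sconst 0 = 0"
  by transfer (simp add: sym_ideal_zero)

lemma sconst_1 [simp]: "sconst 1 = 1"
  by transfer (simp add: sym_ideal_zero)

lemma sconst_uminus: "sconst (- a) = - sconst a"
  using sconst_add[of a "- a"] by (simp add: eq_neg_iff_add_eq_0 add.commute)

lemma sconst_mult_cancel:
  assumes "c \<noteq> 0" "sconst c * x = 0"
  shows "x = 0"
proof -
  have "sconst (inverse c) * (sconst c * x) = sconst (inverse c * c) * x"
    by (simp only: sconst_mult mult.assoc)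
  then show ?thesis using assms by simp
qed

lemma sgen_add: "sgen (a + b) = sgen a + sgen b"
proof transfer
  fix a b :: 'a
  have "Poly_Mapping.single {#a + b#} 1 - Poly_Mapping.single {#a#} 1 - Poly_Mapping.single {#b#} 1
      \<in> (sym_relators :: ('a multiset \<Rightarrow>\<^sub>0 complex) set)"
    by (auto simp: sym_relators_def)
  then show "Poly_Mapping.single {#a + b#} 1 - (Poly_Mapping.single {#a#} 1 + Poly_Mapping.single {#b#} 1)
      \<in> (sym_ideal :: ('a multiset \<Rightarrow>\<^sub>0 complex) set)"
    unfolding sym_ideal_def by (auto simp: algebra_simps intro: module.span_base[OF module_ring])
qed

lemma sgen_scaleC: "sgen (c *\<^sub>C a) = sconst c * sgen a"
proof transfer
  fix c and a :: 'a
  have "Poly_Mapping.single {#c *\<^sub>C a#} 1 - Poly_Mapping.single {#a#} c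
      \<in> (sym_relators :: ('a multiset \<Rightarrow>\<^sub>0 complex) set)"
    by (auto simp: sym_relators_def)
  then show "Poly_Mapping.single {#c *\<^sub>C a#} 1 - Poly_Mapping.single {#} c * Poly_Mapping.single {#a#} 1
      \<in> (sym_ideal :: ('a multiset \<Rightarrow>\<^sub>0 complex) set)"
    unfolding sym_ideal_def by (auto simp: mult_single intro: module.span_base[OF module_ring])
qed

lemma abs_sym_single: "abs_sym (Poly_Mapping.single M c) = sconst c * smono M"
proof (induction M)
  case empty
  show ?case by (simp add: sconst.abs_eq)
next
  case (add v M)
  have "abs_sym (Poly_Mapping.single (add_mset v M) c) = abs_sym (Poly_Mapping.single {#v#} 1 * Poly_Mapping.single M c)"
    by (simp add: mult_single)
  also have "\<dots> = sgen v * abs_sym (Poly_Mapping.single M c)"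
    by (simp add: sgen.abs_eq times_sym.abs_eq)
  finally show ?case using add by (simp add: mult_ac)
qed

lemma poly_mapping_expand:
  fixes p :: "'a \<Rightarrow>\<^sub>0 'b::comm_monoid_add"
  shows "p = (\<Sum>M\<in>Poly_Mapping.keys p. Poly_Mapping.single M (Poly_Mapping.lookup p M))"
  by (rule poly_mapping_eqI) (auto simp: lookup_sum lookup_single when_def in_keys_iff)

lemma poly_mapping_induct [case_names single add]:
  fixes p :: "'a \<Rightarrow>\<^sub>0 'b::comm_monoid_add"
  assumes "\<And>M c. P (Poly_Mapping.single M c)" "\<And>p q. P p \<Longrightarrow> P q \<Longrightarrow> P (p + q)"
  shows "P p"
proof -
  have "P (\<Sum>M\<in>A. Poly_Mapping.single M (Poly_Mapping.lookup p M))" if "finite A" for A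
    using that
  proof (induction A)
    case empty
    show ?case using assms(1)[of undefined 0] by simp
  qed (auto intro: assms)
  then show ?thesis by (subst poly_mapping_expand) simp
qed

lemma sym_induct_smono [case_names smono add]:
  fixes x :: "'v::complex_vector sym"
  assumes "\<And>M c. P (sconst c * smono M)" "\<And>x y. P x \<Longrightarrow> P y \<Longrightarrow> P (x + y)"
  shows "P x"
proof -
  have "P (abs_sym p)" for p
    by (induction p rule: poly_mapping_induct)
       (auto simp: abs_sym_single plus_sym.abs_eq[symmetric] intro: assms)
  then show ?thesis by (rule sym.abs_induct)
qed

lemma sym_induct [case_names sconst sgen add mult]:
  fixes x :: "'v::complex_vector sym"
  assumes "\<And>c. P (sconst c)" "\<And>v. P (sgen v)"
    and "\<And>x y. P x \<Longrightarrow> P y \<Longrightarrow> P (x + y)" "\<And>x y. P x \<Longrightarrow> P y \<Longrightarrow> P (x * y)"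
  shows "P x"
proof (induction x rule: sym_induct_smono)
  case (smono M c)
  have "P (smono M)"
    using assms(1)[of 1] by (induction M) (auto intro: assms)
  then show ?case by (intro assms)
qed (auto intro: assms)

text \<open>Scalars enter the target ring through a homomorphism \<open>k\<close> instead of a type
  class, so that one theory serves the symmetric algebra, polynomials over it (derivations and
  scalings) and the complex numbers (pairings).\<close>

locale scalar_hom =
  fixes k :: "complex \<Rightarrow> 'r::comm_ring_1"
  assumes k_add: "k (a + b) = k a + k b" and k_mult: "k (a * b) = k a * k b" and k_1: "k 1 = 1"
begin

lemma k_0: "k 0 = 0"
  using k_add[of 0 0] by simp

definition free_ext :: "('v multiset \<Rightarrow> 'r) \<Rightarrow> ('v multiset \<Rightarrow>\<^sub>0 complex) \<Rightarrow> 'r" where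
  "free_ext F p = (\<Sum>M\<in>Poly_Mapping.keys p. k (Poly_Mapping.lookup p M) * F M)"

lemma free_ext_superset:
  assumes "finite A" "Poly_Mapping.keys p \<subseteq> A"
  shows "free_ext F p = (\<Sum>M\<in>A. k (Poly_Mapping.lookup p M) * F M)"
  unfolding free_ext_def using assms by (intro sum.mono_neutral_left) (auto simp: in_keys_iff k_0)

lemma free_ext_add: "free_ext F (p + q) = free_ext F p + free_ext F q"
proof -
  let ?A = "Poly_Mapping.keys p \<union> Poly_Mapping.keys q"
  show ?thesis
    using Poly_Mapping.keys_add[of p q]
    by (subst (1 2 3) free_ext_superset[of ?A])
       (auto simp: lookup_add k_add distrib_right sum.distrib)
qed

lemma free_ext_single: "free_ext F (Poly_Mapping.single M c) = k c * F M"
  by (subst free_ext_superset[of "{M}"]) (auto simp: k_0)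

lemma free_ext_uminus: "free_ext F (- p) = - free_ext F p"
  using free_ext_add[of F p "- p"] by (simp add: free_ext_def eq_neg_iff_add_eq_0 add.commute)

lemma free_ext_diff: "free_ext F (p - q) = free_ext F p - free_ext F q"
  using free_ext_add[of F p "- q"] by (simp add: free_ext_uminus)

definition multilinear :: "('v::complex_vector multiset \<Rightarrow> 'r) \<Rightarrow> bool" where
  "multilinear F \<longleftrightarrow> (\<forall>N a b. F (add_mset (a + b) N) = F (add_mset a N) + F (add_mset b N)) \<and>
     (\<forall>N a c. F (add_mset (c *\<^sub>C a) N) = k c * F (add_mset a N))"

text \<open>By additivity it is enough to multiply a relator by a monomial \<open>M\<close>. The
  value of \<open>free_ext F\<close> is then a multiple of the defect of linearity of
  \<open>F\<close> in one slot, the others being filled by \<open>M\<close>.\<close>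

lemma free_ext_sym_ideal:
  assumes F: "multilinear F" and p: "p \<in> sym_ideal"
  shows "free_ext F p = 0"
proof -
  have *: "free_ext F (c * x) = 0" if "x \<in> sym_relators" for c x
  proof (induction c rule: poly_mapping_induct)
    case (single M c)
    from that consider
        a b where "x = Poly_Mapping.single {#a + b#} 1 - Poly_Mapping.single {#a#} 1 - Poly_Mapping.single {#b#} 1"
      | a d where "x = Poly_Mapping.single {#d *\<^sub>C a#} 1 - Poly_Mapping.single {#a#} d"
      unfolding sym_relators_def by blast
    then show ?case
    proof cases
      case 1
      show ?thesis
        unfolding 1 using F by (simp add: multilinear_def right_diff_distrib mult_single free_ext_diff
          free_ext_single distrib_left k_1)
    next
      case 2
      show ?thesis
        unfolding 2 using F by (simp add: multilinear_def right_diff_distrib mult_single free_ext_diff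
          free_ext_single k_mult k_1 mult_ac)
    qed
  qed (simp add: distrib_right free_ext_add)
  have "p \<in> module.span (*) sym_relators"
    using p by (simp add: sym_ideal_def)
  then show ?thesis
  proof (induction rule: module.span_induct_alt[OF module_ring, consumes 1, case_names base step])
    case base
    then show ?case by (simp add: free_ext_def)
  next
    case (step c x y)
    then show ?case by (simp add: free_ext_add *)
  qed
qed

text \<open>Evaluation on a representative; for multilinear \<open>F\<close> its choice does not
  matter, by \<open>free_ext_sym_ideal\<close>.\<close>

definition sym_ext :: "('v::complex_vector multiset \<Rightarrow> 'r) \<Rightarrow> 'v sym \<Rightarrow> 'r" where
  "sym_ext F x = free_ext F (rep_sym x)"

context
  fixes F :: "'v::complex_vector multiset \<Rightarrow> 'r"
  assumes F: "multilinear F"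
begin

lemma sym_ext_abs: "sym_ext F (abs_sym p) = free_ext F p"
proof -
  have "rep_sym (abs_sym p) - p \<in> sym_ideal"
    by (rule rep_abs_rsp_left[OF Quotient3_sym]) (simp add: sym_ideal_zero)
  then show ?thesis
    using free_ext_sym_ideal[OF F, of "rep_sym (abs_sym p) - p"] by (simp add: free_ext_diff sym_ext_def)
qed

lemma sym_ext_add: "sym_ext F (x + y) = sym_ext F x + sym_ext F y"
proof -
  obtain p q where "x = abs_sym p" "y = abs_sym q"
    by (rule that[of "rep_sym x" "rep_sym y"]) (simp_all add: Quotient3_abs_rep[OF Quotient3_sym])
  then show ?thesis by (simp add: plus_sym.abs_eq sym_ext_abs free_ext_add)
qed

lemma sym_ext_smono: "sym_ext F (sconst c * smono M) = k c * F M"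
  by (simp add: abs_sym_single[symmetric] sym_ext_abs free_ext_single)

lemma sym_ext_sconst_mult: "sym_ext F (sconst c * x) = k c * sym_ext F x"
proof (induction x rule: sym_induct_smono)
  case (smono M d)
  have "sconst c * (sconst d * smono M) = sconst (c * d) * smono M"
    by (simp add: sconst_mult mult.assoc)
  then show ?case by (simp only: sym_ext_smono k_mult mult.assoc)
qed (simp add: distrib_left sym_ext_add)

end

definition alg_linear :: "('v::complex_vector \<Rightarrow> 'r) \<Rightarrow> bool" where
  "alg_linear f \<longleftrightarrow> (\<forall>a b. f (a + b) = f a + f b) \<and> (\<forall>c a. f (c *\<^sub>C a) = k c * f a)"

definition sym_hom :: "('v::complex_vector \<Rightarrow> 'r) \<Rightarrow> 'v sym \<Rightarrow> 'r" where
  "sym_hom f = sym_ext (\<lambda>M. prod_mset (image_mset f M))"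

context
  fixes f :: "'v::complex_vector \<Rightarrow> 'r"
  assumes f: "alg_linear f"
begin

lemma multilinear_prod: "multilinear (\<lambda>M. prod_mset (image_mset f M))"
  using f by (simp add: multilinear_def alg_linear_def distrib_right mult.assoc)

lemma sym_hom_add: "sym_hom f (x + y) = sym_hom f x + sym_hom f y"
  unfolding sym_hom_def by (rule sym_ext_add[OF multilinear_prod])

lemma sym_hom_sconst_mult: "sym_hom f (sconst c * x) = k c * sym_hom f x"
  unfolding sym_hom_def by (rule sym_ext_sconst_mult[OF multilinear_prod])

lemma sym_hom_smono: "sym_hom f (smono M) = prod_mset (image_mset f M)"
  using sym_ext_smono[OF multilinear_prod, of 1 M] by (simp add: sym_hom_def k_1)

lemma sym_hom_sconst: "sym_hom f (sconst c) = k c"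
  using sym_hom_sconst_mult[of c 1] sym_hom_smono[of "{#}"] by simp

lemma sym_hom_sgen: "sym_hom f (sgen v) = f v"
  using sym_hom_smono[of "{#v#}"] by simp

lemma sym_hom_mult: "sym_hom f (x * y) = sym_hom f x * sym_hom f y"
proof (induction x rule: sym_induct_smono)
  case (smono M c)
  show ?case
  proof (induction y rule: sym_induct_smono)
    case (smono N d)
    have "sconst c * smono M * (sconst d * smono N) = sconst c * (sconst d * smono (M + N))"
      by (simp only: smono_simps mult.assoc mult.left_commute)
    also have "sym_hom f \<dots> = k c * (k d * (prod_mset (image_mset f M) * prod_mset (image_mset f N)))"
      by (simp only: sym_hom_sconst_mult sym_hom_smono image_mset_union prod_mset_Un)
    finally show ?case
      by (simp only: sym_hom_sconst_mult sym_hom_smono mult.assoc mult.left_commute)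
  qed (simp add: distrib_left sym_hom_add)
qed (simp add: distrib_right sym_hom_add)

end

end

interpretation sc: scalar_hom "sconst :: complex \<Rightarrow> 'v::complex_vector sym"
  by standard (simp_all add: sconst_add sconst_mult)

interpretation pc: scalar_hom "\<lambda>c. [:sconst c :: 'v::complex_vector sym:]"
  by standard (simp_all add: sconst_add sconst_mult)

interpretation cc: scalar_hom "\<lambda>c::complex. c"
  by standard simp_all

lemma sconst_diff: "sconst (a - b) = sconst a - sconst b"
  using sconst_add[of a "- b"] by (simp add: sconst_uminus)

subsection \<open>Derivations of a symmetric algebra\<close>

text \<open>
  \<open>v \<mapsto> v + \<epsilon> g v\<close> extends to an algebra homomorphism modulo \<open>\<epsilon>\<^sup>2\<close>; the derivation that extends \<open>g\<close>
  is its coefficient of \<open>\<epsilon>\<close>.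
\<close>

definition der :: "('v::complex_vector \<Rightarrow> 'v sym) \<Rightarrow> 'v sym \<Rightarrow> 'v sym" where
  "der g x = coeff (pc.sym_hom (\<lambda>v. [:sgen v, g v:]) x) 1"

context
  fixes g :: "'v::complex_vector \<Rightarrow> 'v sym"
  assumes g: "sc.alg_linear g"
begin

lemma dual_alg_linear: "pc.alg_linear (\<lambda>v. [:sgen v, g v:])"
  using g by (simp add: pc.alg_linear_def sc.alg_linear_def sgen_add sgen_scaleC)

text \<open>This turns multiplicativity into the Leibniz rule: the coefficient of degree 1 of a
  product combines the coefficients of degrees 0 and 1, and those of degree 0 give back the
  arguments. Working modulo the square of the variable amounts to reading only these two
  coefficients.\<close>

lemma dual_hom_coeff_0: "coeff (pc.sym_hom (\<lambda>v. [:sgen v, g v:]) x) 0 = x"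
  by (induction x rule: sym_induct)
     (simp_all add: pc.sym_hom_sconst pc.sym_hom_sgen pc.sym_hom_add pc.sym_hom_mult dual_alg_linear
        coeff_mult)

lemma der_add: "der g (x + y) = der g x + der g y"
  by (simp add: der_def pc.sym_hom_add dual_alg_linear)

lemma der_mult: "der g (x * y) = der g x * y + x * der g y"
  by (simp add: der_def pc.sym_hom_mult dual_alg_linear coeff_mult dual_hom_coeff_0)

lemma der_sgen: "der g (sgen v) = g v"
  by (simp add: der_def pc.sym_hom_sgen dual_alg_linear)

lemma der_sconst: "der g (sconst c) = 0"
  by (simp add: der_def pc.sym_hom_sconst dual_alg_linear)

lemma der_1: "der g 1 = 0"
  using der_sconst[of 1] by simp

lemma der_0: "der g 0 = 0"
  using der_sconst[of 0] by simp

lemma der_sconst_mult: "der g (sconst c * x) = sconst c * der g x"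
  by (simp add: der_mult der_sconst)

end

lemmas der_simps = der_add der_mult der_sgen der_sconst der_1 der_0 der_sconst_mult

lemma alg_linear_plus: "sc.alg_linear g \<Longrightarrow> sc.alg_linear h \<Longrightarrow> sc.alg_linear (\<lambda>v. g v + h v)"
  by (simp add: sc.alg_linear_def algebra_simps)

lemma alg_linear_times: "sc.alg_linear g \<Longrightarrow> sc.alg_linear (\<lambda>v. y * g v)"
  by (simp add: sc.alg_linear_def algebra_simps)

lemma alg_linear_sconst: "cc.alg_linear \<mu> \<Longrightarrow> sc.alg_linear (\<lambda>v::'v::complex_vector. sconst (\<mu> v) :: 'v sym)"
  by (simp add: sc.alg_linear_def cc.alg_linear_def sconst_add sconst_mult)

lemma alg_linear_sgen: "sc.alg_linear sgen"
  by (simp add: sc.alg_linear_def sgen_add sgen_scaleC)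

lemma der_plus:
  assumes "sc.alg_linear g" "sc.alg_linear h"
  shows "der (\<lambda>v. g v + h v) x = der g x + der h x"
  using assms alg_linear_plus[OF assms]
  by (induction x rule: sym_induct) (simp_all add: der_simps algebra_simps)

lemma der_times:
  assumes "sc.alg_linear g"
  shows "der (\<lambda>v. y * g v) x = y * der g x"
  using assms alg_linear_times[OF assms, of y]
  by (induction x rule: sym_induct) (simp_all add: der_simps algebra_simps)

text \<open>The composites are not derivations, but on a product the two orders only exchange the
  cross terms, so induction goes through. On generators both sides are 0, because a functional
  produces constants.\<close>

lemma der_commute:
  assumes "cc.alg_linear \<mu>" "cc.alg_linear \<nu>"
  shows "der (\<lambda>v. sconst (\<mu> v)) (der (\<lambda>v. sconst (\<nu> v)) x)
       = der (\<lambda>v. sconst (\<nu> v)) (der (\<lambda>v. sconst (\<mu> v)) x)"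
  using assms[THEN alg_linear_sconst]
  by (induction x rule: sym_induct) (simp_all add: der_simps algebra_simps)

lemma zero_in_Sym: "0 \<in> Sym V" and one_in_Sym: "1 \<in> Sym V"
  using Sym.const[of 0 V] Sym.const[of 1 V] by auto

lemma der_in_Sym:
  assumes "cc.alg_linear \<mu>" "x \<in> Sym V"
  shows "der (\<lambda>v. sconst (\<mu> v)) x \<in> Sym V"
  using assms(2) alg_linear_sconst[OF assms(1)]
  by induction (auto simp: der_simps intro: Sym.intros zero_in_Sym)

lemma der_cong_Sym:
  assumes "sc.alg_linear g" "sc.alg_linear h" "\<And>v. v \<in> V \<Longrightarrow> g v = h v" "x \<in> Sym V"
  shows "der g x = der h x"
  using assms(4) by induction (simp_all add: der_simps assms)

lemma Sym_mono: "x \<in> Sym V \<Longrightarrow> V \<subseteq> W \<Longrightarrow> x \<in> Sym W"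
  by (induction rule: Sym.induct) (auto intro: Sym.intros)

text \<open>This makes finite-rank operators sufficient: an element involves only finitely many
  generators, and an operator that fixes those acts on it like the identity.\<close>

lemma Sym_finite_support:
  assumes "x \<in> Sym V"
  obtains S where "finite S" "S \<subseteq> V" "x \<in> Sym S"
proof -
  have "\<exists>S. finite S \<and> S \<subseteq> V \<and> x \<in> Sym S"
    using assms
  proof induction
    case (gen v)
    then show ?case by (intro exI[of _ "{v}"]) (auto intro: Sym.gen)
  next
    case (const c)
    show ?case by (intro exI[of _ "{}"]) (auto intro: Sym.const)
  next
    case (add x y)
    then obtain S T where "finite S" "S \<subseteq> V" "x \<in> Sym S" "finite T" "T \<subseteq> V" "y \<in> Sym T" by blast
    then show ?case
      by (intro exI[of _ "S \<union> T"]) (auto intro!: Sym.add intro: Sym_mono)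
  next
    case (mult x y)
    then obtain S T where "finite S" "S \<subseteq> V" "x \<in> Sym S" "finite T" "T \<subseteq> V" "y \<in> Sym T" by blast
    then show ?case
      by (intro exI[of _ "S \<union> T"]) (auto intro!: Sym.mult intro: Sym_mono)
  qed
  then show thesis using that by blast
qed

text \<open>Meant for arguments that move one generator at a time. The induction over
  \<open>Sym\<close> shows that left multiplication by \<open>x\<close> preserves \<open>P\<close>,
  a property stable under products by associativity.\<close>

lemma Sym_induct_left [consumes 1, case_names sconst add sgen_mult sconst_mult]:
  assumes "x \<in> Sym V"
    and sconst: "\<And>c. P (sconst c)"
    and add: "\<And>x y. x \<in> Sym V \<Longrightarrow> y \<in> Sym V \<Longrightarrow> P x \<Longrightarrow> P y \<Longrightarrow> P (x + y)"
    and sgen: "\<And>v x. v \<in> V \<Longrightarrow> x \<in> Sym V \<Longrightarrow> P x \<Longrightarrow> P (sgen v * x)"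
    and scale: "\<And>c x. x \<in> Sym V \<Longrightarrow> P x \<Longrightarrow> P (sconst c * x)"
  shows "P x"
proof -
  have "y \<in> Sym V \<and> P y \<Longrightarrow> x * y \<in> Sym V \<and> P (x * y)" for y
    using assms(1)
  proof (induction arbitrary: y)
    case (mult x x')
    then show ?case by (metis mult.assoc)
  qed (auto simp: distrib_right intro: assms Sym.intros)
  from this[of 1] show ?thesis using sconst[of 1] by (simp add: one_in_Sym)
qed

lemma vacuum_part_simps [simp]:
  "vacuum_part (x + y) = vacuum_part x + vacuum_part y"
  "vacuum_part (x * y) = vacuum_part x * vacuum_part y"
  "vacuum_part (sconst c) = c" "vacuum_part (sgen v) = 0"
  by (transfer, simp add: lookup_add lookup_times_empty lookup_single)+

lemma vacuum_part_01 [simp]: "vacuum_part 0 = 0" "vacuum_part 1 = 1"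
  using vacuum_part_simps(3)[of 0] vacuum_part_simps(3)[of 1] by (simp_all del: vacuum_part_simps)

subsection \<open>Derivations separate the elements of a symmetric algebra\<close>

text \<open>Euler's identity for the scaling \<open>v \<mapsto> t v\<close>, read off from the coefficients in \<open>t\<close>.\<close>

lemma
  fixes x :: "'v::complex_vector sym"
  defines "h \<equiv> pc.sym_hom (\<lambda>v::'v. [:0, sgen v:])"
  shows euler_coeff: "coeff (h (der sgen x)) n = of_nat n * coeff (h x) n"
    and scaling_coeff_0: "coeff (h x) 0 = sconst (vacuum_part x)"
    and scaling_at_1: "poly (h x) 1 = x"
proof -
  have lin: "pc.alg_linear (\<lambda>v::'v. [:0, sgen v:])"
    by (simp add: pc.alg_linear_def sgen_add sgen_scaleC)
  note [simp] = pc.sym_hom_sconst[OF lin] pc.sym_hom_sgen[OF lin] pc.sym_hom_add[OF lin]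
    pc.sym_hom_mult[OF lin] der_simps[OF alg_linear_sgen]
  show "coeff (h x) 0 = sconst (vacuum_part x)"
    unfolding h_def by (induction x rule: sym_induct) (simp_all add: sconst_add sconst_mult coeff_mult)
  show "poly (h x) 1 = x"
    unfolding h_def by (induction x rule: sym_induct) simp_all
  show "coeff (h (der sgen x)) n = of_nat n * coeff (h x) n"
  proof (induction x arbitrary: n rule: sym_induct)
    case (sconst c)
    then show ?case
      using pc.sym_hom_sconst[OF lin, of 0] by (cases n) (simp_all add: h_def)
  next
    case (sgen v)
    then show ?case by (cases n) (auto simp: h_def coeff_pCons split: nat.splits)
  next
    case (mult x y)
    have "coeff (h (der sgen (x * y))) n = (\<Sum>i\<le>n. of_nat i * coeff (h x) i * coeff (h y) (n - i))
        + (\<Sum>i\<le>n. coeff (h x) i * (of_nat (n - i) * coeff (h y) (n - i)))"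
      using mult by (simp add: h_def coeff_mult)
    also have "\<dots> = (\<Sum>i\<le>n. of_nat (i + (n - i)) * (coeff (h x) i * coeff (h y) (n - i)))"
      unfolding sum.distrib[symmetric] by (intro sum.cong refl) (simp only: of_nat_add algebra_simps)
    also have "\<dots> = of_nat n * coeff (h (x * y)) n"
      by (simp add: h_def coeff_mult sum_distrib_left)
    finally show ?case .
  qed (simp add: h_def distrib_left)
qed

lemma of_nat_eq_sconst: "of_nat n = sconst (of_nat n)"
  by (induction n) (simp_all add: sconst_add)

text \<open>By Euler's identity \<open>n\<close> times the coefficient of degree \<open>n\<close>
  vanishes. Positive integers are invertible complex scalars, which permits the cancellation of
  \<open>n\<close> in a ring not known to be a domain; evaluation at 1 then recovers
  \<open>x\<close> from its constant coefficient.\<close>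

lemma euler_zero:
  fixes x :: "'v::complex_vector sym"
  assumes "der sgen x = 0"
  shows "x = sconst (vacuum_part x)"
proof -
  let ?h = "pc.sym_hom (\<lambda>v::'v. [:0, sgen v:])"
  have "?h 0 = 0"
    using pc.sym_hom_sconst[of "\<lambda>v::'v. [:0, sgen v:]" 0]
    by (simp add: pc.alg_linear_def sgen_add sgen_scaleC)
  then have "of_nat n * coeff (?h x) n = 0" for n
    using euler_coeff[of x n] assms by simp
  from this[unfolded of_nat_eq_sconst] have "coeff (?h x) n = 0" if "n > 0" for n
    using that by (rule_tac sconst_mult_cancel[of "of_nat n" "coeff (?h x) n"]) auto
  then have "?h x = [:sconst (vacuum_part x):]"
    by (intro poly_eqI) (auto simp: scaling_coeff_0 coeff_pCons split: nat.splits)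
  then show ?thesis using scaling_at_1[of x] by simp
qed

text \<open>
  On a finite set the identity is a finite-rank operator \<open>T\<close> built from functionals in \<open>E\<close>, so an
  element killed by all derivations from \<open>E\<close> is killed by the Euler derivation.
\<close>

lemma finite_rank_identity:
  fixes S V :: "'v::complex_vector set" and E :: "('v \<Rightarrow> complex) set"
  assumes "finite S" "S \<subseteq> V" and V: "cv.subspace V"
    and lin: "\<And>\<mu>. \<mu> \<in> E \<Longrightarrow> cc.alg_linear \<mu>"
    and sep: "\<And>v. v \<in> V \<Longrightarrow> (\<And>\<mu>. \<mu> \<in> E \<Longrightarrow> \<mu> v = 0) \<Longrightarrow> v = 0"
  shows "\<exists>T. (\<forall>a b. T (a + b) = T a + T b) \<and> (\<forall>c a. T (c *\<^sub>C a) = c *\<^sub>C T a) \<and> range T \<subseteq> V \<and>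
    (\<forall>s\<in>S. T s = s) \<and>
    (\<forall>x g. (\<forall>\<mu>\<in>E. der (\<lambda>v. sconst (\<mu> v)) x = 0) \<longrightarrow> sc.alg_linear g \<longrightarrow> der (\<lambda>v. g (T v)) x = 0)"
  using assms(1,2)
proof (induction S)
  case empty
  have "der (\<lambda>v. g 0) x = 0" if "sc.alg_linear g" for g :: "'v \<Rightarrow> 'v sym" and x
  proof -
    have "g 0 = 0" using that by (metis add_cancel_right_right sc.alg_linear_def)
    moreover have z: "sc.alg_linear (\<lambda>v::'v. 0)" by (simp add: sc.alg_linear_def)
    moreover have "der (\<lambda>v. 0) x = 0"
      using der_times[OF z, of 0 x] by simp
    ultimately show ?thesis by simp
  qed
  then show ?case using V by (intro exI[of _ "\<lambda>_. 0"]) (auto simp: cv.subspace_0)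
next
  case (insert v S)
  then have "S \<subseteq> V" by simp
  from insert.IH[OF this] obtain T
    where Tlin: "\<forall>a b. T (a + b) = T a + T b" "\<forall>c a. T (c *\<^sub>C a) = c *\<^sub>C T a" and TV: "range T \<subseteq> V"
      and TS: "\<forall>s\<in>S. T s = s"
      and Tdr: "\<forall>x g. (\<forall>\<mu>\<in>E. der (\<lambda>v. sconst (\<mu> v)) x = 0) \<longrightarrow> sc.alg_linear g
        \<longrightarrow> der (\<lambda>v. g (T v)) x = 0"
    by (elim exE conjE) (rule that)
  note T = Tlin[rule_format] TV TS[rule_format]
  note Tder = Tdr[THEN spec, THEN spec, THEN mp, THEN mp]
  show ?case
  proof (cases "v = T v")
    case True
    with Tlin TV TS Tdr show ?thesis by (intro exI[of _ T]) auto
  next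
    case False
    define v' where "v' = v - T v"
    have "v' \<in> V" using insert.prems T(3) V by (auto simp: v'_def intro: cv.subspace_diff)
    moreover have "v' \<noteq> 0" using False by (simp add: v'_def)
    ultimately obtain \<mu> where mu: "\<mu> \<in> E" "\<mu> v' \<noteq> 0" using sep by blast
    have mu_lin: "\<mu> (a + b) = \<mu> a + \<mu> b" "\<mu> (c *\<^sub>C a) = c * \<mu> a" for a b c
      using lin[OF mu(1)] by (auto simp: cc.alg_linear_def)
    have mu_diff: "\<mu> (a - b) = \<mu> a - \<mu> b" for a b
      using mu_lin(1)[of "a - b" b] by simp
    \<comment> \<open>\<open>T\<close> misses \<open>v\<close> by \<open>v'\<close>, which lies in
      \<open>V\<close> because \<open>range T\<close> does, so some functional of \<open>E\<close>
      detects it. The rank-one correction uses \<open>\<mu> o (id - T)\<close>, which vanishes on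
      \<open>S\<close>, scaled to be 1 at \<open>v\<close>.\<close>
    define \<nu> where "\<nu> u = inverse (\<mu> v') * (\<mu> u + (-1) * \<mu> (T u))" for u
    define T' where "T' u = T u + \<nu> u *\<^sub>C v'" for u
    have "\<nu> v = 1" using mu mu_diff[of v "T v"] by (simp add: \<nu>_def v'_def)
    have "der (\<lambda>u. g (T' u)) x = 0"
      if x: "\<forall>\<mu>\<in>E. der (\<lambda>v. sconst (\<mu> v)) x = 0" and g: "sc.alg_linear g" for x g
    proof -
      let ?i = "sconst (inverse (\<mu> v')) :: 'v sym"
      \<comment> \<open>\<open>g o T'\<close> is a combination, with coefficients in the algebra, of
        \<open>g o T\<close>, \<open>\<mu>\<close> and \<open>\<mu> o T\<close>. The induction
        hypothesis is stated for every \<open>g\<close>, so it also covers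
        \<open>\<mu> o T\<close>.\<close>
      have eq: "g (T' u) = g (T u) + g v' * (?i * (sconst (\<mu> u) + (-1) * sconst (\<mu> (T u))))" for u
      proof -
        have "g (T' u) = g (T u) + g v' * sconst (\<nu> u)"
          using g by (simp add: T'_def sc.alg_linear_def mult.commute)
        also have "sconst (\<nu> u) = ?i * (sconst (\<mu> u) + (-1) * sconst (\<mu> (T u)))"
          by (simp add: \<nu>_def sconst_mult sconst_diff)
        finally show ?thesis .
      qed
      have lmu: "sc.alg_linear (\<lambda>u. sconst (\<mu> u) :: 'v sym)"
        by (intro alg_linear_sconst lin mu)
      have lins: "sc.alg_linear (\<lambda>u. sconst (\<mu> (T u)) :: 'v sym)" "sc.alg_linear (\<lambda>u. g (T u))"
        using lmu g T by (auto simp: sc.alg_linear_def)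
      show ?thesis
        unfolding eq
        by (simp only: der_plus der_times lmu lins alg_linear_plus alg_linear_times Tder[OF x g] Tder[OF x lmu]
              x[rule_format, OF mu(1)] mult_zero_right add_0)
    qed
    moreover have "T' s = s" if "s \<in> insert v S" for s
      using that \<open>\<nu> v = 1\<close> T(4)[of s] by (auto simp: T'_def v'_def \<nu>_def scaleC_one)
    moreover have "range T' \<subseteq> V"
      using T(3) \<open>v' \<in> V\<close> V by (auto simp: T'_def intro!: cv.subspace_add cv.subspace_scale)
    moreover have "T' (a + b) = T' a + T' b" "T' (c *\<^sub>C a) = c *\<^sub>C T' a" for a b c
    proof -
      have "\<nu> (a + b) = \<nu> a + \<nu> b" "\<nu> (c *\<^sub>C a) = c * \<nu> a" for a b c
        by (simp_all add: \<nu>_def T mu_lin algebra_simps)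
      then show "T' (a + b) = T' a + T' b" "T' (c *\<^sub>C a) = c *\<^sub>C T' a"
        by (simp_all add: T'_def T scaleC_add_left scaleC_add_right scaleC_scaleC)
    qed
    ultimately show ?thesis by (intro exI[of _ T']) blast
  qed
qed

lemma der_zero_imp_const:
  fixes V :: "'v::complex_vector set" and E :: "('v \<Rightarrow> complex) set"
  assumes V: "cv.subspace V"
    and lin: "\<And>\<mu>. \<mu> \<in> E \<Longrightarrow> cc.alg_linear \<mu>"
    and sep: "\<And>v. v \<in> V \<Longrightarrow> (\<And>\<mu>. \<mu> \<in> E \<Longrightarrow> \<mu> v = 0) \<Longrightarrow> v = 0"
    and x: "x \<in> Sym V" "\<And>\<mu>. \<mu> \<in> E \<Longrightarrow> der (\<lambda>v. sconst (\<mu> v)) x = 0"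
  shows "x = sconst (vacuum_part x)"
proof -
  obtain S where S: "finite S" "S \<subseteq> V" "x \<in> Sym S"
    using Sym_finite_support[OF x(1)] .
  have "\<exists>T. (\<forall>a b. T (a + b) = T a + T b) \<and> (\<forall>c a. T (c *\<^sub>C a) = c *\<^sub>C T a) \<and> range T \<subseteq> V \<and>
    (\<forall>s\<in>S. T s = s) \<and>
    (\<forall>x g. (\<forall>\<mu>\<in>E. der (\<lambda>v. sconst (\<mu> v)) x = 0) \<longrightarrow> sc.alg_linear g \<longrightarrow> der (\<lambda>v. g (T v)) x = 0)"
    by (rule finite_rank_identity[OF S(1,2) V]) (fact lin sep)+
  then obtain T where Tlin: "\<forall>a b. T (a + b) = T a + T b" "\<forall>c a. T (c *\<^sub>C a) = c *\<^sub>C T a"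
    and TS: "\<forall>s\<in>S. T s = s"
    and Tder: "\<forall>x g. (\<forall>\<mu>\<in>E. der (\<lambda>v. sconst (\<mu> v)) x = 0) \<longrightarrow> sc.alg_linear g
      \<longrightarrow> der (\<lambda>v. g (T v)) x = 0"
    by (elim exE conjE) (rule that)
  have "der (\<lambda>v. sgen (T v)) x = 0"
    by (rule Tder[THEN spec, THEN spec, THEN mp, THEN mp]) (simp_all add: x(2) alg_linear_sgen)
  have "der (\<lambda>v. sgen (T v)) x = der sgen x"
    using Tlin TS S(3) by (intro der_cong_Sym[of _ _ S])
      (auto simp: alg_linear_sgen sc.alg_linear_def sgen_add sgen_scaleC)
  with \<open>der (\<lambda>v. sgen (T v)) x = 0\<close> show ?thesis by (intro euler_zero) simp
qed

text \<open>The filtration by degree, encoded through iterated contraction instead of a grading: one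
  derivation lowers the index by definition. It supplies the induction measure for
  \<open>correlations_separate\<close>.\<close>

primrec degree_le :: "nat \<Rightarrow> 'v::complex_vector sym \<Rightarrow> bool" where
  "degree_le 0 x \<longleftrightarrow> x \<in> range sconst"
| "degree_le (Suc n) x \<longleftrightarrow> (\<forall>\<mu>. cc.alg_linear \<mu> \<longrightarrow> degree_le n (der (\<lambda>v. sconst (\<mu> v)) x))"

lemma degree_le_sconst: "degree_le n (sconst c)"
proof (induction n arbitrary: c)
  case (Suc n)
  from Suc[of 0] show ?case by (auto simp: der_simps alg_linear_sconst)
qed simp

lemma degree_le_sconst_mult: "degree_le n x \<Longrightarrow> degree_le n (sconst c * x)"
  by (induction n arbitrary: x) (auto simp: der_simps alg_linear_sconst simp flip: sconst_mult)

lemma degree_le_add: "degree_le n x \<Longrightarrow> degree_le n y \<Longrightarrow> degree_le n (x + y)"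
  by (induction n arbitrary: x y) (auto simp: der_simps alg_linear_sconst simp flip: sconst_add)

lemma degree_le_Suc: "degree_le n x \<Longrightarrow> degree_le (Suc n) x"
proof (induction n arbitrary: x)
  case 0
  then show ?case by (auto simp: der_simps alg_linear_sconst intro: range_eqI[of _ _ 0])
qed simp

lemma degree_le_mono: "degree_le n x \<Longrightarrow> n \<le> m \<Longrightarrow> degree_le m x"
  by (induction m) (auto simp del: degree_le.simps simp: le_Suc_eq intro: degree_le_Suc)

text \<open>By Leibniz each summand of the derivative differentiates one factor, which lowers the
  sum of the two bounds by one. A factor with bound 0 is a scalar and is treated apart.\<close>

lemma degree_le_mult: "degree_le m x \<Longrightarrow> degree_le n y \<Longrightarrow> degree_le (m + n) (x * y)"
proof (induction "m + n" arbitrary: m n x y)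
  case 0
  then show ?case by (auto simp flip: sconst_mult)
next
  case (Suc k)
  show ?case
  proof (cases "m = 0 \<or> n = 0")
    case True
    then show ?thesis
    proof
      assume "m = 0"
      with Suc.prems show ?thesis by (auto intro: degree_le_sconst_mult)
    next
      assume "n = 0"
      with Suc.prems obtain c where "y = sconst c" "degree_le m x" by auto
      then show ?thesis
        using \<open>n = 0\<close> degree_le_sconst_mult[of m x c] by (simp add: mult.commute)
    qed
  next
    case False
    then obtain m' n' where mn: "m = Suc m'" "n = Suc n'" by (metis not0_implies_Suc)
    have "degree_le (m' + Suc n') (der (\<lambda>v. sconst (\<mu> v)) x * y + x * der (\<lambda>v. sconst (\<mu> v)) y)"
      if "cc.alg_linear \<mu>" for \<mu>
    proof (rule degree_le_add)
      show "degree_le (m' + Suc n') (der (\<lambda>v. sconst (\<mu> v)) x * y)"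
        using Suc.prems Suc.hyps(2) that mn by (intro Suc.hyps(1)) auto
      have "degree_le (m + n') (x * der (\<lambda>v. sconst (\<mu> v)) y)"
        using Suc.prems Suc.hyps(2) that mn(2) by (intro Suc.hyps(1)) auto
      then show "degree_le (m' + Suc n') (x * der (\<lambda>v. sconst (\<mu> v)) y)" by (simp add: mn)
    qed
    then show ?thesis by (simp add: mn der_simps alg_linear_sconst)
  qed
qed

lemma degree_le_exists: "\<exists>n. degree_le n x"
proof (induction x rule: sym_induct)
  case (sconst c)
  then show ?case using degree_le_sconst by blast
next
  case (sgen v)
  have "degree_le (Suc 0) (sgen v)" by (simp add: der_simps alg_linear_sconst)
  then show ?case by blast
next
  case (add x y)
  then obtain m n where "degree_le m x" "degree_le n y" by blast
  then have "degree_le (max m n) (x + y)"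
    by (intro degree_le_add) (auto intro: degree_le_mono)
  then show ?case by blast
next
  case (mult x y)
  then show ?case using degree_le_mult by blast
qed

text \<open>A correlation function of \<open>x\<close> differentiated at \<open>p\<close> is one of
  \<open>x\<close> with \<open>p\<close> appended, since \<open>foldr\<close> applies the last entry
  of the list first. Hence by induction on the degree all these derivatives vanish, \<open>x\<close>
  is a constant, and the empty list shows that this constant is 0.\<close>

lemma correlations_separate:
  fixes V :: "'v::complex_vector set" and \<mu> :: "'p \<Rightarrow> 'v \<Rightarrow> complex"
  assumes V: "cv.subspace V"
    and lin: "\<And>p. p \<in> P \<Longrightarrow> cc.alg_linear (\<mu> p)"
    and sep: "\<And>v. v \<in> V \<Longrightarrow> (\<And>p. p \<in> P \<Longrightarrow> \<mu> p v = 0) \<Longrightarrow> v = 0"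
    and x: "x \<in> Sym V"
    and corr: "\<And>ps. set ps \<subseteq> P \<Longrightarrow> vacuum_part (foldr (\<lambda>p. der (\<lambda>v. sconst (\<mu> p v))) ps x) = 0"
  shows "x = 0"
proof -
  obtain n where "degree_le n x" using degree_le_exists by blast
  then show ?thesis
    using x corr
  proof (induction n arbitrary: x)
    case 0
    then show ?case using "0.prems"(3)[of "[]"] by auto
  next
    case (Suc n)
    have "der (\<lambda>v. sconst (\<mu> p v)) x = 0" if "p \<in> P" for p
    proof (rule Suc.IH)
      fix ps assume "set ps \<subseteq> P"
      then show "vacuum_part (foldr (\<lambda>p. der (\<lambda>v. sconst (\<mu> p v))) ps (der (\<lambda>v. sconst (\<mu> p v)) x)) = 0"
        using Suc.prems(3)[of "ps @ [p]"] that by simp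
    qed (use Suc.prems that in \<open>auto intro!: der_in_Sym lin\<close>)
    then have "x = sconst (vacuum_part x)"
      using Suc.prems(2) by (intro der_zero_imp_const[OF V, of "\<mu> ` P"]) (auto intro: lin sep)
    moreover have "vacuum_part x = 0" using Suc.prems(3)[of "[]"] by simp
    ultimately show ?case by simp
  qed
qed

subsection \<open>The pairing induced by a bilinear form\<close>

locale bilinear_form =
  fixes b :: "'v::complex_vector \<Rightarrow> 'v \<Rightarrow> complex"
  assumes lin_left: "cc.alg_linear (\<lambda>u. b u v)" and lin_right: "cc.alg_linear (b u)"
begin

abbreviation contract :: "'v \<Rightarrow> 'v sym \<Rightarrow> 'v sym" where
  "contract u \<equiv> der (\<lambda>v. sconst (b u v))"

text \<open>On two monomials of equal degree this is the permanent of the matrix of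
  \<open>b\<close>, and on monomials of different degrees it is 0. Folding over a multiset is
  legitimate because contractions commute.\<close>

definition pairing :: "'v sym \<Rightarrow> 'v sym \<Rightarrow> complex" where
  "pairing x y = cc.sym_ext (\<lambda>M. vacuum_part (fold_mset contract y M)) x"

sublocale contract: comp_fun_commute contract
  by standard (rule ext, simp add: der_commute[OF lin_right lin_right])

lemmas contract_simps = der_simps[OF alg_linear_sconst[OF lin_right]]

lemma contract_add: "contract (u + u') x = contract u x + contract u' x"
proof -
  have "(\<lambda>v. sconst (b (u + u') v) :: 'v sym) = (\<lambda>v. sconst (b u v) + sconst (b u' v))"
    using lin_left by (simp add: cc.alg_linear_def sconst_add)
  then show ?thesis by (simp add: der_plus alg_linear_sconst lin_right)
qed

lemma contract_scale: "contract (c *\<^sub>C u) x = sconst c * contract u x"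
proof -
  have "(\<lambda>v. sconst (b (c *\<^sub>C u) v) :: 'v sym) = (\<lambda>v. sconst c * sconst (b u v))"
    using lin_left by (simp add: cc.alg_linear_def sconst_mult)
  then show ?thesis by (simp add: der_times alg_linear_sconst lin_right)
qed

lemma fold_contract_add: "fold_mset contract (x + y) M = fold_mset contract x M + fold_mset contract y M"
  by (induction M) (simp_all add: contract_simps)

lemma fold_contract_scale: "fold_mset contract (sconst c * x) M = sconst c * fold_mset contract x M"
  by (induction M) (simp_all add: contract_simps)

lemma multilinear_fold: "cc.multilinear (\<lambda>M. vacuum_part (fold_mset contract y M))"
  by (simp add: cc.multilinear_def contract_add contract_scale)

lemma pairing_add_left: "pairing (x + x') y = pairing x y + pairing x' y"
  unfolding pairing_def by (rule cc.sym_ext_add[OF multilinear_fold])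

lemma pairing_scale_left: "pairing (sconst c * x) y = c * pairing x y"
  unfolding pairing_def by (rule cc.sym_ext_sconst_mult[OF multilinear_fold])

lemma pairing_smono: "pairing (smono M) y = vacuum_part (fold_mset contract y M)"
  using cc.sym_ext_smono[OF multilinear_fold, of y 1 M] by (simp add: pairing_def)

lemma pairing_add_right: "pairing x (y + y') = pairing x y + pairing x y'"
  by (induction x rule: sym_induct_smono)
     (simp_all add: pairing_add_left pairing_scale_left pairing_smono fold_contract_add distrib_left)

lemma pairing_scale_right: "pairing x (sconst c * y) = c * pairing x y"
  by (induction x rule: sym_induct_smono)
     (simp_all add: pairing_add_left pairing_scale_left pairing_smono fold_contract_scale distrib_left)

lemma pairing_1: "pairing 1 y = vacuum_part y"
  using pairing_smono[of "{#}" y] by simp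

lemma pairing_sgen_left: "pairing (sgen u * x) y = pairing x (contract u y)"
proof (induction x rule: sym_induct_smono)
  case (smono M c)
  have "pairing (smono (add_mset u M)) y = pairing (smono M) (contract u y)"
    unfolding pairing_smono by (simp only: contract.fold_mset_add_mset contract.fold_mset_fun_left_comm)
  then show ?case
    by (simp add: mult.left_commute[of "sgen u"] pairing_scale_left)
qed (simp add: distrib_left pairing_add_left)

text \<open>The definition strips generators from the left argument, so this side needs induction on
  the left monomial: contracting \<open>sgen v * y\<close> with \<open>u\<close> gives
  \<open>b u v\<close> times \<open>y\<close> plus \<open>sgen v\<close> times the contraction of
  \<open>y\<close>, which matches the Leibniz rule on the left.\<close>

lemma pairing_sgen_right: "pairing x (sgen v * y) = pairing (der (\<lambda>u. sconst (b u v)) x) y"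
proof -
  note d = der_simps[OF alg_linear_sconst[OF lin_left]]
  have *: "pairing (smono M) (sgen v * y) = pairing (der (\<lambda>u. sconst (b u v)) (smono M)) y" for M y
  proof (induction M arbitrary: y)
    case empty
    show ?case using pairing_scale_left[of 0 1] by (simp add: pairing_1 d)
  next
    case (add u M)
    then show ?case
      by (simp add: pairing_sgen_left contract_simps d pairing_add_left pairing_add_right
          pairing_scale_right pairing_scale_left)
  qed
  show ?thesis
    by (induction x rule: sym_induct_smono) (simp_all add: d pairing_add_left pairing_scale_left *)
qed

end

subsection \<open>Charts and Lie derivatives\<close>

definition chart_pt :: "point \<Rightarrow> complex \<Rightarrow> point" where
  "chart_pt p u = (case p of Some _ \<Rightarrow> Some u | None \<Rightarrow> if u = 0 then None else Some (1 / u))"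

text \<open>In the chart at infinity this is \<open>dz/dw\<close>, except that at
  \<open>u = 0\<close> it is 1: the value of a section at \<open>None\<close> is already its
  coefficient with respect to \<open>dw\<close>.\<close>

definition chart_jac :: "point \<Rightarrow> complex \<Rightarrow> complex" where
  "chart_jac p u = (case p of Some _ \<Rightarrow> 1 | None \<Rightarrow> if u = 0 then 1 else - 1 / u ^ 2)"

lemma form_coeff_eq: "form_coeff p s u = chart_jac p u * s (chart_pt p u)"
  by (simp add: form_coeff_def chart_jac_def chart_pt_def split: option.splits)

lemma chart_base [simp]: "chart_pt p (base p) = p" "chart_jac p (base p) = 1"
  by (cases p; simp add: chart_pt_def chart_jac_def)+

text \<open>In the chart at infinity only \<open>0\<close> escapes the continuity of the inversion.
  An open set containing \<open>None\<close> contains all finite points outside some disc, hence a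
  disc around \<open>0\<close> in the coordinate \<open>1 / z\<close>.\<close>

lemma open_chart_preimage:
  assumes D: "openin sphere_topology D"
  shows "open {u. chart_pt p u \<in> D}"
proof -
  have *: "open {u. Some u \<in> D} \<and> (None \<in> D \<longrightarrow> (\<exists>R. \<forall>u. norm u > R \<longrightarrow> Some u \<in> D))"
    using D unfolding sphere_topology_def openin_Alexandroff_compactification
  proof (elim disjE exE conjE)
    fix U assume "openin euclidean U" "D = Some ` U"
    then show ?thesis by (auto simp: image_iff)
  next
    fix C :: "complex set"
    assume C: "compactin euclidean C" "closedin euclidean C"
      and D: "D = insert None (Some ` (topspace euclidean - C))"
    have "bounded C" using C by (auto intro: compact_imp_bounded)
    then obtain R where "\<And>x. x \<in> C \<Longrightarrow> norm x \<le> R" unfolding bounded_iff by blast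
    then have "Some u \<in> D" if "norm u > R" for u using that by (auto simp: D image_iff not_le[symmetric])
    moreover have "{u. Some u \<in> D} = - C" by (auto simp: D image_iff)
    ultimately show ?thesis using C by auto
  qed
  show ?thesis
  proof (cases p)
    case (Some a)
    then show ?thesis using * by (simp add: chart_pt_def)
  next
    case None
    let ?S = "{u. chart_pt None u \<in> D}" and ?I = "{u. Some u \<in> D}"
    have "open (- {0} \<inter> (\<lambda>u. 1 / u) -` ?I)"
      by (rule continuous_open_preimage) (auto intro!: continuous_intros simp: *)
    moreover have "- {0} \<inter> (\<lambda>u. 1 / u) -` ?I = ?S - {0}"
      by (auto simp: chart_pt_def split: if_splits)
    ultimately have punctured: "open (?S - {0})" by simp
    show ?thesis
    proof (cases "None \<in> D")
      case False
      then have "?S - {0} = ?S" by (auto simp: chart_pt_def)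
      with punctured show ?thesis by (simp add: None)
    next
      case True
      with * obtain R where R: "\<And>u. norm u > R \<Longrightarrow> Some u \<in> D" by blast
      \<comment> \<open>\<open>R\<close> may be negative or 0; the absolute value and the added 1
        keep \<open>r\<close> positive.\<close>
      define r where "r = 1 / (\<bar>R\<bar> + 1)"
      have "r > 0" by (simp add: r_def add_nonneg_pos)
      have "u \<in> ?S" if "u \<in> ball 0 r" for u
      proof (cases "u = 0")
        case False
        then have "norm (1 / u) > \<bar>R\<bar> + 1"
          using that by (simp add: r_def norm_divide field_simps)
        then show ?thesis using False R[of "1 / u"] by (simp add: chart_pt_def)
      qed (use True in \<open>simp add: chart_pt_def\<close>)
      then have "?S = (?S - {0}) \<union> ball 0 r" using \<open>r > 0\<close> by auto
      then show ?thesis using punctured by (metis None open_Un open_ball)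
    qed
  qed
qed

lemma analytic_inverse_chart:
  fixes F :: "complex \<Rightarrow> complex"
  assumes "F analytic_on {u}" "u \<noteq> 0"
  shows "(\<lambda>x. F (1 / x)) analytic_on {1 / u}"
proof -
  have "(F \<circ> (\<lambda>x. 1 / x)) analytic_on {1 / u}"
    using assms by (intro analytic_on_compose analytic_intros) auto
  then show ?thesis by (simp add: o_def)
qed

lemma analytic_inverse_chart':
  fixes F :: "complex \<Rightarrow> complex"
  assumes "F analytic_on {1 / u}" "u \<noteq> 0"
  shows "(\<lambda>x. F (1 / x)) analytic_on {u}"
  using analytic_inverse_chart[of F "1 / u"] assms by simp

lemma eventually_neq_nhds: "(u::complex) \<noteq> a \<Longrightarrow> eventually (\<lambda>x. x \<noteq> a) (nhds u)"
  using eventually_nhds_in_open[of "- {a}" u] by auto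

text \<open>Regularity is required at the base point of each chart only; the other points of the
  chart at infinity are finite points seen through the inversion.\<close>

lemma vec_coeff_analytic:
  assumes "regular_vector_field X"
  shows "vec_coeff p X analytic_on {u}"
proof (cases p)
  case (Some a)
  then show ?thesis
    using assms[unfolded regular_vector_field_def, rule_format, of "Some u"] by (simp add: vec_coeff_def)
next
  case None
  show ?thesis
  proof (cases "u = 0")
    case True
    then show ?thesis
      using assms[unfolded regular_vector_field_def, rule_format, of None] by (simp add: None)
  next
    case False
    have "(\<lambda>x. X (Some x)) analytic_on {1 / u}"
      using assms[unfolded regular_vector_field_def, rule_format, of "Some (1 / u)"]
      by (simp add: vec_coeff_def)
    then have "(\<lambda>w. - (w ^ 2) * X (Some (1 / w))) analytic_on {u}"
      using False by (intro analytic_intros analytic_inverse_chart') auto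
    moreover have "vec_coeff None X analytic_on {u} \<longleftrightarrow> (\<lambda>w. - (w ^ 2) * X (Some (1 / w))) analytic_on {u}"
      by (intro analytic_at_cong eventually_mono[OF eventually_neq_nhds[OF False]])
        (auto simp: vec_coeff_def)
    ultimately show ?thesis by (simp add: None)
  qed
qed

text \<open>
  The content is the case of a point \<open>u \<noteq> 0\<close> of the chart at infinity, where \<open>lie\<close> is by definition
  computed in the other coordinate \<open>1 / u\<close>.
\<close>

lemma form_coeff_lie:
  assumes X: "regular_vector_field X" and s: "form_coeff p s analytic_on {u}"
  shows "form_coeff p (lie X s) u
    = vec_coeff p X u * deriv (form_coeff p s) u + deriv (vec_coeff p X) u * form_coeff p s u"
proof (cases "p = None \<and> u \<noteq> 0")
  case False
  then consider a where "p = Some a" | "p = None" "u = 0" by (cases p) auto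
  then show ?thesis
    by cases (simp_all add: lie_def form_coeff_None, simp_all add: vec_coeff_def form_coeff_None)
next
  case True
  then have p: "p = None" and u: "u \<noteq> 0" by auto
  define F where "F = form_coeff None s"
  define Y where "Y = vec_coeff None X"
  define f where "f = (\<lambda>x. s (Some x))"
  define Z where "Z = (\<lambda>x. X (Some x))"
  have dF: "(F has_field_derivative deriv F u) (at u)"
    using s by (auto simp: F_def p intro: analytic_on_imp_differentiable_at DERIV_deriv_iff_field_differentiable[THEN iffD2])
  have dY: "(Y has_field_derivative deriv Y u) (at u)"
    using vec_coeff_analytic[OF X, of None u]
    by (auto simp: Y_def intro: analytic_on_imp_differentiable_at DERIV_deriv_iff_field_differentiable[THEN iffD2])
  have ev: "eventually (\<lambda>x. x \<noteq> 0) (nhds (1 / u))" using u by (intro eventually_neq_nhds) auto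
  have "deriv f (1 / u) = deriv (\<lambda>x. - F (1 / x) / x ^ 2) (1 / u)"
    by (rule deriv_cong_ev[OF _ refl], rule eventually_mono[OF ev])
       (auto simp: F_def f_def form_coeff_None field_simps)
  also have "((\<lambda>x. - F (1 / x) / x ^ 2) has_field_derivative deriv F u * u ^ 4 + 2 * F u * u ^ 3) (at (1 / u))"
    using u dF
    by (auto intro!: derivative_eq_intros DERIV_chain2[where f = F and g = "\<lambda>x. 1 / x"]
        simp: field_simps power2_eq_square eval_nat_numeral)
  then have "deriv (\<lambda>x. - F (1 / x) / x ^ 2) (1 / u) = deriv F u * u ^ 4 + 2 * F u * u ^ 3"
    by (rule DERIV_imp_deriv)
  finally have df: "deriv f (1 / u) = deriv F u * u ^ 4 + 2 * F u * u ^ 3" .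
  have "deriv Z (1 / u) = deriv (\<lambda>x. - (x ^ 2) * Y (1 / x)) (1 / u)"
    by (rule deriv_cong_ev[OF _ refl], rule eventually_mono[OF ev])
       (auto simp: Y_def Z_def vec_coeff_def field_simps)
  also have "((\<lambda>x. - (x ^ 2) * Y (1 / x)) has_field_derivative deriv Y u - 2 * Y u / u) (at (1 / u))"
    using u dY
    by (auto intro!: derivative_eq_intros DERIV_chain2[where f = Y and g = "\<lambda>x. 1 / x"]
        simp: field_simps power2_eq_square)
  then have "deriv (\<lambda>x. - (x ^ 2) * Y (1 / x)) (1 / u) = deriv Y u - 2 * Y u / u"
    by (rule DERIV_imp_deriv)
  finally have dZ: "deriv Z (1 / u) = deriv Y u - 2 * Y u / u" .
  have fZ: "f (1 / u) = - F u * u ^ 2" "Z (1 / u) = - Y u / u ^ 2"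
    using u by (simp_all add: F_def f_def Y_def Z_def form_coeff_None vec_coeff_def)
  have "form_coeff p (lie X s) u = - (Z (1 / u) * deriv f (1 / u) + deriv Z (1 / u) * f (1 / u)) / u ^ 2"
    using u by (simp add: p form_coeff_None lie_def f_def Z_def vec_coeff_def)
  \<comment> \<open>The terms in \<open>Y u * F u\<close> that come from the two transformation
    rules cancel: this is the coordinate invariance of the Lie derivative of a 1-form.\<close>
  also have "\<dots> = Y u * deriv F u + deriv Y u * F u"
    unfolding df dZ fZ using u by (simp add: field_simps eval_nat_numeral)
  finally show ?thesis by (simp add: F_def Y_def p)
qed

text \<open>In a chart, \<open>L\<^sub>X\<^sup>N\<close> is the differential operator \<open>\<Sum>n\<le>N. lie_sym Y N n \<partial>\<^sup>n\<close>, with \<open>Y\<close> the coefficient of \<open>X\<close>.\<close>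

primrec lie_sym :: "(complex \<Rightarrow> complex) \<Rightarrow> nat \<Rightarrow> nat \<Rightarrow> complex \<Rightarrow> complex" where
  "lie_sym Y 0 n u = (if n = 0 then 1 else 0)"
| "lie_sym Y (Suc N) n u = Y u * deriv (lie_sym Y N n) u + deriv Y u * lie_sym Y N n u
     + (case n of 0 \<Rightarrow> 0 | Suc m \<Rightarrow> Y u * lie_sym Y N m u)"

lemma lie_sym_analytic:
  assumes "\<And>u. Y analytic_on {u}"
  shows "lie_sym Y N n analytic_on {u}"
proof (induction N arbitrary: n u)
  case 0
  have "lie_sym Y 0 n = (\<lambda>u. if n = 0 then 1 else 0)" by (rule ext) simp
  then show ?case by simp
next
  case (Suc N)
  have "lie_sym Y (Suc N) n = (\<lambda>u. Y u * deriv (lie_sym Y N n) u + deriv Y u * lie_sym Y N n u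
     + (case n of 0 \<Rightarrow> 0 | Suc m \<Rightarrow> Y u * lie_sym Y N m u))" by (rule ext) simp
  moreover have "(\<lambda>u. case n of 0 \<Rightarrow> 0 | Suc m \<Rightarrow> Y u * lie_sym Y N m u) analytic_on {u}"
    by (cases n) (auto intro!: analytic_intros Suc assms)
  ultimately show ?case by (auto intro!: analytic_intros Suc assms)
qed

lemma lie_sym_zero: "n > N \<Longrightarrow> lie_sym Y N n u = 0"
proof (induction N arbitrary: n u)
  case (Suc N)
  then have "lie_sym Y N n = (\<lambda>_. 0)" by (intro ext) auto
  with Suc show ?case by (auto split: nat.splits)
qed auto

lemma lie_sym_const: "lie_sym (\<lambda>_. 1) N n u = (if n = N then 1 else 0)"
proof (induction N arbitrary: n u)
  case (Suc N)
  then have "lie_sym (\<lambda>_. 1) N n = (\<lambda>_. if n = N then 1 else 0)" by (intro ext)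
  with Suc show ?case by (auto split: nat.splits)
qed auto

text \<open>Proved on a whole open set and not only at the base point, because the step from
  \<open>N\<close> to \<open>Suc N\<close> differentiates the formula.\<close>

lemma form_coeff_lie_power:
  assumes X: "regular_vector_field X" and U: "open U" and s: "form_coeff p s analytic_on U" and u: "u \<in> U"
  shows "form_coeff p ((lie X ^^ N) s) u
    = (\<Sum>n\<le>N. lie_sym (vec_coeff p X) N n u * (deriv ^^ n) (form_coeff p s) u)"
  using u
proof (induction N arbitrary: u)
  case 0
  then show ?case by simp
next
  case (Suc N)
  let ?Y = "vec_coeff p X"
  define f where "f = form_coeff p s"
  define G where "G = (\<lambda>u. \<Sum>n\<le>N. lie_sym ?Y N n u * (deriv ^^ n) f u)"
  have an_f: "(deriv ^^ n) f analytic_on {v}" if "v \<in> U" for n v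
    using s that unfolding f_def by (meson analytic_higher_deriv analytic_on_subset empty_subsetI insert_subset)
  have an_a: "lie_sym ?Y N n analytic_on {v}" for n v
    by (intro lie_sym_analytic vec_coeff_analytic X)
  have G: "G analytic_on {v}" if "v \<in> U" for v
    unfolding G_def using that by (intro analytic_intros an_f an_a)
  have ev: "eventually (\<lambda>v. form_coeff p ((lie X ^^ N) s) v = G v) (nhds u)"
    using eventually_nhds_in_open[OF U Suc.prems] by eventually_elim (simp add: Suc.IH G_def f_def)
  have an: "form_coeff p ((lie X ^^ N) s) analytic_on {u}"
    using analytic_at_cong[OF ev refl] G[OF Suc.prems] by simp
  have "form_coeff p ((lie X ^^ Suc N) s) u = ?Y u * deriv G u + deriv ?Y u * G u"
    using form_coeff_lie[OF X an] deriv_cong_ev[OF ev refl] eventually_nhds_x_imp_x[OF ev] by simp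
  also have "deriv G u = (\<Sum>n\<le>N. deriv (lie_sym ?Y N n) u * (deriv ^^ n) f u + lie_sym ?Y N n u * (deriv ^^ Suc n) f u)"
    unfolding G_def
  proof (rule DERIV_imp_deriv, rule derivative_eq_intros, rule DERIV_mult)
    fix n
    show "(lie_sym ?Y N n has_field_derivative deriv (lie_sym ?Y N n) u) (at u)"
      using analytic_on_imp_differentiable_at[OF an_a] by (simp add: DERIV_deriv_iff_field_differentiable)
    show "((deriv ^^ n) f has_field_derivative (deriv ^^ Suc n) f u) (at u)"
      using analytic_on_imp_differentiable_at[OF an_f[OF Suc.prems]] by (simp add: DERIV_deriv_iff_field_differentiable)
  qed (simp add: mult.commute add.commute)
  also have "?Y u * \<dots> + deriv ?Y u * G u
    = (\<Sum>n\<le>N. (?Y u * deriv (lie_sym ?Y N n) u + deriv ?Y u * lie_sym ?Y N n u) * (deriv ^^ n) f u)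
    + (\<Sum>n\<le>N. ?Y u * lie_sym ?Y N n u * (deriv ^^ Suc n) f u)"
    unfolding G_def sum_distrib_left sum.distrib[symmetric]
    by (intro sum.cong refl) (simp add: algebra_simps)
  \<comment> \<open>The index shift produces the \<open>Suc m\<close> branch of
    \<open>lie_sym\<close>. The other sum is then extended by its zero term at \<open>Suc N\<close>,
    so that the two can be merged.\<close>
  also have "(\<Sum>n\<le>N. ?Y u * lie_sym ?Y N n u * (deriv ^^ Suc n) f u)
    = (\<Sum>n\<le>Suc N. (case n of 0 \<Rightarrow> 0 | Suc m \<Rightarrow> ?Y u * lie_sym ?Y N m u) * (deriv ^^ n) f u)"
    unfolding sum.atMost_Suc_shift by simp
  also have "(\<Sum>n\<le>N. (?Y u * deriv (lie_sym ?Y N n) u + deriv ?Y u * lie_sym ?Y N n u) * (deriv ^^ n) f u)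
    = (\<Sum>n\<le>Suc N. (?Y u * deriv (lie_sym ?Y N n) u + deriv ?Y u * lie_sym ?Y N n u) * (deriv ^^ n) f u)"
  proof -
    have "lie_sym ?Y N (Suc N) = (\<lambda>_. 0)" by (intro ext lie_sym_zero) simp
    then show ?thesis by simp
  qed
  finally show ?case
    by (simp add: f_def sum.distrib[symmetric] distrib_right del: sum.atMost_Suc funpow.simps)
qed

lemma lie_power_analytic:
  assumes X: "regular_vector_field X" and s: "form_coeff p s analytic_on {base p}"
  shows "(lie X ^^ N) s p
      = (\<Sum>n\<le>N. lie_sym (vec_coeff p X) N n (base p) * (deriv ^^ n) (form_coeff p s) (base p))"
    and "form_coeff p ((lie X ^^ N) s) analytic_on {base p}"
proof -
  obtain U where U: "open U" "base p \<in> U" "form_coeff p s analytic_on U"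
    using s unfolding analytic_at by (metis analytic_on_open)
  note eq = form_coeff_lie_power[OF X U(1,3)]
  show "(lie X ^^ N) s p
      = (\<Sum>n\<le>N. lie_sym (vec_coeff p X) N n (base p) * (deriv ^^ n) (form_coeff p s) (base p))"
    using eq[OF U(2), of N] by simp
  have ev: "eventually (\<lambda>u. form_coeff p ((lie X ^^ N) s) u =
      (\<Sum>n\<le>N. lie_sym (vec_coeff p X) N n u * (deriv ^^ n) (form_coeff p s) u)) (nhds (base p))"
    using eventually_nhds_in_open[OF U(1,2)] by eventually_elim (rule eq)
  show "form_coeff p ((lie X ^^ N) s) analytic_on {base p}"
    unfolding analytic_at_cong[OF ev refl]
    by (intro analytic_intros lie_sym_analytic vec_coeff_analytic X analytic_higher_deriv s)
qed

lemma eventually_form_coeff_cong: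
  assumes "openin sphere_topology D" "\<And>q. q \<in> D \<Longrightarrow> s q = t q" "p \<in> D"
  shows "eventually (\<lambda>u. form_coeff p s u = form_coeff p t u) (nhds (base p))"
proof -
  have "eventually (\<lambda>u. u \<in> {u. chart_pt p u \<in> D}) (nhds (base p))"
    using assms by (intro eventually_nhds_in_open open_chart_preimage) auto
  then show ?thesis by eventually_elim (simp add: form_coeff_eq assms(2))
qed

lemma lie_cong:
  assumes "openin sphere_topology D" "\<And>q. q \<in> D \<Longrightarrow> s q = t q" "p \<in> D"
  shows "lie X s p = lie X t p"
  unfolding lie_def using deriv_cong_ev[OF eventually_form_coeff_cong[OF assms] refl] assms by simp

lemma lie_power_cong:
  assumes "openin sphere_topology D" "\<And>q. q \<in> D \<Longrightarrow> s q = t q" "p \<in> D"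
  shows "(lie X ^^ N) s p = (lie X ^^ N) t p"
  using assms(3)
proof (induction N arbitrary: p)
  case (Suc N)
  then show ?case by (simp add: lie_cong[OF assms(1) Suc.IH])
qed (simp add: assms)

text \<open>Lie derivatives are local, so a formula for an operator-valued section that is known
  only on one of the domains can be substituted under \<open>has_lie\<close>.\<close>

lemma has_lie_cong:
  assumes "openin sphere_topology D" "\<And>q. q \<in> D \<Longrightarrow> s q = t q" "p \<in> D"
  shows "has_lie X s p l \<longleftrightarrow> has_lie X t p l"
proof -
  have "(form_coeff p s has_field_derivative d) (at (base p)) \<longleftrightarrow>
      (form_coeff p t has_field_derivative d) (at (base p))" for d
    using eventually_form_coeff_cong[OF assms] by (intro DERIV_cong_ev) auto
  then show ?thesis
    unfolding has_lie_def by (simp add: field_differentiable_def lie_cong[OF assms, where X = X])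
qed

lemma has_lie_zero: "has_lie X (\<lambda>_. 0) p 0"
  by (simp add: has_lie_def lie_def form_coeff_zero)

lemma has_lie_add:
  "has_lie X s p a \<Longrightarrow> has_lie X t p b \<Longrightarrow> has_lie X (\<lambda>q. s q + t q) p (a + b)"
  by (auto simp: has_lie_def lie_def form_coeff_add distrib_left intro!: derivative_intros)

lemma has_lie_cmult: "has_lie X s p a \<Longrightarrow> has_lie X (\<lambda>q. c * s q) p (c * a)"
  by (auto simp: has_lie_def lie_def form_coeff_cmult distrib_left intro!: derivative_intros)

lemma has_lie_sum:
  "(\<And>i. i \<in> I \<Longrightarrow> has_lie X (s i) p (a i)) \<Longrightarrow> has_lie X (\<lambda>q. \<Sum>i\<in>I. s i q) p (\<Sum>i\<in>I. a i)"
  by (induction I rule: infinite_finite_induct) (auto intro: has_lie_zero has_lie_add)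

lemma has_lie_power:
  assumes "regular_vector_field X" "form_coeff p s analytic_on {base p}"
  shows "has_lie X ((lie X ^^ N) s) p ((lie X ^^ Suc N) s p)"
  using analytic_on_imp_differentiable_at[OF lie_power_analytic(2)[OF assms]] by (simp add: has_lie_def)

subsection \<open>Meromorphic forms\<close>

lemma form_nice: "form_coeff p (form_val \<alpha>) nicely_meromorphic_on {base p}"
  using form_val[of \<alpha>] by (simp add: meromorphic_section_def)

lemma form_isolated: "isolated_singularity_at (form_coeff p (form_val \<alpha>)) (base p)"
  using form_nice meromorphic_on_isolated_singularity unfolding nicely_meromorphic_on_def by blast

text \<open>A nicely meromorphic coefficient takes its limit as value wherever there is no pole, so
  absence of a pole leaves no removable singularity behind.\<close>

lemma form_pole_iff: "form_pole \<alpha> p \<longleftrightarrow> \<not> form_coeff p (form_val \<alpha>) analytic_on {base p}"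
  unfolding form_pole_def
  using nicely_meromorphic_on_imp_analytic_at[OF form_nice, of "base p" p \<alpha>] analytic_at_imp_no_pole by blast

lemma eventually_form_add:
  "eventually (\<lambda>x. form_coeff p (form_val (\<alpha> + \<beta>)) x
      = form_coeff p (form_val \<alpha>) x + form_coeff p (form_val \<beta>) x) (at (base p))"
proof -
  have "eventually (\<lambda>x. form_coeff p (tidy (\<lambda>q. form_val \<alpha> q + form_val \<beta> q)) x
      = form_coeff p (\<lambda>q. form_val \<alpha> q + form_val \<beta> q) x) (at (base p))"
    using form_val[of \<alpha>] form_val[of \<beta>] by (intro eventually_form_coeff_tidy meromorphic_add_aux) auto
  then show ?thesis by (simp add: plus_mform.rep_eq form_coeff_add)
qed

lemma form_val_scale: "form_coeff p (form_val (c *\<^sub>C \<alpha>)) = (\<lambda>x. c * form_coeff p (form_val \<alpha>) x)"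
  by (simp add: scaleC_mform.rep_eq form_coeff_cmult)

lemma form_val_zero: "form_coeff p (form_val 0) = (\<lambda>x. 0)"
  by (simp add: zero_mform.rep_eq form_coeff_zero)

lemma
  assumes "\<not> form_pole \<alpha> p" "\<not> form_pole \<beta> p"
  shows not_pole_add: "\<not> form_pole (\<alpha> + \<beta>) p"
    and eventually_form_add_nhds: "eventually (\<lambda>x. form_coeff p (form_val (\<alpha> + \<beta>)) x
      = form_coeff p (form_val \<alpha>) x + form_coeff p (form_val \<beta>) x) (nhds (base p))"
proof -
  let ?f = "\<lambda>x. form_coeff p (form_val \<alpha>) x + form_coeff p (form_val \<beta>) x"
  have an: "?f analytic_on {base p}"
    using assms by (auto simp: form_pole_iff intro: analytic_intros)
  have "\<not> is_pole ?f (base p)" using an analytic_at_imp_no_pole by blast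
  then show "\<not> form_pole (\<alpha> + \<beta>) p"
    unfolding form_pole_def is_pole_cong[OF eventually_form_add refl] .
  have "form_coeff p (form_val (\<alpha> + \<beta>)) (base p) = remove_sings ?f (base p)"
    by (simp add: plus_mform.rep_eq tidy_def form_coeff_add)
  also have "\<dots> = ?f (base p)" using an by simp
  finally show "eventually (\<lambda>x. form_coeff p (form_val (\<alpha> + \<beta>)) x = ?f x) (nhds (base p))"
    using eventually_form_add[of p \<alpha> \<beta>] by (auto simp: eventually_nhds_conv_at)
qed

lemma not_pole_scale: "\<not> form_pole \<alpha> p \<Longrightarrow> \<not> form_pole (c *\<^sub>C \<alpha>) p"
  by (auto simp: form_pole_iff form_val_scale intro!: analytic_intros)

lemma not_pole_zero: "\<not> form_pole 0 p"
  by (simp add: form_pole_iff form_val_zero)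

lemma form_holomorphic_punctured:
  obtains U where "open U" "base p \<in> U" "form_coeff p (form_val \<alpha>) holomorphic_on U - {base p}"
proof -
  obtain r where "r > 0" "form_coeff p (form_val \<alpha>) analytic_on ball (base p) r - {base p}"
    using form_isolated unfolding isolated_singularity_at_def by blast
  then show ?thesis using that[of "ball (base p) r"] analytic_imp_holomorphic by auto
qed

lemma form_residue_add: "form_residue (\<alpha> + \<beta>) p = form_residue \<alpha> p + form_residue \<beta> p"
proof -
  obtain U where U: "open U" "base p \<in> U" "form_coeff p (form_val \<alpha>) holomorphic_on U - {base p}"
    by (rule form_holomorphic_punctured)
  obtain V where V: "open V" "base p \<in> V" "form_coeff p (form_val \<beta>) holomorphic_on V - {base p}"
    by (rule form_holomorphic_punctured)
  show ?thesis
    unfolding form_residue_def residue_cong[OF eventually_form_add refl]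
    by (rule residue_add[of "U \<inter> V"]) (use U V in \<open>auto intro: holomorphic_on_subset\<close>)
qed

lemma form_residue_scale: "form_residue (c *\<^sub>C \<alpha>) p = c * form_residue \<alpha> p"
proof -
  obtain U where U: "open U" "base p \<in> U" "form_coeff p (form_val \<alpha>) holomorphic_on U - {base p}"
    by (rule form_holomorphic_punctured)
  show ?thesis
    unfolding form_residue_def form_val_scale by (rule residue_lmul[OF U])
qed

lemma subspace_forms_K: "cv.subspace (forms_K D)"
proof (rule cv.subspaceI)
  show "0 \<in> forms_K D" by (simp add: forms_K_def not_pole_zero form_residue_def form_val_zero residue_const)
next
  fix \<alpha> \<beta> assume "\<alpha> \<in> forms_K D" "\<beta> \<in> forms_K D"
  then show "\<alpha> + \<beta> \<in> forms_K D"
    unfolding forms_K_def using not_pole_add[of \<alpha> _ \<beta>] by (simp add: form_residue_add) blast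
next
  fix c \<alpha> assume "\<alpha> \<in> forms_K D"
  then show "c *\<^sub>C \<alpha> \<in> forms_K D"
    unfolding forms_K_def using not_pole_scale[of \<alpha> _ c] by (simp add: form_residue_scale) blast
qed

section \<open>Jets of forms and the derivatives of the kernel\<close>

definition jet :: "nat \<Rightarrow> point \<Rightarrow> mform \<Rightarrow> complex" where
  "jet n p \<alpha> = (deriv ^^ n) (form_coeff p (form_val \<alpha>)) (base p)"

lemma jet_0 [simp]: "jet 0 p \<alpha> = form_val \<alpha> p"
  by (simp add: jet_def)

lemma jet_add: "\<not> form_pole \<alpha> p \<Longrightarrow> \<not> form_pole \<beta> p \<Longrightarrow> jet n p (\<alpha> + \<beta>) = jet n p \<alpha> + jet n p \<beta>"
  unfolding jet_def using higher_deriv_cong_ev[OF eventually_form_add_nhds[of \<alpha> p \<beta>] refl]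
  by (simp add: form_pole_iff higher_deriv_add_at)

lemma jet_scale: "\<not> form_pole \<alpha> p \<Longrightarrow> jet n p (c *\<^sub>C \<alpha>) = c * jet n p \<alpha>"
  unfolding jet_def form_val_scale
  using form_pole_iff[of \<alpha> p] higher_deriv_cmult by (auto simp: analytic_at)

lemma polar_change_chart:
  fixes w a F :: complex
  assumes "w \<noteq> 0"
  shows "- (- F / (1 / w - a) ^ (n + 2)) / w ^ 2 = F * w ^ n / (1 - a * w) ^ (n + 2)"
proof -
  have "1 / w - a = (1 - a * w) / w" using assms by (simp add: field_simps)
  then show ?thesis using assms by (simp add: power_divide power_add power2_eq_square)
qed

text \<open>
  \<open>polar p n\<close> is the \<open>n\<close>-th derivative of \<open>kernel q\<close> with respect to the distinguished coordinate
  of \<open>q\<close> at \<open>q = p\<close>.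
\<close>

lift_definition polar :: "point \<Rightarrow> nat \<Rightarrow> mform" is
  "\<lambda>p n q. case (p, q) of
     (Some a, Some x) \<Rightarrow> - fact (Suc n) / (x - a) ^ (n + 2)
   | (Some a, None) \<Rightarrow> (if n = 0 then 1 else 0)
   | (None, Some x) \<Rightarrow> fact (Suc n) * x ^ n
   | (None, None) \<Rightarrow> 0"
proof -
  have nice: "(\<lambda>x::complex. - fact (Suc n) / (x - a) ^ (n + 2)) nicely_meromorphic_on {z}" for a z n
  proof (cases "z = a")
    case True
    have "is_pole (\<lambda>x::complex. - fact (Suc n) / (x - a) ^ (n + 2)) a"
      by (rule is_pole_basic[of _ UNIV]) (auto simp del: fact_Suc)
    then show ?thesis
      using True by (auto simp: nicely_meromorphic_on_def intro!: meromorphic_intros)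
  next
    case False
    then show ?thesis
      by (intro analytic_on_imp_nicely_meromorphic_on analytic_intros) auto
  qed
  fix p :: point and n :: nat
  let ?s = "\<lambda>q. case (p, q) of (Some a, Some x) \<Rightarrow> - fact (Suc n) / (x - a) ^ (n + 2)
      | (Some a, None) \<Rightarrow> (if n = 0 then 1 else 0)
      | (None, Some x) \<Rightarrow> fact (Suc n) * x ^ n | (None, None) \<Rightarrow> (0::complex)"
  have "form_coeff q ?s nicely_meromorphic_on {base q}" for q
  proof (cases p; cases q)
    fix a x assume "p = Some a" "q = Some x"
    then show ?thesis using nice[of n a x] by simp
  next
    fix a assume pq: "p = Some a" "q = None"
    have "form_coeff q ?s = (\<lambda>w. fact (Suc n) * w ^ n / (1 - a * w) ^ (n + 2))"
      using polar_change_chart[of _ "fact (Suc n)" a n] by (auto simp: pq form_coeff_None simp del: fact_Suc)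
    moreover have "(\<lambda>w. fact (Suc n) * w ^ n / (1 - a * w) ^ (n + 2)) nicely_meromorphic_on {0}"
      by (intro analytic_on_imp_nicely_meromorphic_on analytic_intros) auto
    ultimately show ?thesis by (simp add: pq)
  next
    fix x assume "p = None" "q = Some x"
    then show ?thesis by (auto intro!: analytic_on_imp_nicely_meromorphic_on analytic_intros)
  next
    assume pq: "p = None" "q = None"
    have "form_coeff q ?s = (\<lambda>w. - fact (Suc n) / (w - 0) ^ (n + 2))"
      by (auto simp: pq form_coeff_None power_one_over field_simps power_add power2_eq_square)
    then show ?thesis using nice[of n 0 0] by (simp add: pq)
  qed
  then show "meromorphic_section ?s"
    by (simp add: meromorphic_section_def)
qed

lemma polar_0: "polar p 0 = kernel p"
  by (rule form_val_inject[THEN iffD1], rule ext)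
     (simp add: polar.rep_eq kernel.rep_eq numeral_2_eq_2 split: option.splits)

lemma polar_coeff_Some:
  "form_coeff (Some x) (form_val (polar (Some a) n)) = (\<lambda>y. - fact (Suc n) / (y - a) ^ (n + 2))"
  "form_coeff (Some x) (form_val (polar None n)) = (\<lambda>y. fact (Suc n) * y ^ n)"
  by (simp_all add: polar.rep_eq)

lemma polar_coeff_None:
  "form_coeff None (form_val (polar (Some a) n)) = (\<lambda>w. fact (Suc n) * w ^ n / (1 - a * w) ^ (n + 2))"
  using polar_change_chart[of _ "fact (Suc n)" a n]
  by (auto simp: form_coeff_None polar.rep_eq simp del: fact_Suc)

lemma polar_coeff_self:
  "form_coeff p (form_val (polar p n)) = (\<lambda>y. - fact (Suc n) / (y - base p) ^ (n + 2))"
proof (cases p)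
  case None
  then show ?thesis
    by (auto simp: form_coeff_None polar.rep_eq power_one_over field_simps power_add power2_eq_square)
qed (simp add: polar.rep_eq)

lemma polar_analytic: "p \<noteq> q \<Longrightarrow> form_coeff q (form_val (polar p n)) analytic_on {base q}"
  by (cases p; cases q)
    (auto simp: polar_coeff_Some polar_coeff_None simp del: form_coeff_Some intro!: analytic_intros)

lemma polar_not_pole: "p \<noteq> q \<Longrightarrow> \<not> form_pole (polar p n) q"
  using polar_analytic by (simp add: form_pole_iff)

lemma residue_analytic: "f analytic_on {z} \<Longrightarrow> residue f z = 0"
  unfolding analytic_at using residue_holo by blast

text \<open>In its own coordinate the form is a constant over a power of order at least 2, so it has
  no residue at \<open>p\<close>; elsewhere it is analytic.\<close>

lemma polar_in_forms_K: "p \<in> D \<Longrightarrow> polar p n \<in> forms_K D"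
proof -
  have "form_residue (polar p n) q = 0" for q
  proof (cases "p = q")
    case True
    have "residue (\<lambda>y. (\<lambda>_. - fact (Suc n)) y / (y - base q) ^ Suc (Suc n)) (base q)
        = (deriv ^^ Suc n) (\<lambda>_. - fact (Suc n)) (base q) / fact (Suc n)"
      by (rule residue_holomorphic_over_power[of UNIV]) auto
    also have "(deriv ^^ Suc n) (\<lambda>_. - fact (Suc n) :: complex) (base q) = 0"
      by (simp del: funpow.simps)
    finally show ?thesis by (simp add: form_residue_def True polar_coeff_self)
  qed (use residue_analytic polar_analytic form_residue_def in auto)
  moreover have "q \<in> D" if "p \<in> D" "form_pole (polar p n) q" for q
    using polar_not_pole[of p q n] that by (cases "p = q") auto
  ultimately show "p \<in> D \<Longrightarrow> polar p n \<in> forms_K D"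
    by (simp add: forms_K_def)
qed

lemma higher_deriv_inverse_power:
  fixes a c x y :: complex
  assumes "c * y + a \<noteq> 0"
  shows "(deriv ^^ m) (\<lambda>y. 1 / (c * y + a) ^ Suc k) y
    = (- c) ^ m * fact (k + m) / (fact k * (c * y + a) ^ Suc (k + m))"
  using assms
proof (induction m arbitrary: y)
  case (Suc m)
  have "eventually (\<lambda>y. y \<in> (\<lambda>y. c * y + a) -` (- {0})) (nhds y)"
    using Suc.prems by (intro eventually_nhds_in_open continuous_open_vimage) (auto intro!: continuous_intros)
  then have "eventually (\<lambda>y. (deriv ^^ m) (\<lambda>y. 1 / (c * y + a) ^ Suc k) y
      = (- c) ^ m * fact (k + m) / (fact k * (c * y + a) ^ Suc (k + m))) (nhds y)"
    by eventually_elim (use Suc.IH in auto)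
  then have "(deriv ^^ Suc m) (\<lambda>y. 1 / (c * y + a) ^ Suc k) y
      = deriv (\<lambda>y. (- c) ^ m * fact (k + m) / (fact k * (c * y + a) ^ Suc (k + m))) y"
    by (simp add: deriv_cong_ev)
  also have "\<dots> = (- c) ^ Suc m * fact (k + Suc m) / (fact k * (c * y + a) ^ Suc (k + Suc m))"
  proof (rule DERIV_imp_deriv)
    have "((\<lambda>y. (c * y + a) ^ Suc (k + m)) has_field_derivative
        (1 + of_nat (k + m)) * (c * (c * y + a) ^ (k + m))) (at y)"
      by (rule DERIV_power_Suc) (auto intro!: derivative_eq_intros)
    from DERIV_cmult[OF DERIV_inverse_fun[OF this], of "(- c) ^ m * fact (k + m) / fact k"] Suc.prems
    have "((\<lambda>y. (- c) ^ m * fact (k + m) / fact k * inverse ((c * y + a) ^ Suc (k + m))) has_field_derivative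
        (- c) ^ m * fact (k + m) / fact k * - (inverse ((c * y + a) ^ Suc (k + m)) *
          ((1 + of_nat (k + m)) * (c * (c * y + a) ^ (k + m))) * inverse ((c * y + a) ^ Suc (k + m)))) (at y)"
      by (simp add: mult_ac)
    \<comment> \<open>The quotient is simplified for abstract letters, so that powers and factorials
      are not expanded; \<open>g\<close> is the base \<open>c * y + a\<close> and \<open>Q\<close>
      its power of exponent \<open>k + m\<close>.\<close>
    moreover have "A / F * - (inverse (g * Q) * (L * (c * Q)) * inverse (g * Q)) = - c * A * L / (F * (g * (g * Q)))"
      if "F \<noteq> 0" "g \<noteq> 0" "Q \<noteq> 0" for A F g Q L :: complex
      using that by (simp add: field_simps)
    from this[of "fact k" "c * y + a" "(c * y + a) ^ (k + m)" "(- c) ^ m * fact (k + m)" "1 + of_nat (k + m)"]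
    have "(- c) ^ m * fact (k + m) / fact k * - (inverse ((c * y + a) ^ Suc (k + m)) *
          ((1 + of_nat (k + m)) * (c * (c * y + a) ^ (k + m))) * inverse ((c * y + a) ^ Suc (k + m)))
        = (- c) ^ Suc m * fact (k + Suc m) / (fact k * (c * y + a) ^ Suc (k + Suc m))"
      using Suc.prems by (simp only: power_Suc add_Suc_right fact_Suc of_nat_Suc mult_ac power_eq_0_iff) simp
    ultimately show "((\<lambda>y. (- c) ^ m * fact (k + m) / (fact k * (c * y + a) ^ Suc (k + m))) has_field_derivative
        (- c) ^ Suc m * fact (k + Suc m) / (fact k * (c * y + a) ^ Suc (k + Suc m))) (at y)"
      by (simp only: divide_inverse inverse_mult_distrib mult.assoc)
  qed
  finally show ?case .
qed simp

lemma higher_deriv_monomial: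
  "(deriv ^^ m) (\<lambda>y::complex. y ^ n) y = of_nat (fact m * (n choose m)) * y ^ (n - m)"
proof (induction m arbitrary: y)
  case (Suc m)
  have "(deriv ^^ m) (\<lambda>y::complex. y ^ n) = (\<lambda>y. of_nat (fact m * (n choose m)) * y ^ (n - m))"
    by (rule ext) (rule Suc)
  then have "(deriv ^^ Suc m) (\<lambda>y::complex. y ^ n) y = deriv (\<lambda>y. of_nat (fact m * (n choose m)) * y ^ (n - m)) y"
    by simp
  also have "\<dots> = of_nat (fact m * ((n - m) * (n choose m))) * y ^ (n - Suc m)"
    by (rule DERIV_imp_deriv) (auto intro!: derivative_eq_intros)
  also have "(n - m) * (n choose m) = Suc m * (n choose Suc m)"
    by (simp only: binomial_absorb_comp binomial_absorption)
  finally show ?case by (simp only: fact_Suc mult_ac of_nat_id)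
qed simp

lemma jet_polar_Some:
  assumes "x \<noteq> a"
  shows "jet m (Some x) (polar (Some a) n) = - ((- 1) ^ m * fact (n + m + 1)) / (x - a) ^ (n + m + 2)"
proof -
  have "jet m (Some x) (polar (Some a) n) = (deriv ^^ m) (\<lambda>y. - fact (Suc n) * (1 / (1 * y + - a) ^ Suc (Suc n))) x"
    by (simp add: jet_def polar_coeff_Some del: form_coeff_Some fact_Suc)
  also have "\<dots> = - fact (Suc n) * (deriv ^^ m) (\<lambda>y. 1 / (1 * y + - a) ^ Suc (Suc n)) x"
    using assms by (intro higher_deriv_cmult' analytic_intros) auto
  also have "(deriv ^^ m) (\<lambda>y. 1 / (1 * y + - a) ^ Suc (Suc n)) x
      = (- 1) ^ m * fact (Suc n + m) / (fact (Suc n) * (1 * x + - a) ^ Suc (Suc n + m))"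
    using assms by (intro higher_deriv_inverse_power) auto
  finally show ?thesis by (simp del: fact_Suc)
qed

lemma jet_polar_None:
  "jet m (Some a) (polar None n) = fact (Suc n) * of_nat (fact m * (n choose m)) * a ^ (n - m)"
proof -
  have "jet m (Some a) (polar None n) = (deriv ^^ m) (\<lambda>y. fact (Suc n) * y ^ n) a"
    by (simp add: jet_def polar_coeff_Some del: form_coeff_Some fact_Suc)
  also have "\<dots> = fact (Suc n) * (deriv ^^ m) (\<lambda>y. y ^ n) a"
    by (intro higher_deriv_cmult' analytic_intros)
  finally show ?thesis by (simp only: higher_deriv_monomial mult.assoc)
qed

text \<open>By the Leibniz rule at \<open>0\<close> only the term that differentiates
  \<open>w ^ m\<close> exactly \<open>m\<close> times survives. For \<open>m > n\<close> there is no
  such term, and the binomial coefficient on the right is 0.\<close>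

lemma jet_polar_None':
  "jet n None (polar (Some a) m) = fact (Suc n) * of_nat (fact m * (n choose m)) * a ^ (n - m)"
proof -
  let ?g = "\<lambda>w. fact (Suc m) * (1 / ((- a) * w + 1) ^ Suc (Suc m))"
  have g: "(deriv ^^ j) ?g 0 = a ^ j * fact (Suc m + j)" for j
  proof -
    have "(deriv ^^ j) ?g 0 = fact (Suc m) * (deriv ^^ j) (\<lambda>w. 1 / ((- a) * w + 1) ^ Suc (Suc m)) 0"
      by (intro higher_deriv_cmult' analytic_intros) auto
    also have "(deriv ^^ j) (\<lambda>w. 1 / ((- a) * w + 1) ^ Suc (Suc m)) 0
      = (- (- a)) ^ j * fact (Suc m + j) / (fact (Suc m) * ((- a) * 0 + 1) ^ Suc (Suc m + j))"
      by (intro higher_deriv_inverse_power) auto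
    finally show ?thesis by (simp del: fact_Suc)
  qed
  have mono: "(deriv ^^ i) (\<lambda>w::complex. w ^ m) 0 = (if i = m then fact m else 0)" for i
    unfolding higher_deriv_monomial by (cases i m rule: linorder_cases) auto
  have "jet n None (polar (Some a) m) = (deriv ^^ n) (\<lambda>w. w ^ m * ?g w) 0"
    by (simp add: jet_def polar_coeff_None mult_ac del: fact_Suc)
  also have "\<dots> = (\<Sum>i = 0..n. of_nat (n choose i) * (deriv ^^ i) (\<lambda>w. w ^ m) 0 * (deriv ^^ (n - i)) ?g 0)"
    by (intro higher_deriv_mult_at analytic_intros) auto
  also have "\<dots> = (\<Sum>i = 0..n. if i = m then of_nat (n choose m) * fact m * (a ^ (n - m) * fact (Suc m + (n - m))) else 0)"
    unfolding g mono by (intro sum.cong refl) auto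
  also have "\<dots> = fact (Suc n) * of_nat (fact m * (n choose m)) * a ^ (n - m)"
    by (auto simp: mult_ac simp del: fact_Suc)
  finally show ?thesis .
qed

text \<open>
  Both sides are mixed derivatives, of orders \<open>m\<close> at \<open>p\<close> and \<open>n\<close> at \<open>q\<close>, of the symmetric function \<open>kernel\<close>.
\<close>

lemma jet_polar_sym:
  assumes "p \<noteq> q"
  shows "jet m p (polar q n) = jet n q (polar p m)"
proof (cases p; cases q)
  fix x a assume pq: "p = Some x" "q = Some a"
  then have xa: "x \<noteq> a" using assms by auto
  \<comment> \<open>Exchanging \<open>x\<close> and \<open>a\<close> multiplies the denominator by
    \<open>?e\<close>, and replacing \<open>(- 1) ^ m\<close> by \<open>(- 1) ^ n\<close> multiplies
    the numerator by \<open>?e\<close> as well.\<close>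
  let ?e = "(- 1) ^ (n + m) :: complex"
  have e: "(a - x) ^ (m + n + 2) = ?e * (x - a) ^ (n + m + 2)"
    using power_minus[of "x - a" "m + n + 2"] by (simp add: add_ac)
  have e': "(- 1) ^ n = ?e * (- 1) ^ m"
    by (simp add: power_add flip: power_mult_distrib)
  have "jet n q (polar p m) = - ((?e * (- 1) ^ m) * fact (m + n + 1)) / (?e * (x - a) ^ (n + m + 2))"
    using jet_polar_Some[OF xa[symmetric], of n m] by (simp only: pq e e')
  also have "\<dots> = ?e * - ((- 1) ^ m * fact (n + m + 1)) / (?e * (x - a) ^ (n + m + 2))"
    by (simp only: mult.assoc mult_minus_right add.commute[of m n])
  also have "\<dots> = jet m p (polar q n)"
    unfolding pq jet_polar_Some[OF xa] by (rule mult_divide_mult_cancel_left) simp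
  finally show ?thesis ..
qed (use assms in \<open>auto simp: jet_polar_None jet_polar_None'\<close>)

section \<open>Cancellation of principal parts\<close>

lemma form_residue_polar: "form_residue (polar p n) q = 0"
  using polar_in_forms_K[of p UNIV n] by (simp add: forms_K_def)

lemma forms_K_mono: "D \<subseteq> D' \<Longrightarrow> forms_K D \<subseteq> forms_K D'"
  by (auto simp: forms_K_def)

lemma span_polar_subset: "P \<subseteq> D \<Longrightarrow> cv.span {polar p n |p n. p \<in> P} \<subseteq> forms_K D"
  by (rule cv.span_minimal[OF _ subspace_forms_K]) (use polar_in_forms_K in auto)

text \<open>The induction is on the exponent of the denominator and not on the order of the pole,
  since the numerator may vanish at the base point. The difference quotient of the numerator serves
  as numerator at the next stage.\<close>

lemma cancel_pole_aux:
  assumes "form_residue \<alpha> p = 0" "g analytic_on {base p}"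
    and "eventually (\<lambda>x. form_coeff p (form_val \<alpha>) x = g x / (x - base p) ^ m) (at (base p))"
  shows "\<exists>\<beta>\<in>cv.span (range (polar p)). \<not> form_pole (\<alpha> + \<beta>) p"
  using assms
proof (induction m arbitrary: \<alpha> g)
  case 0
  have "is_pole (form_coeff p (form_val \<alpha>)) (base p) \<longleftrightarrow> is_pole g (base p)"
    using "0.prems"(3) by (intro is_pole_cong) auto
  then have "\<not> form_pole \<alpha> p"
    using "0.prems"(2) analytic_at_imp_no_pole by (simp add: form_pole_def)
  then show ?case by (intro bexI[of _ 0]) (auto simp: cv.span_zero)
next
  case (Suc m)
  let ?b = "base p"
  obtain S where S: "open S" "?b \<in> S" "g holomorphic_on S"
    using Suc.prems(2) analytic_at by blast
  define h where "h z = (if z = ?b then deriv g ?b else (g z - g ?b) / (z - ?b))" for z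
  have h: "h analytic_on {?b}"
    unfolding h_def analytic_at using S by (auto intro!: pole_lemma exI[of _ S] simp: interior_open)
  have gh: "g x = g ?b + (x - ?b) * h x" for x by (simp add: h_def)
  \<comment> \<open>\<open>polar p (m - 1)\<close> has a pole of order \<open>Suc m\<close> with
    leading coefficient \<open>- fact m\<close>, so this multiple removes the top term. For
    \<open>m = 0\<close> the pole is at most simple, and \<open>g\<close> at the base point is the
    residue, which is zero.\<close>
  define \<beta> where "\<beta> = (if m = 0 then 0 else (g ?b / fact m) *\<^sub>C polar p (m - 1))"
  have ev: "eventually (\<lambda>x. form_coeff p (form_val (\<alpha> + \<beta>)) x = h x / (x - ?b) ^ m) (at ?b)"
  proof (cases "m = 0")
    case True
    have "residue (form_coeff p (form_val \<alpha>)) ?b = residue (\<lambda>x. g x / (x - ?b) ^ Suc 0) ?b"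
      using Suc.prems(3) by (intro residue_cong) (simp_all add: True)
    also have "\<dots> = (deriv ^^ 0) g ?b / fact 0"
      using S by (intro residue_holomorphic_over_power[of S]) auto
    finally have "g ?b = 0" using Suc.prems(1) by (simp add: form_residue_def)
    have "eventually (\<lambda>x. x \<noteq> ?b) (at ?b)" by (simp add: eventually_at_filter)
    with Suc.prems(3) show ?thesis
    proof eventually_elim
      case (elim x)
      then show ?case using gh[of x] \<open>g ?b = 0\<close> by (simp add: True \<beta>_def)
    qed
  next
    case False
    then obtain k where k: "m = Suc k" by (cases m) auto
    have ne: "eventually (\<lambda>x. x \<noteq> ?b) (at ?b)" by (simp add: eventually_at_filter)
    show ?thesis
      using Suc.prems(3) eventually_form_add[of p \<alpha> \<beta>] ne
    proof eventually_elim
      case (elim x)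
      have "form_coeff p (form_val (\<alpha> + \<beta>)) x = g x / (x - ?b) ^ Suc m - g ?b / (x - ?b) ^ Suc m"
        using elim(1,2) by (simp add: k \<beta>_def form_val_scale polar_coeff_self del: fact_Suc)
      also have "\<dots> = (x - ?b) * h x / (x - ?b) ^ Suc m"
        using gh[of x] by (simp add: diff_divide_distrib[symmetric])
      finally show ?case using elim(3) by simp
    qed
  qed
  have \<beta>: "\<beta> \<in> cv.span (range (polar p))"
    unfolding \<beta>_def using cv.span_scale[OF cv.span_base[OF rangeI[of "polar p" "m - 1"]]] by (simp add: cv.span_zero)
  have "form_residue \<beta> p = 0"
    by (auto simp: \<beta>_def form_residue_scale form_residue_polar) (simp add: form_residue_def form_val_zero residue_const)
  then have "form_residue (\<alpha> + \<beta>) p = 0" using Suc.prems(1) by (simp add: form_residue_add)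
  from Suc.IH[OF this h ev] obtain \<beta>' where "\<beta>' \<in> cv.span (range (polar p))" "\<not> form_pole (\<alpha> + \<beta> + \<beta>') p"
    by blast
  then show ?case using \<beta> by (intro bexI[of _ "\<beta> + \<beta>'"]) (auto simp: add.assoc intro: cv.span_add)
qed

lemma cancel_pole:
  assumes "form_residue \<alpha> p = 0"
  shows "\<exists>\<beta>\<in>cv.span (range (polar p)). \<not> form_pole (\<alpha> + \<beta>) p"
proof (cases "form_pole \<alpha> p")
  case False
  then show ?thesis by (intro bexI[of _ 0]) (auto simp: cv.span_zero)
next
  case True
  let ?f = "form_coeff p (form_val \<alpha>)" and ?b = "base p"
  obtain S where S: "open S" "?b \<in> S" "?f holomorphic_on S - {?b}"
    by (rule form_holomorphic_punctured)
  from zorder_exist_pole[OF S(3,1,2)] True obtain r where r: "r > 0" "zor_poly ?f ?b holomorphic_on cball ?b r"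
      "\<And>w. w \<in> cball ?b r - {?b} \<Longrightarrow> ?f w = zor_poly ?f ?b w / (w - ?b) ^ nat (- zorder ?f ?b)"
    unfolding form_pole_def by blast
  have "zor_poly ?f ?b analytic_on {?b}"
    unfolding analytic_at using r(1,2) by (intro exI[of _ "ball ?b r"]) (auto intro: holomorphic_on_subset)
  moreover have "eventually (\<lambda>w. w \<in> ball ?b r - {?b}) (at ?b)"
    using r(1) by (intro eventually_at_in_open) auto
  then have "eventually (\<lambda>w. ?f w = zor_poly ?f ?b w / (w - ?b) ^ nat (- zorder ?f ?b)) (at ?b)"
    by eventually_elim (rule r(3), auto)
  ultimately show ?thesis by (rule cancel_pole_aux[OF assms])
qed

text \<open>The correction at \<open>p\<close> has poles at \<open>p\<close> only and no residues,
  so the corrected form again satisfies the assumptions, with \<open>p\<close> removed from the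
  set.\<close>

lemma cancel_poles:
  assumes "finite P" "\<alpha> \<in> forms_K P"
  shows "\<exists>\<beta>\<in>cv.span {polar p n |p n. p \<in> P}. \<forall>p. \<not> form_pole (\<alpha> + \<beta>) p"
  using assms
proof (induction P arbitrary: \<alpha>)
  case empty
  then show ?case by (intro bexI[of _ 0]) (auto simp: forms_K_def cv.span_zero)
next
  case (insert p P)
  then obtain \<beta> where b: "\<beta> \<in> cv.span (range (polar p))" "\<not> form_pole (\<alpha> + \<beta>) p"
    using cancel_pole[of \<alpha> p] by (auto simp: forms_K_def)
  have "range (polar p) = {polar q n |q n. q \<in> {p}}" by auto
  with b(1) have "\<beta> \<in> forms_K {p}" using span_polar_subset[of "{p}" "{p}"] by auto
  then have "\<alpha> + \<beta> \<in> forms_K (insert p P)"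
    using insert.prems forms_K_mono[of "{p}" "insert p P"] cv.subspace_add[OF subspace_forms_K] by blast
  then have "\<alpha> + \<beta> \<in> forms_K P" using b(2) by (auto simp: forms_K_def)
  from insert.IH[OF this] obtain \<beta>' where b': "\<beta>' \<in> cv.span {polar p n |p n. p \<in> P}"
      "\<forall>p. \<not> form_pole (\<alpha> + \<beta> + \<beta>') p" by blast
  have "\<beta> \<in> cv.span {polar q n |q n. q \<in> insert p P}" "\<beta>' \<in> cv.span {polar q n |q n. q \<in> insert p P}"
    by (rule subsetD[OF cv.span_mono b(1)], auto) (rule subsetD[OF cv.span_mono b'(1)], auto)
  then show ?case using b'(2) by (intro bexI[of _ "\<beta> + \<beta>'"]) (auto simp: add.assoc intro: cv.span_add)
qed

section \<open>Forms on the whole sphere: Liouville's theorem, finiteness of poles, identity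
  theorem\<close>

lemma form_nice_UNIV: "(\<lambda>z. form_val \<alpha> (Some z)) nicely_meromorphic_on UNIV"
proof -
  have *: "(\<lambda>z. form_val \<alpha> (Some z)) nicely_meromorphic_on {z}" for z
    using form_nice[of "Some z" \<alpha>] by simp
  then have "(\<lambda>z. form_val \<alpha> (Some z)) meromorphic_on UNIV"
    by (subst meromorphic_on_meromorphic_at) (auto simp: nicely_meromorphic_on_def)
  with * show ?thesis unfolding nicely_meromorphic_on_def by blast
qed

text \<open>The value at infinity is forced: the coefficient there vanishes off \<open>0\<close>, so
  it has no pole and takes its limit as value.\<close>

lemma form_zeroI:
  assumes "\<And>z. form_val \<alpha> (Some z) = 0"
  shows "\<alpha> = 0"
proof -
  let ?F = "form_coeff None (form_val \<alpha>)"
  have ev: "eventually (\<lambda>w. ?F w = 0) (at 0)"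
    by (auto simp: eventually_at_filter form_coeff_None assms)
  have "is_pole ?F 0 \<longleftrightarrow> is_pole (\<lambda>_. 0::complex) (0::complex)" using ev by (intro is_pole_cong) auto
  then have "\<not> is_pole ?F 0" by (simp add: analytic_at_imp_no_pole)
  then have "?F analytic_on {0}" using form_pole_iff[of \<alpha> None] by (simp add: form_pole_def)
  then have "isCont ?F 0" by (intro analytic_at_imp_isCont)
  then have "(?F \<longlongrightarrow> form_val \<alpha> None) (at 0)"
    by (simp add: isCont_def form_coeff_None)
  moreover have "(?F \<longlongrightarrow> 0) (at 0)" using ev by (rule tendsto_eventually)
  ultimately have "form_val \<alpha> None = 0" by (rule tendsto_unique[rotated]) simp
  then have "form_val \<alpha> p = 0" for p using assms by (cases p) auto
  then show ?thesis by (simp add: form_val_inject[symmetric] zero_mform.rep_eq fun_eq_iff)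
qed

text \<open>Regularity at infinity makes the coefficient of \<open>dz\<close> equal to
  \<open>- w\<^sup>2\<close> times a function continuous at \<open>w = 0\<close>, so this entire
  function tends to 0 at infinity.\<close>

lemma form_no_pole_zero:
  assumes "\<And>p. \<not> form_pole \<alpha> p"
  shows "\<alpha> = 0"
proof (rule form_zeroI)
  let ?f = "\<lambda>z. form_val \<alpha> (Some z)" and ?F = "form_coeff None (form_val \<alpha>)"
  have "?f analytic_on {z}" for z using assms[of "Some z"] by (simp add: form_pole_iff)
  then have "?f holomorphic_on UNIV"
    by (meson analytic_imp_holomorphic analytic_on_analytic_at)
  moreover have "(?f \<longlongrightarrow> 0) at_infinity"
  proof -
    have "isCont ?F 0" using assms[of None] by (intro analytic_at_imp_isCont) (simp add: form_pole_iff)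
    then have "((\<lambda>w. - (w ^ 2) * ?F w) \<longlongrightarrow> - (0 ^ 2) * ?F 0) (at 0)"
      by (intro tendsto_intros) (simp add: isCont_def)
    moreover have "eventually (\<lambda>w. - (w ^ 2) * ?F w = ?f (inverse w)) (at 0)"
      by (auto simp: eventually_at_filter form_coeff_None divide_inverse)
    ultimately have "((\<lambda>w. ?f (inverse w)) \<longlongrightarrow> 0) (at 0)"
      using tendsto_cong by force
    then show ?thesis by (simp add: lim_at_infinity_0 o_def)
  qed
  ultimately show "?f z = 0" for z by (rule Liouville_weak_0)
qed

text \<open>The singularity at infinity is isolated, so all finite poles lie in the disc of radius
  \<open>1 / r\<close>; this is compact, and the singularities of a meromorphic function are
  sparse.\<close>

lemma finite_form_poles: "finite {p. form_pole \<alpha> p}"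
proof -
  let ?f = "\<lambda>z. form_val \<alpha> (Some z)" and ?F = "form_coeff None (form_val \<alpha>)"
  obtain r where r: "r > 0" "?F analytic_on ball 0 r - {0}"
    using form_isolated[of None \<alpha>] unfolding isolated_singularity_at_def by auto
  have an: "?f analytic_on {z}" if "norm z > 1 / r" for z
  proof -
    have z: "z \<noteq> 0" using that r(1) by auto
    have "norm (1 / z) < r" using that r(1) z by (simp add: norm_divide field_simps)
    then have "?F analytic_on {1 / z}" using z by (intro analytic_on_subset[OF r(2)]) auto
    then have "(\<lambda>x. - ?F (1 / x) / x ^ 2) analytic_on {z}"
      using z by (intro analytic_intros analytic_inverse_chart') auto
    moreover have "?f analytic_on {z} \<longleftrightarrow> (\<lambda>x. - ?F (1 / x) / x ^ 2) analytic_on {z}"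
      by (intro analytic_at_cong eventually_mono[OF eventually_neq_nhds[OF z]])
        (auto simp: form_coeff_None field_simps)
    ultimately show ?thesis by simp
  qed
  have "?f meromorphic_on cball 0 (1 / r)"
    using form_nice_UNIV[of \<alpha>] meromorphic_on_subset unfolding nicely_meromorphic_on_def by blast
  then have "finite (cball 0 (1 / r) \<inter> {z. \<not> ?f analytic_on {z}})"
    by (intro sparse_in_compact_finite meromorphic_on_imp_sparse_singularities) auto
  moreover have "{p. form_pole \<alpha> p} \<subseteq> insert None (Some ` (cball 0 (1 / r) \<inter> {z. \<not> ?f analytic_on {z}}))"
  proof
    fix p assume "p \<in> {p. form_pole \<alpha> p}"
    then show "p \<in> insert None (Some ` (cball 0 (1 / r) \<inter> {z. \<not> ?f analytic_on {z}}))"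
      using an by (cases p) (force simp: form_pole_iff)+
  qed
  ultimately show ?thesis using finite_subset by blast
qed

theorem forms_K_eq_span: "forms_K D = cv.span {polar p n |p n. p \<in> D}"
proof
  show "cv.span {polar p n |p n. p \<in> D} \<subseteq> forms_K D" by (rule span_polar_subset) simp
  show "forms_K D \<subseteq> cv.span {polar p n |p n. p \<in> D}"
  proof
    fix \<alpha> assume \<alpha>: "\<alpha> \<in> forms_K D"
    define P where "P = {p. form_pole \<alpha> p}"
    have "\<alpha> \<in> forms_K P" "P \<subseteq> D" using \<alpha> by (auto simp: forms_K_def P_def)
    with cancel_poles[of P \<alpha>] finite_form_poles[of \<alpha>] obtain \<beta>
      where \<beta>: "\<beta> \<in> cv.span {polar p n |p n. p \<in> P}" "\<And>p. \<not> form_pole (\<alpha> + \<beta>) p"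
      unfolding P_def[symmetric] by blast
    have "\<alpha> = - \<beta>" using form_no_pole_zero[OF \<beta>(2)] by (simp add: eq_neg_iff_add_eq_0)
    moreover have "\<beta> \<in> cv.span {polar p n |p n. p \<in> D}"
      by (rule subsetD[OF cv.span_mono \<beta>(1)]) (use \<open>P \<subseteq> D\<close> in auto)
    ultimately show "\<alpha> \<in> cv.span {polar p n |p n. p \<in> D}" by (simp add: cv.span_neg)
  qed
qed

text \<open>The identity theorem is applied in the plane, so a finite point of \<open>D\<close> is
  required. If the given point is infinity, a punctured neighbourhood in its chart supplies
  one.\<close>

lemma form_zero_if_zero_on_open:
  assumes D: "openin sphere_topology D" "D \<noteq> {}" and zero: "\<And>p. p \<in> D \<Longrightarrow> form_val \<alpha> p = 0"
  shows "\<alpha> = 0"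
proof (rule form_zeroI)
  let ?S = "{z. chart_pt (Some 0) z \<in> D}"
  have "open ?S" by (rule open_chart_preimage[OF D(1)])
  obtain p where p: "p \<in> D" using D by blast
  have "\<exists>z. Some z \<in> D"
  proof (cases p)
    case None
    have "open {w. chart_pt None w \<in> D}" by (rule open_chart_preimage[OF D(1)])
    moreover have "0 \<in> {w. chart_pt None w \<in> D}" using p None by (simp add: chart_pt_def)
    ultimately have "eventually (\<lambda>w. w \<in> {w. chart_pt None w \<in> D} - {0}) (at 0)"
      by (rule eventually_at_in_open)
    then obtain w where "w \<noteq> 0" "chart_pt None w \<in> D"
      using eventually_happens[of _ "at (0::complex)"] by auto
    then show ?thesis by (auto simp: chart_pt_def)
  qed (use p in auto)
  then obtain z0 where "z0 \<in> ?S" by (auto simp: chart_pt_def)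
  with \<open>open ?S\<close> have "eventually (\<lambda>z. z \<in> ?S) (at z0)" by (rule eventually_at_in_open')
  then have "eventually (\<lambda>z. form_val \<alpha> (Some z) = 0) (at z0)"
    by eventually_elim (simp add: chart_pt_def zero)
  then have "frequently (\<lambda>z. form_val \<alpha> (Some z) = 0) (at z0)"
    by (rule eventually_frequently[rotated]) simp
  then show "form_val \<alpha> (Some z) = 0" for z
    by (rule frequently_eq_meromorphic_imp_constant[OF _ form_nice_UNIV]) auto
qed

subsection \<open>Extension of linear functionals and of the pairing of forms\<close>

interpretation cp: vector_space_pair "scaleC :: complex \<Rightarrow> 'v::complex_vector \<Rightarrow> 'v" "(*) :: complex \<Rightarrow> complex \<Rightarrow> complex"
  by standard (simp_all add: scaleC_add_right scaleC_add_left scaleC_scaleC scaleC_one algebra_simps)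

definition linear_on :: "'v::complex_vector set \<Rightarrow> ('v \<Rightarrow> complex) \<Rightarrow> bool" where
  "linear_on V f \<longleftrightarrow> (\<forall>a\<in>V. \<forall>b\<in>V. f (a + b) = f a + f b) \<and> (\<forall>c. \<forall>a\<in>V. f (c *\<^sub>C a) = c * f a)"

lemma alg_linear_imp_linear_on: "cc.alg_linear f \<Longrightarrow> linear_on V f"
  by (simp add: cc.alg_linear_def linear_on_def)

lemma linear_on_eq_span:
  assumes V: "cv.subspace V" and lin: "linear_on V f" "linear_on V g"
    and S: "S \<subseteq> V" "\<And>s. s \<in> S \<Longrightarrow> f s = g s" and v: "v \<in> cv.span S"
  shows "f v = g v"
proof -
  have "f 0 = g 0"
    using lin cv.subspace_0[OF V] cv.scale_zero_left unfolding linear_on_def by (metis mult_zero_left)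
  then have "cv.subspace {v \<in> V. f v = g v}"
    using V lin by (intro cv.subspaceI)
      (auto simp: linear_on_def intro: cv.subspace_0 cv.subspace_add cv.subspace_scale)
  then have "cv.span S \<subseteq> {v \<in> V. f v = g v}"
    using S by (intro cv.span_minimal) auto
  with v show ?thesis by blast
qed

lemma alg_linear_construct: "cv.independent B \<Longrightarrow> cc.alg_linear (cp.construct B f)"
  using cp.linear_construct[of B f] unfolding cc.alg_linear_def
  by (auto simp: Vector_Spaces.linear_iff)

lemma linear_extension_exists:
  fixes V :: "'v::complex_vector set"
  assumes V: "cv.subspace V" and f: "linear_on V f"
  shows "\<exists>\<mu>. cc.alg_linear \<mu> \<and> (\<forall>v\<in>V. \<mu> v = f v)"
proof -
  obtain B where B: "B \<subseteq> V" "cv.independent B" "V \<subseteq> cv.span B"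
    by (rule cv.maximal_independent_subset)
  have "cp.construct B f v = f v" if "v \<in> V" for v
    by (rule linear_on_eq_span[OF V _ _ B(1)])
      (use B that f alg_linear_construct[OF B(2), of f] in \<open>auto simp: cp.construct_basis alg_linear_imp_linear_on\<close>)
  then show ?thesis using alg_linear_construct[OF B(2)] by blast
qed

text \<open>\<open>der\<close> asks for a functional on the whole space. Any extension will do,
  because derivations that agree on \<open>V\<close> agree on \<open>Sym V\<close>.\<close>

definition lin_ext :: "'v::complex_vector set \<Rightarrow> ('v \<Rightarrow> complex) \<Rightarrow> 'v \<Rightarrow> complex" where
  "lin_ext V f = (SOME \<mu>. cc.alg_linear \<mu> \<and> (\<forall>v\<in>V. \<mu> v = f v))"

lemma
  assumes "cv.subspace V" "linear_on V f"
  shows alg_linear_lin_ext: "cc.alg_linear (lin_ext V f)"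
    and lin_ext_eq: "v \<in> V \<Longrightarrow> lin_ext V f v = f v"
  using someI_ex[OF linear_extension_exists[OF assms]] by (auto simp: lin_ext_def)

text \<open>The form in which the separation by the curve enters. It is symmetric, so every result
  can be applied with the two domains exchanged.\<close>

definition dual_domains :: "point set \<Rightarrow> point set \<Rightarrow> bool" where
  "dual_domains D D' \<longleftrightarrow> openin sphere_topology D \<and> openin sphere_topology D' \<and> D \<noteq> {} \<and> D' \<noteq> {} \<and> D \<inter> D' = {}"

lemma dual_domains_sym: "dual_domains D D' \<Longrightarrow> dual_domains D' D"
  by (auto simp: dual_domains_def)

lemma forms_K_not_pole: "\<alpha> \<in> forms_K D \<Longrightarrow> p \<notin> D \<Longrightarrow> \<not> form_pole \<alpha> p"
  by (auto simp: forms_K_def)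

lemma linear_on_jet: "p \<notin> D \<Longrightarrow> linear_on (forms_K D) (jet n p)"
  using forms_K_not_pole by (auto simp: linear_on_def jet_add jet_scale)

text \<open>
  The pairing of forms is determined by the duality between the generators \<open>polar z n\<close> of
  \<open>forms_K D\<close> and the jets of elements of \<open>forms_K D'\<close>; it exists since the mixed jets
  of the kernel commute.
\<close>

lemma form_pairing_exists:
  assumes dd: "dual_domains D D'"
  obtains b where "bilinear_form b"
    "\<And>u z n. u \<in> forms_K D' \<Longrightarrow> z \<in> D \<Longrightarrow> b u (polar z n) = jet n z u"
    "\<And>v z n. v \<in> forms_K D \<Longrightarrow> z \<in> D' \<Longrightarrow> b (polar z n) v = jet n z v"
proof -
  have disj: "z \<notin> D'" if "z \<in> D" for z using that dd by (auto simp: dual_domains_def)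
  let ?S = "{polar p n |p n. p \<in> D}" and ?S' = "{polar p n |p n. p \<in> D'}"
  \<comment> \<open>A basis extracted from the generators allows \<open>b\<close> to be prescribed
    freely in its second argument.\<close>
  obtain B where B: "B \<subseteq> ?S" "cv.independent B" "?S \<subseteq> cv.span B"
    by (rule cv.maximal_independent_subset)
  have span_B: "cv.span B = forms_K D"
    unfolding forms_K_eq_span
    using cv.span_mono[OF B(1)] cv.span_mono[OF B(3)] by (simp add: cv.span_span)
  have "\<forall>w\<in>B. \<exists>z n. z \<in> D \<and> w = polar z n" using B(1) by blast
  then obtain zz nn where zn: "\<And>w. w \<in> B \<Longrightarrow> zz w \<in> D" "\<And>w. w \<in> B \<Longrightarrow> w = polar (zz w) (nn w)"
    by metis
  define h where "h w = lin_ext (forms_K D') (jet (nn w) (zz w))" for w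
  have h: "cc.alg_linear (h w)" "\<And>u. u \<in> forms_K D' \<Longrightarrow> h w u = jet (nn w) (zz w) u" if "w \<in> B" for w
    unfolding h_def using that zn disj
    by (simp_all add: alg_linear_lin_ext lin_ext_eq subspace_forms_K linear_on_jet)
  define b where "b u v = cp.construct B (\<lambda>w. h w u) v" for u v
  have "b (u + u') v = b u v + b u' v" "b (c *\<^sub>C u) v = c * b u v" for u u' v c
  proof -
    have "cp.construct B (\<lambda>w. h w (u + u')) = cp.construct B (\<lambda>w. h w u + h w u')"
      using h(1) by (intro cp.construct_cong) (simp add: cc.alg_linear_def)
    then show "b (u + u') v = b u v + b u' v" by (simp add: b_def cp.construct_add B)
    have "cp.construct B (\<lambda>w. h w (c *\<^sub>C u)) = cp.construct B (\<lambda>w. c * h w u)"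
      using h(1) by (intro cp.construct_cong) (simp add: cc.alg_linear_def)
    then show "b (c *\<^sub>C u) v = c * b u v" by (simp add: b_def cp.construct_scale B)
  qed
  then have left: "cc.alg_linear (\<lambda>u. b u v)" for v by (simp add: cc.alg_linear_def)
  have right: "cc.alg_linear (b u)" for u
    unfolding b_def using alg_linear_construct[OF B(2)] by simp
  have "bilinear_form b" by standard (rule left, rule right)
  moreover have b1: "b (polar z n) v = jet n z v" if "v \<in> forms_K D" "z \<in> D'" for v z n
  proof (rule linear_on_eq_span[of "forms_K D" _ _ B])
    show "linear_on (forms_K D) (b (polar z n))" by (rule alg_linear_imp_linear_on[OF right])
    show "linear_on (forms_K D) (jet n z)" using that disj by (intro linear_on_jet) auto
    fix w assume w: "w \<in> B"
    have "b (polar z n) w = h w (polar z n)" by (simp add: b_def cp.construct_basis B w)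
    also have "\<dots> = jet (nn w) (zz w) (polar z n)" using w that by (intro h polar_in_forms_K)
    also have "\<dots> = jet n z (polar (zz w) (nn w))"
      using zn(1)[OF w] disj that by (intro jet_polar_sym) auto
    also have "polar (zz w) (nn w) = w" using zn(2)[OF w] by simp
    finally show "b (polar z n) w = jet n z w" .
  qed (use B that span_B polar_in_forms_K in \<open>auto simp: subspace_forms_K\<close>)
  \<comment> \<open>The generator \<open>polar z n\<close> need not belong to the basis. Both sides
    are linear in \<open>u\<close>, and for \<open>u = polar p m\<close> the claim is the rule just
    shown combined with the symmetry of mixed jets.\<close>
  moreover have "b u (polar z n) = jet n z u" if "u \<in> forms_K D'" "z \<in> D" for u z n
  proof (rule linear_on_eq_span[of "forms_K D'" "\<lambda>u. b u (polar z n)" _ ?S'])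
    show "linear_on (forms_K D') (\<lambda>u. b u (polar z n))" by (rule alg_linear_imp_linear_on[OF left])
    show "linear_on (forms_K D') (jet n z)" using that disj by (intro linear_on_jet) auto
    fix w assume "w \<in> ?S'"
    then obtain p m where w: "p \<in> D'" "w = polar p m" by auto
    then show "b w (polar z n) = jet n z w"
      using that disj b1[of "polar z n" p m] jet_polar_sym[of p z m n] by (auto simp: polar_in_forms_K)
  next
    show "u \<in> cv.span ?S'" using that(1) by (simp only: forms_K_eq_span)
  qed (use polar_in_forms_K in \<open>auto simp: subspace_forms_K\<close>)
  ultimately show thesis using that[of b] by blast
qed

subsection \<open>The operators and their Lie derivatives\<close>

abbreviation dfun :: "('v::complex_vector \<Rightarrow> complex) \<Rightarrow> 'v sym \<Rightarrow> 'v sym" where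
  "dfun \<mu> \<equiv> der (\<lambda>v. sconst (\<mu> v))"

lemmas dfun_simps = der_simps[OF alg_linear_sconst]

lemma dfun_cong:
  assumes "cc.alg_linear \<mu>" "cc.alg_linear \<nu>" "\<And>v. v \<in> V \<Longrightarrow> \<mu> v = \<nu> v" "x \<in> Sym V"
  shows "dfun \<mu> x = dfun \<nu> x"
  using assms by (intro der_cong_Sym[of _ _ V]) (auto intro: alg_linear_sconst)

lemma dfun_uminus: "cc.alg_linear \<mu> \<Longrightarrow> dfun (\<lambda>v. - \<mu> v) x = - dfun \<mu> x"
  using der_times[OF alg_linear_sconst, of \<mu> "- 1" x] by (simp add: sconst_uminus)

text \<open>The pairs do not depend on \<open>\<mu>\<close>. With evaluation at \<open>z\<close> for
  \<open>\<mu>\<close>, the dependence of \<open>i(z) x\<close> on \<open>z\<close> is thereby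
  carried by finitely many scalar sections.\<close>

lemma dfun_decomposition:
  assumes "x \<in> Sym V"
  shows "\<exists>xs. set xs \<subseteq> V \<times> Sym V \<and>
    (\<forall>\<mu>. cc.alg_linear \<mu> \<longrightarrow> dfun \<mu> x = (\<Sum>(\<beta>, w)\<leftarrow>xs. sconst (\<mu> \<beta>) * w))"
  using assms
proof induction
  case (gen v)
  then show ?case
    by (intro exI[of _ "[(v, 1)]"]) (auto simp: dfun_simps one_in_Sym)
next
  case (const c)
  show ?case by (intro exI[of _ "[]"]) (auto simp: dfun_simps)
next
  case (add x y)
  then obtain xs ys where "set xs \<subseteq> V \<times> Sym V" "set ys \<subseteq> V \<times> Sym V"
    "\<And>\<mu>. cc.alg_linear \<mu> \<Longrightarrow> dfun \<mu> x = (\<Sum>(\<beta>, w)\<leftarrow>xs. sconst (\<mu> \<beta>) * w)"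
    "\<And>\<mu>. cc.alg_linear \<mu> \<Longrightarrow> dfun \<mu> y = (\<Sum>(\<beta>, w)\<leftarrow>ys. sconst (\<mu> \<beta>) * w)"
    by blast
  then show ?case by (intro exI[of _ "xs @ ys"]) (auto simp: dfun_simps)
next
  case (mult x y)
  then obtain xs ys where xs: "set xs \<subseteq> V \<times> Sym V" and ys: "set ys \<subseteq> V \<times> Sym V"
    and *: "\<And>\<mu>. cc.alg_linear \<mu> \<Longrightarrow> dfun \<mu> x = (\<Sum>(\<beta>, w)\<leftarrow>xs. sconst (\<mu> \<beta>) * w)"
    "\<And>\<mu>. cc.alg_linear \<mu> \<Longrightarrow> dfun \<mu> y = (\<Sum>(\<beta>, w)\<leftarrow>ys. sconst (\<mu> \<beta>) * w)"
    by blast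
  let ?zs = "map (\<lambda>(\<beta>, w). (\<beta>, w * y)) xs @ map (\<lambda>(\<beta>, w). (\<beta>, x * w)) ys"
  have "set ?zs \<subseteq> V \<times> Sym V" using xs ys mult by (auto intro: Sym.mult)
  moreover have "dfun \<mu> (x * y) = (\<Sum>(\<beta>, w)\<leftarrow>?zs. sconst (\<mu> \<beta>) * w)" if "cc.alg_linear \<mu>" for \<mu>
    using that
    by (simp add: dfun_simps * sum_list_mult_const[symmetric] sum_list_const_mult[symmetric]
        o_def case_prod_unfold mult_ac)
  ultimately show ?case by blast
qed

context
  fixes D :: "point set"
begin

lemma space_W_simps:
  "x \<in> space_W D \<Longrightarrow> y \<in> space_W D \<Longrightarrow> x + y \<in> space_W D"
  "x \<in> space_W D \<Longrightarrow> y \<in> space_W D \<Longrightarrow> x * y \<in> space_W D"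
  "x \<in> space_W D \<Longrightarrow> y \<in> space_W D \<Longrightarrow> x - y \<in> space_W D"
  "sconst c \<in> space_W D" "\<alpha> \<in> forms_K D \<Longrightarrow> sgen \<alpha> \<in> space_W D" "1 \<in> space_W D"
proof -
  assume "x \<in> space_W D" "y \<in> space_W D"
  then have "x + sconst (- 1) * y \<in> Sym (forms_K D)" unfolding space_W_def by (intro Sym.intros)
  then show "x - y \<in> space_W D" by (simp add: space_W_def sconst_uminus)
qed (auto simp: space_W_def one_in_Sym intro: Sym.intros)

lemma dfun_in_W: "cc.alg_linear \<mu> \<Longrightarrow> x \<in> space_W D \<Longrightarrow> dfun \<mu> x \<in> space_W D"
  unfolding space_W_def by (rule der_in_Sym)

text \<open>A derivation with \<open>d 1 = 0\<close> is determined on \<open>space_W D\<close> by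
  its values on generators, and extensionality fixes it elsewhere. So the description denotes a
  restriction of \<open>dfun \<mu>\<close>, whichever extension \<open>\<mu>\<close> of the
  evaluation is used.\<close>

lemma annihilation_eq:
  assumes \<mu>: "cc.alg_linear \<mu>" "\<And>\<alpha>. \<alpha> \<in> forms_K D \<Longrightarrow> \<mu> \<alpha> = - form_val \<alpha> z" and x: "x \<in> space_W D"
  shows "annihilation D z x = dfun \<mu> x"
proof -
  define d where "d = restrict (dfun \<mu>) (space_W D)"
  have "annihilation D z = d"
    unfolding annihilation_def
  proof (rule the_equality)
    show "d \<in> space_W D \<rightarrow>\<^sub>E space_W D \<and> derivation_on (space_W D) d \<and>
        d 1 = 0 \<and> (\<forall>\<alpha>\<in>forms_K D. d (sgen \<alpha>) = - sconst (form_val \<alpha> z))"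
      using \<mu> by (auto simp: d_def derivation_on_def dfun_simps space_W_simps dfun_in_W sconst_uminus)
  next
    fix d' assume d': "d' \<in> space_W D \<rightarrow>\<^sub>E space_W D \<and> derivation_on (space_W D) d' \<and>
        d' 1 = 0 \<and> (\<forall>\<alpha>\<in>forms_K D. d' (sgen \<alpha>) = - sconst (form_val \<alpha> z))"
    show "d' = d"
    proof (rule PiE_ext[of d' "space_W D" "\<lambda>_. space_W D" d])
      fix x assume "x \<in> space_W D"
      then have "x \<in> Sym (forms_K D)" by (simp add: space_W_def)
      then have "d' x = dfun \<mu> x"
      proof induction
        case (const c)
        have "d' (sconst c * 1) = sconst c * d' 1"
          using d' space_W_simps(6) unfolding derivation_on_def by blast
        then show ?case using d' \<mu> by (simp add: dfun_simps)
      qed (use d' \<mu> in \<open>auto simp: derivation_on_def space_W_def dfun_simps sconst_uminus\<close>)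
      then show "d' x = d x" using \<open>x \<in> space_W D\<close> by (simp add: d_def)
    qed (use d' \<mu> in \<open>auto simp: d_def dfun_in_W\<close>)
  qed
  then show ?thesis using x by (simp add: d_def)
qed

text \<open>
  \<open>L\<^sub>X\<^sup>N i(z)\<close> turns out to be the derivation \<open>dfun (lie_fun D X N z)\<close>. Evaluation at \<open>z\<close> is linear only
  on forms regular at \<open>z\<close> (poles have the junk value \<open>0\<close>), so a linear extension is chosen.
\<close>

definition lie_fun :: "(point \<Rightarrow> complex) \<Rightarrow> nat \<Rightarrow> point \<Rightarrow> mform \<Rightarrow> complex" where
  "lie_fun X N z = lin_ext (forms_K D) (\<lambda>\<alpha>. - (lie X ^^ N) (form_val \<alpha>) z)"

lemma lie_power_jet:
  assumes "regular_vector_field X" "\<not> form_pole \<alpha> z"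
  shows "(lie X ^^ N) (form_val \<alpha>) z = (\<Sum>n\<le>N. lie_sym (vec_coeff z X) N n (base z) * jet n z \<alpha>)"
  using lie_power_analytic(1)[OF assms(1)] assms(2) by (simp add: jet_def form_pole_iff)

lemma
  assumes X: "regular_vector_field X" and z: "z \<notin> D"
  shows alg_linear_lie_fun: "cc.alg_linear (lie_fun X N z)"
    and lie_fun_eq: "\<alpha> \<in> forms_K D \<Longrightarrow> lie_fun X N z \<alpha> = - (lie X ^^ N) (form_val \<alpha>) z"
proof -
  have *: "(lie X ^^ N) (form_val \<alpha>) z = (\<Sum>n\<le>N. lie_sym (vec_coeff z X) N n (base z) * jet n z \<alpha>)"
    if "\<alpha> \<in> forms_K D" for \<alpha>
    by (rule lie_power_jet[OF X forms_K_not_pole[OF that z]])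
  have "linear_on (forms_K D) (\<lambda>\<alpha>. - (lie X ^^ N) (form_val \<alpha>) z)"
    unfolding linear_on_def
  proof (intro conjI ballI allI)
    fix \<alpha> \<beta> c assume ab: "\<alpha> \<in> forms_K D" "\<beta> \<in> forms_K D"
    have sub: "\<alpha> + \<beta> \<in> forms_K D" "c *\<^sub>C \<alpha> \<in> forms_K D"
      using ab by (auto intro: cv.subspace_add cv.subspace_scale subspace_forms_K)
    have l: "linear_on (forms_K D) (jet n z)" for n by (rule linear_on_jet[OF z])
    show "- (lie X ^^ N) (form_val (\<alpha> + \<beta>)) z = - (lie X ^^ N) (form_val \<alpha>) z + - (lie X ^^ N) (form_val \<beta>) z"
      using l ab by (simp add: * sub linear_on_def distrib_left sum.distrib)
    show "- (lie X ^^ N) (form_val (c *\<^sub>C \<alpha>)) z = c * - (lie X ^^ N) (form_val \<alpha>) z"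
      using l ab by (simp add: * sub linear_on_def sum_distrib_left mult_ac)
  qed
  then show "cc.alg_linear (lie_fun X N z)"
    "\<alpha> \<in> forms_K D \<Longrightarrow> lie_fun X N z \<alpha> = - (lie X ^^ N) (form_val \<alpha>) z"
    unfolding lie_fun_def by (simp_all add: alg_linear_lin_ext lin_ext_eq subspace_forms_K)
qed

end

lemma regular_zero: "regular_vector_field (\<lambda>_. 0)"
proof -
  have "vec_coeff p (\<lambda>_. 0) = (\<lambda>_. 0)" for p by (cases p) (auto simp: vec_coeff_def)
  then show ?thesis by (simp add: regular_vector_field_def)
qed

text \<open>Minus the evaluation at \<open>z\<close>, taken as the case of order 0 so that
  \<open>i(z)\<close> is covered by the facts about its Lie derivatives.\<close>

abbreviation point_fun :: "point set \<Rightarrow> point \<Rightarrow> mform \<Rightarrow> complex" where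
  "point_fun D z \<equiv> lie_fun D (\<lambda>_. 0) 0 z"

lemma alg_linear_point_fun: "z \<notin> D \<Longrightarrow> cc.alg_linear (point_fun D z)"
  by (rule alg_linear_lie_fun[OF regular_zero])

lemma point_fun_eq: "z \<notin> D \<Longrightarrow> \<alpha> \<in> forms_K D \<Longrightarrow> point_fun D z \<alpha> = - form_val \<alpha> z"
  by (simp add: lie_fun_eq[OF regular_zero])

lemma annihilation_point_fun:
  "z \<notin> D \<Longrightarrow> x \<in> space_W D \<Longrightarrow> annihilation D z x = dfun (point_fun D z) x"
  by (intro annihilation_eq alg_linear_point_fun point_fun_eq)

section \<open>Correlation functions and the uniqueness of operator derivatives\<close>

lemma correlation_snoc: "correlation D (ps @ [p]) x = correlation D ps (annihilation D p x)"
  by (simp add: correlation_def)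

lemma annihilation_in_W: "z \<notin> D \<Longrightarrow> x \<in> space_W D \<Longrightarrow> annihilation D z x \<in> space_W D"
  by (simp add: annihilation_point_fun dfun_in_W alg_linear_point_fun)

lemma correlation_foldr:
  assumes "set ps \<subseteq> - D" "x \<in> space_W D"
  shows "correlation D ps x = vacuum_part (foldr (\<lambda>p. dfun (point_fun D p)) ps x)"
  using assms
proof (induction ps arbitrary: x rule: rev_induct)
  case (snoc p ps)
  then have "annihilation D p x \<in> space_W D" by (intro annihilation_in_W) auto
  with snoc have "correlation D (ps @ [p]) x = vacuum_part (foldr (\<lambda>p. dfun (point_fun D p)) ps (annihilation D p x))"
    by (simp add: correlation_snoc)
  also have "annihilation D p x = dfun (point_fun D p) x"
    using snoc.prems by (intro annihilation_point_fun) auto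
  finally show ?case by simp
qed (simp add: correlation_def)

lemma
  assumes ps: "set ps \<subseteq> - D" and x: "x \<in> space_W D"
  shows correlation_add: "y \<in> space_W D \<Longrightarrow> correlation D ps (x + y) = correlation D ps x + correlation D ps y"
    and correlation_scale: "correlation D ps (sconst c * x) = c * correlation D ps x"
proof -
  have "foldr (\<lambda>p. dfun (point_fun D p)) ps (x + y) =
      foldr (\<lambda>p. dfun (point_fun D p)) ps x + foldr (\<lambda>p. dfun (point_fun D p)) ps y"
    using ps by (induction ps) (simp_all add: dfun_simps alg_linear_point_fun)
  then show "y \<in> space_W D \<Longrightarrow> correlation D ps (x + y) = correlation D ps x + correlation D ps y"
    using ps x by (simp add: correlation_foldr space_W_simps)
  have "foldr (\<lambda>p. dfun (point_fun D p)) ps (sconst c * x) =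
      sconst c * foldr (\<lambda>p. dfun (point_fun D p)) ps x"
    using ps by (induction ps) (simp_all add: dfun_simps alg_linear_point_fun)
  then show "correlation D ps (sconst c * x) = c * correlation D ps x"
    using ps x by (simp add: correlation_foldr space_W_simps)
qed

lemma dfun_decomposition_nat:
  assumes "x \<in> space_W D"
  obtains n \<beta> w where "\<And>i. i < n \<Longrightarrow> \<beta> i \<in> forms_K D" "\<And>i. i < n \<Longrightarrow> w i \<in> space_W D"
    "\<And>\<mu>. cc.alg_linear \<mu> \<Longrightarrow> dfun \<mu> x = (\<Sum>i<(n::nat). sconst (\<mu> (\<beta> i)) * w i)"
proof -
  obtain xs where xs: "set xs \<subseteq> forms_K D \<times> space_W D"
    "\<And>\<mu>. cc.alg_linear \<mu> \<Longrightarrow> dfun \<mu> x = (\<Sum>(\<beta>, w)\<leftarrow>xs. sconst (\<mu> \<beta>) * w)"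
    using dfun_decomposition[of x "forms_K D"] assms unfolding space_W_def by blast
  show thesis
  proof (rule that)
    fix i assume "i < length xs"
    then have "xs ! i \<in> forms_K D \<times> space_W D" using xs(1) nth_mem by blast
    then show "fst (xs ! i) \<in> forms_K D" "snd (xs ! i) \<in> space_W D" by (auto simp: mem_Times_iff)
  next
    fix \<mu> :: "mform \<Rightarrow> complex" assume "cc.alg_linear \<mu>"
    then show "dfun \<mu> x = (\<Sum>i<length xs. sconst (\<mu> (fst (xs ! i))) * snd (xs ! i))"
      by (simp add: xs(2) sum_list_sum_nth atLeast0LessThan case_prod_unfold)
  qed
qed

text \<open>Evaluations outside \<open>D\<close> separate forms, because they include those on the
  open set \<open>D'\<close>.\<close>

lemma correlation_zero_imp_zero:
  assumes dd: "dual_domains D D'" and x: "x \<in> space_W D"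
    and zero: "\<And>ps. set ps \<subseteq> - D \<Longrightarrow> correlation D ps x = 0"
  shows "x = 0"
proof (rule correlations_separate[OF subspace_forms_K, where P = "- D" and \<mu> = "point_fun D"])
  fix v assume v: "v \<in> forms_K D" "\<And>p. p \<in> - D \<Longrightarrow> point_fun D p v = 0"
  have "form_val v p = 0" if "p \<in> D'" for p
  proof -
    have "p \<in> - D" using that dd by (auto simp: dual_domains_def)
    then show ?thesis using v point_fun_eq[of p D v] by simp
  qed
  then show "v = 0"
    using dd by (intro form_zero_if_zero_on_open[of D']) (auto simp: dual_domains_def)
qed (use x zero correlation_foldr in \<open>auto simp: space_W_def alg_linear_point_fun\<close>)

text \<open>\<open>has_lie\<close> fixes all correlation functions of a candidate, and these
  separate the elements of \<open>space_W D\<close>; the given \<open>v\<close> is therefore the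
  only one.\<close>

lemma lie_op_eq:
  assumes dd: "dual_domains D D'" and v: "v \<in> space_W D"
    and lie: "\<And>ps. set ps \<subseteq> - D \<Longrightarrow> has_lie X (\<lambda>q. correlation D ps (A q x)) z (correlation D ps v)"
  shows "lie_op D X A z x = v"
  unfolding lie_op_def
proof (rule the_equality)
  show "v \<in> space_W D \<and> (\<forall>ps. set ps \<subseteq> - D \<longrightarrow> has_lie X (\<lambda>q. correlation D ps (A q x)) z (correlation D ps v))"
    using v lie by blast
next
  fix w assume w: "w \<in> space_W D \<and> (\<forall>ps. set ps \<subseteq> - D \<longrightarrow> has_lie X (\<lambda>q. correlation D ps (A q x)) z (correlation D ps w))"
  have "w - v = 0"
  proof (rule correlation_zero_imp_zero[OF dd])
    show wv: "w - v \<in> space_W D" using v w space_W_simps by blast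
    fix ps assume ps: "set ps \<subseteq> - D"
    then have "correlation D ps w = correlation D ps v"
      using lie[OF ps] w by (auto simp: has_lie_def)
    then show "correlation D ps (w - v) = 0"
      using correlation_add[OF ps wv v] by simp
  qed
  then show "w = v" by simp
qed

text \<open>The coefficients depend on \<open>x\<close> and the points but not on the form, so
  differentiating \<open>e(z) x\<close> reduces to differentiating the values of the kernel. Each
  annihilation hits either the new generator, which gives a value, or \<open>x\<close>.\<close>

lemma correlation_sgen_mult:
  assumes "set ps \<subseteq> - D" "x \<in> space_W D"
  shows "\<exists>c. \<forall>\<alpha>\<in>forms_K D. correlation D ps (sgen \<alpha> * x) = (\<Sum>p\<in>set ps. c p * form_val \<alpha> p)"
  using assms
proof (induction ps arbitrary: x rule: rev_induct)
  case Nil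
  then show ?case by (simp add: correlation_def)
next
  case (snoc p ps)
  have p: "p \<notin> D" and ps: "set ps \<subseteq> - D" using snoc.prems by auto
  have ann: "annihilation D p x \<in> space_W D" by (rule annihilation_in_W[OF p snoc.prems(2)])
  from snoc.IH[OF ps ann] obtain c
    where c: "\<And>\<alpha>. \<alpha> \<in> forms_K D \<Longrightarrow> correlation D ps (sgen \<alpha> * annihilation D p x) = (\<Sum>p\<in>set ps. c p * form_val \<alpha> p)"
    by blast
  \<comment> \<open>\<open>p\<close> may already occur in \<open>ps\<close>, and the sum runs over
    the set of points, so its contribution is added to the old coefficient.\<close>
  define c' where "c' q = (if q \<in> set ps then c q else 0) + (if q = p then - correlation D ps x else 0)" for q
  have "correlation D (ps @ [p]) (sgen \<alpha> * x) = (\<Sum>q\<in>set (ps @ [p]). c' q * form_val \<alpha> q)"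
    if \<alpha>: "\<alpha> \<in> forms_K D" for \<alpha>
  proof -
    have "annihilation D p (sgen \<alpha> * x) = sconst (- form_val \<alpha> p) * x + sgen \<alpha> * annihilation D p x"
      using p \<alpha> snoc.prems
      by (simp add: annihilation_point_fun space_W_simps dfun_simps alg_linear_point_fun point_fun_eq)
    then have "correlation D (ps @ [p]) (sgen \<alpha> * x)
        = correlation D ps (sconst (- form_val \<alpha> p) * x) + correlation D ps (sgen \<alpha> * annihilation D p x)"
      using ps ann \<alpha> snoc.prems
      by (simp add: correlation_snoc correlation_add space_W_simps del: sconst_uminus)
    also have "\<dots> = - form_val \<alpha> p * correlation D ps x + (\<Sum>p\<in>set ps. c p * form_val \<alpha> p)"
      using ps snoc.prems by (simp only: correlation_scale c[OF \<alpha>])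
    also have "(\<Sum>p\<in>set ps. c p * form_val \<alpha> p)
        = (\<Sum>q\<in>insert p (set ps). (if q \<in> set ps then c q else 0) * form_val \<alpha> q)"
      by (rule sum.mono_neutral_cong_left) auto
    also have "- form_val \<alpha> p * correlation D ps x
        = (\<Sum>q\<in>insert p (set ps). if q = p then - correlation D ps x * form_val \<alpha> q else 0)"
      by simp
    also have "\<dots> = (\<Sum>q\<in>insert p (set ps). (if q = p then - correlation D ps x else 0) * form_val \<alpha> q)"
      by (intro sum.cong) auto
    finally show ?thesis by (simp add: c'_def distrib_right sum.distrib)
  qed
  then show ?case by blast
qed

section \<open>Lie derivatives of creation and annihilation operators\<close>

definition lie_kernel :: "(point \<Rightarrow> complex) \<Rightarrow> nat \<Rightarrow> point \<Rightarrow> mform" where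
  "lie_kernel X N z = (\<Sum>n\<le>N. lie_sym (vec_coeff z X) N n (base z) *\<^sub>C polar z n)"

lemma lie_kernel_0: "lie_kernel X 0 z = kernel z"
  by (simp add: lie_kernel_def polar_0 scaleC_one)

lemma lie_kernel_in_forms_K: "z \<in> D \<Longrightarrow> lie_kernel X N z \<in> forms_K D"
  unfolding lie_kernel_def
  by (intro cv.subspace_sum cv.subspace_scale subspace_forms_K polar_in_forms_K)

lemma linear_on_sum:
  assumes "cv.subspace V" "linear_on V f" "\<And>i. i \<in> I \<Longrightarrow> v i \<in> V" "finite I"
  shows "f (\<Sum>i\<in>I. c i *\<^sub>C v i) = (\<Sum>i\<in>I. c i * f (v i))"
  using assms(4,3)
proof (induction I)
  case empty
  have "f 0 = 0 * f 0"
    using assms(2) cv.subspace_0[OF assms(1)] cv.scale_zero_left[of 0] unfolding linear_on_def by metis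
  then show ?case by simp
next
  case (insert i I)
  then have "(\<Sum>i\<in>I. c i *\<^sub>C v i) \<in> V" "c i *\<^sub>C v i \<in> V"
    by (auto intro!: cv.subspace_sum cv.subspace_scale assms(1))
  then show ?case using insert assms(2) by (auto simp: linear_on_def)
qed

lemma kernel_analytic: "p \<noteq> q \<Longrightarrow> form_coeff q (form_val (kernel p)) analytic_on {base q}"
  using polar_analytic[of p q 0] by (simp add: polar_0)

text \<open>Symmetry of the kernel exchanges the variables: differentiating \<open>e\<^sub>z\<close>
  in \<open>z\<close> and evaluating at \<open>p\<close> is the same as differentiating the fixed
  form \<open>e\<^sub>p\<close> at \<open>z\<close>.\<close>

lemma form_val_lie_kernel:
  assumes X: "regular_vector_field X" and pz: "p \<noteq> z"
  shows "form_val (lie_kernel X N z) p = (lie X ^^ N) (form_val (kernel p)) z"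
proof -
  have "jet 0 p (lie_kernel X N z) = (\<Sum>n\<le>N. lie_sym (vec_coeff z X) N n (base z) * jet 0 p (polar z n))"
    unfolding lie_kernel_def using pz
    by (intro linear_on_sum[OF subspace_forms_K linear_on_jet[of p "{z}"]] polar_in_forms_K) auto
  also have "\<dots> = (\<Sum>n\<le>N. lie_sym (vec_coeff z X) N n (base z) * jet n z (kernel p))"
    using jet_polar_sym[OF pz, of 0] by (simp only: polar_0)
  also have "\<dots> = (lie X ^^ N) (form_val (kernel p)) z"
    using kernel_analytic[OF pz] by (intro lie_power_jet[symmetric] X) (simp add: form_pole_iff)
  finally show ?thesis by simp
qed

text \<open>The correlation functions of the \<open>N\<close>-th derivative are fixed combinations
  of \<open>L\<^sub>X\<^sup>N e\<^sub>p\<close> with \<open>p\<close> outside \<open>D\<close>,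
  which are analytic at \<open>z\<close>. The induction covers all points of \<open>D\<close> at
  once, because the next derivative needs a neighbourhood.\<close>

lemma creation_lie_power:
  assumes dd: "dual_domains D D'" and X: "regular_vector_field X" and "z \<in> D" and x: "x \<in> space_W D"
  shows "(lie_op D X ^^ N) creation z x = sgen (lie_kernel X N z) * x"
  using \<open>z \<in> D\<close>
proof (induction N arbitrary: z)
  case 0
  then show ?case by (simp add: creation_def lie_kernel_0)
next
  case (Suc N)
  have "openin sphere_topology D" using dd by (simp add: dual_domains_def)
  note cong = has_lie_cong[OF this _ Suc.prems]
  have "lie_op D X ((lie_op D X ^^ N) creation) z x = sgen (lie_kernel X (Suc N) z) * x"
  proof (rule lie_op_eq[OF dd])
    show "sgen (lie_kernel X (Suc N) z) * x \<in> space_W D"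
      using x Suc.prems by (intro space_W_simps lie_kernel_in_forms_K)
    fix ps assume ps: "set ps \<subseteq> - D"
    from correlation_sgen_mult[OF ps x] obtain c
      where c: "\<And>\<alpha>. \<alpha> \<in> forms_K D \<Longrightarrow> correlation D ps (sgen \<alpha> * x) = (\<Sum>p\<in>set ps. c p * form_val \<alpha> p)"
      by blast
    have *: "correlation D ps (sgen (lie_kernel X M q) * x) = (\<Sum>p\<in>set ps. c p * (lie X ^^ M) (form_val (kernel p)) q)"
      if "q \<in> D" for q M
      unfolding c[OF lie_kernel_in_forms_K[OF that]]
    proof (intro sum.cong refl)
      fix p assume "p \<in> set ps"
      then have "p \<noteq> q" using ps that by auto
      then show "c p * form_val (lie_kernel X M q) p = c p * (lie X ^^ M) (form_val (kernel p)) q"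
        by (simp only: form_val_lie_kernel[OF X \<open>p \<noteq> q\<close>])
    qed
    have "has_lie X (\<lambda>q. \<Sum>p\<in>set ps. c p * (lie X ^^ N) (form_val (kernel p)) q) z
        (\<Sum>p\<in>set ps. c p * (lie X ^^ Suc N) (form_val (kernel p)) z)"
      using ps Suc.prems by (intro has_lie_sum has_lie_cmult has_lie_power X kernel_analytic) auto
    also have "?this \<longleftrightarrow> has_lie X (\<lambda>q. correlation D ps ((lie_op D X ^^ N) creation q x)) z
        (correlation D ps (sgen (lie_kernel X (Suc N) z) * x))"
      unfolding *[OF Suc.prems] by (rule cong) (simp only: Suc.IH *)
    finally show "has_lie X (\<lambda>q. correlation D ps ((lie_op D X ^^ N) creation q x)) z
        (correlation D ps (sgen (lie_kernel X (Suc N) z) * x))" .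
  qed
  then show ?case by simp
qed

lemma correlation_sum:
  assumes "set ps \<subseteq> - D" "\<And>i. i < n \<Longrightarrow> w i \<in> space_W D"
  shows "correlation D ps (\<Sum>i<n. sconst (c i) * w i) = (\<Sum>i<(n::nat). c i * correlation D ps (w i))
    \<and> (\<Sum>i<n. sconst (c i) * w i) \<in> space_W D"
  using assms(2)
proof (induction n)
  case 0
  then show ?case
    using correlation_scale[OF assms(1) space_W_simps(6), of 0] space_W_simps(4)[of 0 D] by simp
next
  case (Suc n)
  then show ?case
    by (simp add: correlation_add[OF assms(1)] correlation_scale[OF assms(1)] space_W_simps)
qed

text \<open>Although \<open>i(z)\<close> makes sense for every \<open>z\<close> outside
  \<open>D\<close>, the point is taken in the open set \<open>D'\<close>: the induction step needs
  the formula in a neighbourhood of \<open>z\<close>.\<close>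

lemma annihilation_lie_power:
  assumes dd: "dual_domains D D'" and X: "regular_vector_field X" and "z \<in> D'" and x: "x \<in> space_W D"
  shows "(lie_op D X ^^ N) (annihilation D) z x = dfun (lie_fun D X N z) x"
  using \<open>z \<in> D'\<close>
proof (induction N arbitrary: z)
  case 0
  then have "z \<notin> D" using dd by (auto simp: dual_domains_def)
  then show ?case
    using x alg_linear_lie_fun[OF X, of z D 0] lie_fun_eq[OF X, of z D _ 0] by (simp add: annihilation_eq)
next
  case (Suc N)
  have notin: "q \<notin> D" if "q \<in> D'" for q using dd that by (auto simp: dual_domains_def)
  have "openin sphere_topology D'" using dd by (simp add: dual_domains_def)
  note cong = has_lie_cong[OF this _ Suc.prems]
  have "lie_op D X ((lie_op D X ^^ N) (annihilation D)) z x = dfun (lie_fun D X (Suc N) z) x"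
  proof (rule lie_op_eq[OF dd])
    show "dfun (lie_fun D X (Suc N) z) x \<in> space_W D"
      using x Suc.prems by (intro dfun_in_W alg_linear_lie_fun X notin)
    fix ps assume ps: "set ps \<subseteq> - D"
    obtain n \<beta> w where b: "\<And>i. i < n \<Longrightarrow> \<beta> i \<in> forms_K D" and w: "\<And>i. i < n \<Longrightarrow> w i \<in> space_W D"
      and dec: "\<And>\<mu>. cc.alg_linear \<mu> \<Longrightarrow> dfun \<mu> x = (\<Sum>i<(n::nat). sconst (\<mu> (\<beta> i)) * w i)"
      using dfun_decomposition_nat[OF x] by blast
    have *: "correlation D ps (dfun (lie_fun D X M q) x) = (\<Sum>i<n. - correlation D ps (w i) * (lie X ^^ M) (form_val (\<beta> i)) q)"
      if "q \<in> D'" for q M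
    proof -
      have "correlation D ps (dfun (lie_fun D X M q) x) = (\<Sum>i<n. lie_fun D X M q (\<beta> i) * correlation D ps (w i))"
        using correlation_sum[OF ps w] by (simp add: dec alg_linear_lie_fun[OF X notin[OF that]])
      also have "\<dots> = (\<Sum>i<n. - correlation D ps (w i) * (lie X ^^ M) (form_val (\<beta> i)) q)"
        using lie_fun_eq[OF X notin[OF that] b] by (intro sum.cong refl) simp
      finally show ?thesis .
    qed
    have "has_lie X (\<lambda>q. \<Sum>i<n. - correlation D ps (w i) * (lie X ^^ N) (form_val (\<beta> i)) q) z
        (\<Sum>i<n. - correlation D ps (w i) * (lie X ^^ Suc N) (form_val (\<beta> i)) z)"
    proof (intro has_lie_sum has_lie_cmult has_lie_power X)
      fix i assume "i \<in> {..<n}"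
      then show "form_coeff z (form_val (\<beta> i)) analytic_on {base z}"
        using forms_K_not_pole[OF b notin[OF Suc.prems]] by (simp add: form_pole_iff)
    qed
    also have "?this \<longleftrightarrow> has_lie X (\<lambda>q. correlation D ps ((lie_op D X ^^ N) (annihilation D) q x)) z
        (correlation D ps (dfun (lie_fun D X (Suc N) z) x))"
      unfolding *[OF Suc.prems] by (rule cong) (simp only: Suc.IH *)
    finally show "has_lie X (\<lambda>q. correlation D ps ((lie_op D X ^^ N) (annihilation D) q x)) z
        (correlation D ps (dfun (lie_fun D X (Suc N) z) x))" .
  qed
  then show ?case by simp
qed

lemma lie_power_sum:
  assumes X: "regular_vector_field X"
    and an: "\<And>i. i \<in> I \<Longrightarrow> form_coeff p (s i) analytic_on {base p}" and "finite I"
  shows "(lie X ^^ N) (\<lambda>q. \<Sum>i\<in>I. c i * s i q) p = (\<Sum>i\<in>I. c i * (lie X ^^ N) (s i) p)"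
proof -
  have "form_coeff p (\<lambda>q. \<Sum>i\<in>I. c i * s i q) analytic_on {base p} \<and>
    (\<forall>n. (deriv ^^ n) (form_coeff p (\<lambda>q. \<Sum>i\<in>I. c i * s i q)) (base p)
      = (\<Sum>i\<in>I. c i * (deriv ^^ n) (form_coeff p (s i)) (base p)))"
    using \<open>finite I\<close> an
  proof (induction I)
    case empty
    then show ?case by (simp add: form_coeff_zero)
  next
    case (insert i I)
    then have "(\<lambda>u. c i * form_coeff p (s i) u) analytic_on {base p}"
      "form_coeff p (\<lambda>q. \<Sum>i\<in>I. c i * s i q) analytic_on {base p}"
      by (auto intro!: analytic_intros)
    then show ?case
      using insert
      by (auto simp: form_coeff_add form_coeff_cmult higher_deriv_add_at higher_deriv_cmult' intro!: analytic_intros)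
  qed
  then show ?thesis
    using an by (simp add: lie_power_analytic(1)[OF X] sum_distrib_left sum.swap[of _ I] mult_ac)
qed

text \<open>Stated for an arbitrary \<open>P\<close> so that it applies to the pairing and to its transpose.\<close>

lemma adjoint_chain:
  fixes P :: "mform sym \<Rightarrow> mform sym \<Rightarrow> complex"
  assumes dd: "dual_domains D D'" and x: "x \<in> space_W D'" and y: "y \<in> space_W D"
    and P_add: "\<And>x x'. x \<in> space_W D' \<Longrightarrow> x' \<in> space_W D' \<Longrightarrow> P (x + x') y = P x y + P x' y"
    and P_scale: "\<And>c x. x \<in> space_W D' \<Longrightarrow> P (sconst c * x) y = c * P x y"
    and key: "\<And>X N z. regular_vector_field X \<Longrightarrow> z \<in> D \<Longrightarrow>
      P x (sgen (lie_kernel X N z) * y) = - P (dfun (lie_fun D' X N z) x) y"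
  shows "z \<in> D \<Longrightarrow> P x (creation z y) = - P (annihilation D' z x) y"
    and "regular_vector_field X \<Longrightarrow> z \<in> D \<Longrightarrow>
      P x ((lie_op D X ^^ N) creation z y) = (lie X ^^ N) (\<lambda>q. P x (creation q y)) z \<and>
      (lie X ^^ N) (\<lambda>q. P x (creation q y)) z = - (lie X ^^ N) (\<lambda>q. P (annihilation D' q x) y) z \<and>
      - (lie X ^^ N) (\<lambda>q. P (annihilation D' q x) y) z = - P ((lie_op D' X ^^ N) (annihilation D') z x) y"
proof -
  have notin: "q \<notin> D'" if "q \<in> D" for q using dd that by (auto simp: dual_domains_def)
  have D: "openin sphere_topology D" using dd by (simp add: dual_domains_def)
  show adj: "P x (creation z y) = - P (annihilation D' z x) y" if "z \<in> D" for z
    using key[OF regular_zero that, of 0] x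
    by (simp add: creation_def lie_kernel_0 annihilation_point_fun notin[OF that])
  assume X: "regular_vector_field X" and z: "z \<in> D"
  obtain n \<beta> w where b: "\<And>i. i < n \<Longrightarrow> \<beta> i \<in> forms_K D'" and w: "\<And>i. i < n \<Longrightarrow> w i \<in> space_W D'"
    and dec: "\<And>\<mu>. cc.alg_linear \<mu> \<Longrightarrow> dfun \<mu> x = (\<Sum>i<(n::nat). sconst (\<mu> (\<beta> i)) * w i)"
    using dfun_decomposition_nat[OF x] by blast
  have sum: "P (\<Sum>i<m. sconst (c i) * w i) y = (\<Sum>i<m. c i * P (w i) y) \<and> (\<Sum>i<m. sconst (c i) * w i) \<in> space_W D'"
    if "m \<le> n" for m c
    using that
  proof (induction m)
    case 0
    then show ?case
      using P_scale[OF space_W_simps(6), of 0] space_W_simps(4)[of 0 D'] by simp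
  next
    case (Suc m)
    then show ?case using w by (simp add: P_add P_scale space_W_simps)
  qed
  \<comment> \<open>Every expression of the chain is, up to sign, this finite sum of scalar Lie
    derivatives; the forms \<open>\<beta> i\<close> are regular on \<open>D\<close>.\<close>
  define L where "L M q = (\<Sum>i<n. P (w i) y * (lie X ^^ M) (form_val (\<beta> i)) q)" for M q
  have PL: "P (dfun (lie_fun D' X M q) x) y = - L M q" if "q \<in> D" for M q
  proof -
    have "P (dfun (lie_fun D' X M q) x) y = (\<Sum>i<n. lie_fun D' X M q (\<beta> i) * P (w i) y)"
      using sum[of n] by (simp add: dec alg_linear_lie_fun[OF X notin[OF that]])
    also have "\<dots> = (\<Sum>i<n. - (P (w i) y * (lie X ^^ M) (form_val (\<beta> i)) q))"
      using lie_fun_eq[OF X notin[OF that] b] by (intro sum.cong refl) simp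
    finally show ?thesis by (simp add: L_def sum_negf)
  qed
  have ann: "P (annihilation D' q x) y = - L 0 q" if "q \<in> D" for q
    using PL[OF that, of 0] annihilation_lie_power[OF dual_domains_sym[OF dd] X that x, of 0] by simp
  have cre: "P x (creation q y) = L 0 q" if "q \<in> D" for q
    using adj[OF that] ann[OF that] by simp
  have L: "(lie X ^^ N) (\<lambda>q. \<Sum>i<n. c i * form_val (\<beta> i) q) z = (\<Sum>i<n. c i * (lie X ^^ N) (form_val (\<beta> i)) z)" for c
    using forms_K_not_pole[OF b notin[OF z]] by (intro lie_power_sum[OF X]) (auto simp: form_pole_iff)
  have "(lie X ^^ N) (\<lambda>q. P x (creation q y)) z = (lie X ^^ N) (\<lambda>q. \<Sum>i<n. P (w i) y * form_val (\<beta> i) q) z"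
    by (rule lie_power_cong[OF D _ z]) (simp add: cre L_def)
  then have 1: "(lie X ^^ N) (\<lambda>q. P x (creation q y)) z = L N z" by (simp add: L L_def)
  have "(lie X ^^ N) (\<lambda>q. P (annihilation D' q x) y) z = (lie X ^^ N) (\<lambda>q. \<Sum>i<n. - P (w i) y * form_val (\<beta> i) q) z"
    by (rule lie_power_cong[OF D _ z]) (simp add: ann L_def sum_negf)
  also have "\<dots> = (\<Sum>i<n. - P (w i) y * (lie X ^^ N) (form_val (\<beta> i)) z)" by (rule L)
  finally have 2: "(lie X ^^ N) (\<lambda>q. P (annihilation D' q x) y) z = - L N z" by (simp add: L_def sum_negf)
  have 3: "P ((lie_op D' X ^^ N) (annihilation D') z x) y = - L N z"
    by (simp add: annihilation_lie_power[OF dual_domains_sym[OF dd] X z x] PL[OF z])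
  have 4: "P x ((lie_op D X ^^ N) creation z y) = L N z"
    by (simp add: creation_lie_power[OF dd X z y] key[OF X z] PL[OF z])
  show "P x ((lie_op D X ^^ N) creation z y) = (lie X ^^ N) (\<lambda>q. P x (creation q y)) z \<and>
      (lie X ^^ N) (\<lambda>q. P x (creation q y)) z = - (lie X ^^ N) (\<lambda>q. P (annihilation D' q x) y) z \<and>
      - (lie X ^^ N) (\<lambda>q. P (annihilation D' q x) y) z = - P ((lie_op D' X ^^ N) (annihilation D') z x) y"
    by (simp only: 1 2 3 4 minus_minus simp_thms)
qed

text \<open>A field constant in either chart extends regularly over the sphere: \<open>d/dz\<close>
  is \<open>- w\<^sup>2 d/dw\<close>, with a double zero at infinity, and \<open>d/dw\<close> is
  \<open>- z\<^sup>2 d/dz\<close>.\<close>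

lemma constant_vector_field: "\<exists>X. regular_vector_field X \<and> vec_coeff z X = (\<lambda>_. 1)"
proof (cases z)
  case None
  let ?X = "(\<lambda>q. case q of None \<Rightarrow> 1 | Some x \<Rightarrow> - (x ^ 2)) :: point \<Rightarrow> complex"
  have "vec_coeff None ?X = (\<lambda>_. 1)"
    by (auto simp: vec_coeff_def fun_eq_iff power_one_over)
  moreover have "vec_coeff (Some a) ?X = (\<lambda>x. - (x ^ 2))" for a by (simp add: vec_coeff_def)
  ultimately have "vec_coeff p ?X analytic_on {base p}" for p
    by (cases p) (auto intro!: analytic_intros)
  with \<open>vec_coeff None ?X = (\<lambda>_. 1)\<close> show ?thesis
    by (intro exI[of _ ?X]) (simp add: regular_vector_field_def None)
next
  case (Some a)
  let ?X = "(\<lambda>q. case q of None \<Rightarrow> 0 | Some x \<Rightarrow> 1) :: point \<Rightarrow> complex"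
  have "vec_coeff None ?X = (\<lambda>w. - (w ^ 2))"
    by (auto simp: vec_coeff_def fun_eq_iff)
  moreover have c: "vec_coeff (Some a) ?X = (\<lambda>x. 1)" for a by (simp add: vec_coeff_def)
  ultimately have "vec_coeff p ?X analytic_on {base p}" for p
    by (cases p) (auto intro!: analytic_intros)
  with c show ?thesis
    by (intro exI[of _ ?X]) (simp add: regular_vector_field_def Some)
qed

lemma polar_eq_lie_kernel: "\<exists>X. regular_vector_field X \<and> lie_kernel X n z = polar z n"
proof -
  obtain X where X: "regular_vector_field X" "vec_coeff z X = (\<lambda>_. 1)"
    using constant_vector_field by blast
  have "lie_kernel X n z = (\<Sum>k\<le>n. if k = n then polar z n else 0)"
    unfolding lie_kernel_def X(2) by (intro sum.cong refl) (auto simp: lie_sym_const scaleC_one)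
  then show ?thesis using X(1) by auto
qed

section \<open>The adjunction determines the pairing\<close>

lemma bilinear_form_swap: "bilinear_form b \<Longrightarrow> bilinear_form (\<lambda>u v. b v u)"
  unfolding bilinear_form_def by blast

lemma form_pairing_lie_kernel:
  assumes X: "regular_vector_field X" and b: "cc.alg_linear (b u)"
    and jet: "\<And>n. b u (polar z n) = jet n z u" and u: "u \<in> forms_K D'" "z \<notin> D'"
  shows "b u (lie_kernel X N z) = - lie_fun D' X N z u"
proof -
  have "b u (lie_kernel X N z) = (\<Sum>n\<le>N. lie_sym (vec_coeff z X) N n (base z) * b u (polar z n))"
    unfolding lie_kernel_def
    by (intro linear_on_sum[of UNIV] alg_linear_imp_linear_on b) auto
  also have "\<dots> = (lie X ^^ N) (form_val u) z"
    unfolding jet by (rule lie_power_jet[symmetric, OF X forms_K_not_pole[OF u]])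
  finally show ?thesis using lie_fun_eq[OF X u(2,1)] by simp
qed

lemma dfun_lie_kernel:
  assumes X: "regular_vector_field X" and b: "bilinear_form b"
    and jet: "\<And>u n. u \<in> forms_K D' \<Longrightarrow> b u (polar z n) = jet n z u" and z: "z \<notin> D'" and x: "x \<in> space_W D'"
  shows "dfun (\<lambda>u. b u (lie_kernel X N z)) x = - dfun (lie_fun D' X N z) x"
proof -
  have lin: "cc.alg_linear (lie_fun D' X N z)" by (rule alg_linear_lie_fun[OF X z])
  then have "cc.alg_linear (\<lambda>u. - lie_fun D' X N z u)" by (simp add: cc.alg_linear_def)
  then have "dfun (\<lambda>u. b u (lie_kernel X N z)) x = dfun (\<lambda>u. - lie_fun D' X N z u) x"
    using b x unfolding bilinear_form_def space_W_def
    by (intro dfun_cong form_pairing_lie_kernel[OF X _ jet]) (auto simp: z)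
  then show ?thesis by (simp add: dfun_uminus[OF lin])
qed

text \<open>Both sides are linear in \<open>v\<close>, so it suffices to treat the generators
  \<open>polar z n\<close>. There the identity is the assumed adjunction for a field that is
  constant in the chart at \<open>z\<close>. An abstract \<open>P\<close> covers the transposed
  pairing as well.\<close>

lemma adjoint_determined:
  fixes P :: "mform sym \<Rightarrow> mform sym \<Rightarrow> complex"
  assumes dd: "dual_domains D D'" and b: "bilinear_form b"
    and jet: "\<And>u z n. u \<in> forms_K D' \<Longrightarrow> z \<in> D \<Longrightarrow> b u (polar z n) = jet n z u"
    and addl: "\<And>x x' y. x \<in> space_W D' \<Longrightarrow> x' \<in> space_W D' \<Longrightarrow> y \<in> space_W D \<Longrightarrow> P (x + x') y = P x y + P x' y"
    and scalel: "\<And>c x y. x \<in> space_W D' \<Longrightarrow> y \<in> space_W D \<Longrightarrow> P (sconst c * x) y = c * P x y"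
    and addr: "\<And>x y y'. x \<in> space_W D' \<Longrightarrow> y \<in> space_W D \<Longrightarrow> y' \<in> space_W D \<Longrightarrow> P x (y + y') = P x y + P x y'"
    and scaler: "\<And>c x y. x \<in> space_W D' \<Longrightarrow> y \<in> space_W D \<Longrightarrow> P x (sconst c * y) = c * P x y"
    and adj: "\<And>X N z x y. regular_vector_field X \<Longrightarrow> z \<in> D \<Longrightarrow> x \<in> space_W D' \<Longrightarrow> y \<in> space_W D \<Longrightarrow>
      P x ((lie_op D X ^^ N) creation z y) = - P ((lie_op D' X ^^ N) (annihilation D') z x) y"
    and v: "v \<in> forms_K D" and x: "x \<in> space_W D'" and y: "y \<in> space_W D"
  shows "P x (sgen v * y) = P (dfun (\<lambda>u. b u v) x) y"
proof -
  have lin: "cc.alg_linear (\<lambda>u. b u v)" "cc.alg_linear (b v)" for v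
    using b by (auto simp: bilinear_form_def)
  let ?Q = "{v \<in> forms_K D. P x (sgen v * y) = P (dfun (\<lambda>u. b u v) x) y}"
  have dW: "dfun (\<lambda>u. b u v) x \<in> space_W D'" for v by (rule dfun_in_W[OF lin(1) x])
  have sW: "sgen v * y \<in> space_W D" if "v \<in> forms_K D" for v using that y by (intro space_W_simps)
  have dadd: "dfun (\<lambda>u. b u (v + w)) x = dfun (\<lambda>u. b u v) x + dfun (\<lambda>u. b u w) x" for v w
  proof -
    have "(\<lambda>u. sconst (b u (v + w)) :: mform sym) = (\<lambda>u. sconst (b u v) + sconst (b u w))"
      using lin(2) by (simp add: cc.alg_linear_def sconst_add)
    then show ?thesis by (simp add: der_plus alg_linear_sconst lin)
  qed
  have dscale: "dfun (\<lambda>u. b u (c *\<^sub>C v)) x = sconst c * dfun (\<lambda>u. b u v) x" for c v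
  proof -
    have "(\<lambda>u. sconst (b u (c *\<^sub>C v)) :: mform sym) = (\<lambda>u. sconst c * sconst (b u v))"
      using lin(2) by (simp add: cc.alg_linear_def sconst_mult)
    then show ?thesis by (simp add: der_times alg_linear_sconst lin)
  qed
  have scale: "c *\<^sub>C v \<in> ?Q" if "v \<in> ?Q" for c v
  proof -
    have "P x (sgen (c *\<^sub>C v) * y) = c * P x (sgen v * y)"
      using that x sW scaler by (simp add: sgen_scaleC mult.assoc)
    also have "\<dots> = P (dfun (\<lambda>u. b u (c *\<^sub>C v)) x) y"
      using that scalel[OF dW y] by (simp add: dscale)
    finally show ?thesis using that subspace_forms_K cv.subspace_scale by blast
  qed
  have add: "v + w \<in> ?Q" if "v \<in> ?Q" "w \<in> ?Q" for v w
  proof -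
    have "P x (sgen (v + w) * y) = P x (sgen v * y) + P x (sgen w * y)"
      using that x sW addr by (simp add: sgen_add distrib_right)
    also have "\<dots> = P (dfun (\<lambda>u. b u (v + w)) x) y"
      using that addl[OF dW dW y] by (simp add: dadd)
    finally show ?thesis using that subspace_forms_K cv.subspace_add by blast
  qed
  have polar: "polar z n \<in> ?Q" if z: "z \<in> D" for z n
  proof -
    have z': "z \<notin> D'" using z dd by (auto simp: dual_domains_def)
    obtain X where X: "regular_vector_field X" "lie_kernel X n z = polar z n"
      using polar_eq_lie_kernel by blast
    have "P x (sgen (polar z n) * y) = - P (dfun (lie_fun D' X n z) x) y"
      using adj[OF X(1) z x y, of n] creation_lie_power[OF dd X(1) z y, of n]
        annihilation_lie_power[OF dual_domains_sym[OF dd] X(1) z x, of n] by (simp add: X(2))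
    also have "\<dots> = P (sconst (- 1) * dfun (lie_fun D' X n z) x) y"
      using scalel[OF dfun_in_W[OF alg_linear_lie_fun[OF X(1) z'] x] y, of "- 1"] by simp
    also have "sconst (- 1) * dfun (lie_fun D' X n z) x = dfun (\<lambda>u. b u (polar z n)) x"
      using dfun_lie_kernel[OF X(1) b jet[OF _ z] z' x, of n] by (simp add: X(2) sconst_uminus)
    finally show ?thesis using z polar_in_forms_K by simp
  qed
  \<comment> \<open>Zero is reached by scaling a generator by 0, for which a point of
    \<open>D\<close> is chosen.\<close>
  obtain z0 where "z0 \<in> D" using dd by (auto simp: dual_domains_def)
  from scale[OF polar[OF this, of 0], of 0] have zero: "0 \<in> ?Q" by (simp only: cv.scale_zero_left)
  have "cv.subspace ?Q"
    by (rule cv.subspaceI) (fact zero, fact add, fact scale)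
  then have "cv.span {polar p n |p n. p \<in> D} \<subseteq> ?Q"
    using polar by (intro cv.span_minimal) blast+
  then show ?thesis using v by (auto simp: forms_K_eq_span)
qed

theorem proposition7p1:
  fixes \<gamma> :: "real \<Rightarrow> point" and D D' :: "point set"
  assumes "smooth_simple_closed_curve \<gamma>"
    and "separates_into (range \<gamma>) D D'"
  shows "\<exists>!B. B \<in> space_W D' \<times> space_W D \<rightarrow>\<^sub>E UNIV \<and>
    bilinear_on (space_W D') (space_W D) B \<and>
    B (1, 1) = 1 \<and>
    (\<forall>\<phi>\<in>space_W D. \<forall>\<phi>'\<in>space_W D'.
      (\<forall>z\<in>D. B (\<phi>', creation z \<phi>) = - B (annihilation D' z \<phi>', \<phi>)) \<and>
      (\<forall>z'\<in>D'. B (creation z' \<phi>', \<phi>) = - B (\<phi>', annihilation D z' \<phi>)) \<and>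
      (\<forall>X N. regular_vector_field X \<longrightarrow>
        (\<forall>z\<in>D. \<forall>z'\<in>D'.
          B (\<phi>', (lie_op D X ^^ N) creation z \<phi>)
            = (lie X ^^ N) (\<lambda>y. B (\<phi>', creation y \<phi>)) z \<and>
          (lie X ^^ N) (\<lambda>y. B (\<phi>', creation y \<phi>)) z
            = - (lie X ^^ N) (\<lambda>y. B (annihilation D' y \<phi>', \<phi>)) z \<and>
          - (lie X ^^ N) (\<lambda>y. B (annihilation D' y \<phi>', \<phi>)) z
            = - B ((lie_op D' X ^^ N) (annihilation D') z \<phi>', \<phi>) \<and>
          B ((lie_op D' X ^^ N) creation z' \<phi>', \<phi>)
            = (lie X ^^ N) (\<lambda>y. B (creation y \<phi>', \<phi>)) z' \<and>
          (lie X ^^ N) (\<lambda>y. B (creation y \<phi>', \<phi>)) z'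
            = - (lie X ^^ N) (\<lambda>y. B (\<phi>', annihilation D y \<phi>)) z' \<and>
          - (lie X ^^ N) (\<lambda>y. B (\<phi>', annihilation D y \<phi>)) z'
            = - B (\<phi>', (lie_op D X ^^ N) (annihilation D) z' \<phi>))))"
proof -
  have dd: "dual_domains D D'"
    using assms(2) by (auto simp: separates_into_def sphere_domain_def dual_domains_def)
  note dd' = dual_domains_sym[OF dd]
  have disj: "z \<in> D \<Longrightarrow> z \<notin> D'" "z \<in> D' \<Longrightarrow> z \<notin> D" for z
    using dd by (auto simp: dual_domains_def)
  obtain b where b: "bilinear_form b"
    and jet: "\<And>u z n. u \<in> forms_K D' \<Longrightarrow> z \<in> D \<Longrightarrow> b u (polar z n) = jet n z u"
    and jet': "\<And>v z n. v \<in> forms_K D \<Longrightarrow> z \<in> D' \<Longrightarrow> b (polar z n) v = jet n z v"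
    using form_pairing_exists[OF dd] by blast
  interpret bilinear_form b by (rule b)
  let ?W = "space_W D" and ?W' = "space_W D'"
  define B where "B = restrict (\<lambda>(x, y). pairing x y) (?W' \<times> ?W)"
  have B: "B (x, y) = pairing x y" if "x \<in> ?W'" "y \<in> ?W" for x y
    using that by (simp add: B_def)
  have bil: "bilinear_on ?W' ?W B"
    by (auto simp: bilinear_on_def B space_W_simps pairing_add_left pairing_add_right
        pairing_scale_left pairing_scale_right)
  have key: "B (x, sgen (lie_kernel X N z) * y) = - B (dfun (lie_fun D' X N z) x, y)"
    if "regular_vector_field X" "z \<in> D" "x \<in> ?W'" "y \<in> ?W" for X N z x y
  proof -
    have "B (x, sgen (lie_kernel X N z) * y) = pairing (- dfun (lie_fun D' X N z) x) y"
      using that dfun_lie_kernel[OF that(1) b jet[OF _ that(2)] disj(1)[OF that(2)] that(3), of N]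
      by (simp add: B space_W_simps lie_kernel_in_forms_K pairing_sgen_right)
    also have "\<dots> = - pairing (dfun (lie_fun D' X N z) x) y"
      using pairing_scale_left[of "- 1" "dfun (lie_fun D' X N z) x" y] by (simp add: sconst_uminus)
    finally show ?thesis
      using that disj(1) by (simp add: B dfun_in_W alg_linear_lie_fun)
  qed
  have key': "B (sgen (lie_kernel X N z) * y, x) = - B (y, dfun (lie_fun D X N z) x)"
    if "regular_vector_field X" "z \<in> D'" "x \<in> ?W" "y \<in> ?W'" for X N z x y
  proof -
    have "B (sgen (lie_kernel X N z) * y, x) = pairing y (- dfun (lie_fun D X N z) x)"
      using that dfun_lie_kernel[OF that(1) bilinear_form_swap[OF b] jet'[OF _ that(2)] disj(2)[OF that(2)] that(3), of N]
      by (simp add: B space_W_simps lie_kernel_in_forms_K pairing_sgen_left)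
    also have "\<dots> = - pairing y (dfun (lie_fun D X N z) x)"
      using pairing_scale_right[of y "- 1" "dfun (lie_fun D X N z) x"] by (simp add: sconst_uminus)
    finally show ?thesis
      using that disj(2) by (simp add: B dfun_in_W alg_linear_lie_fun)
  qed
  have left: "B (x + x', y) = B (x, y) + B (x', y)" "B (sconst c * x, y) = c * B (x, y)"
    if "x \<in> ?W'" "x' \<in> ?W'" "y \<in> ?W" for x x' y c
    using bil that unfolding bilinear_on_def by blast+
  have right: "B (x, y + y') = B (x, y) + B (x, y')" "B (x, sconst c * y) = c * B (x, y)"
    if "x \<in> ?W'" "y \<in> ?W" "y' \<in> ?W" for x y y' c
    using bil that unfolding bilinear_on_def by blast+
  note chain = adjoint_chain[OF dd, where P = "\<lambda>x y. B (x, y)"]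
  note chain' = adjoint_chain[OF dd', where P = "\<lambda>x y. B (y, x)"]
  show ?thesis (is "\<exists>!B. ?Q B")
  proof (rule ex1I[of _ B], intro conjI ballI allI impI)
    show "B \<in> ?W' \<times> ?W \<rightarrow>\<^sub>E UNIV" by (auto simp: B_def)
    show "bilinear_on ?W' ?W B" by (rule bil)
    show "B (1, 1) = 1" by (simp add: B space_W_simps pairing_1)
  next
    fix \<phi> \<phi>' z assume "\<phi> \<in> ?W" "\<phi>' \<in> ?W'" "z \<in> D"
    then show "B (\<phi>', creation z \<phi>) = - B (annihilation D' z \<phi>', \<phi>)"
      by (intro chain(1)) (auto simp: left key)
  next
    fix \<phi> \<phi>' z assume "\<phi> \<in> ?W" "\<phi>' \<in> ?W'" "z \<in> D'"
    then show "B (creation z \<phi>', \<phi>) = - B (\<phi>', annihilation D z \<phi>)"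
      by (intro chain'(1)) (auto simp: right key')
  next
    fix \<phi> \<phi>' X N z z'
    assume h: "\<phi> \<in> ?W" "\<phi>' \<in> ?W'" "regular_vector_field X" "z \<in> D" "z' \<in> D'"
    have c: "B (\<phi>', (lie_op D X ^^ N) creation z \<phi>) = (lie X ^^ N) (\<lambda>y. B (\<phi>', creation y \<phi>)) z \<and>
      (lie X ^^ N) (\<lambda>y. B (\<phi>', creation y \<phi>)) z = - (lie X ^^ N) (\<lambda>y. B (annihilation D' y \<phi>', \<phi>)) z \<and>
      - (lie X ^^ N) (\<lambda>y. B (annihilation D' y \<phi>', \<phi>)) z = - B ((lie_op D' X ^^ N) (annihilation D') z \<phi>', \<phi>)"
      using h by (intro chain(2)) (auto simp: left key)
    show "B (\<phi>', (lie_op D X ^^ N) creation z \<phi>) = (lie X ^^ N) (\<lambda>y. B (\<phi>', creation y \<phi>)) z"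
      "(lie X ^^ N) (\<lambda>y. B (\<phi>', creation y \<phi>)) z = - (lie X ^^ N) (\<lambda>y. B (annihilation D' y \<phi>', \<phi>)) z"
      "- (lie X ^^ N) (\<lambda>y. B (annihilation D' y \<phi>', \<phi>)) z = - B ((lie_op D' X ^^ N) (annihilation D') z \<phi>', \<phi>)"
      using c by blast+
    have c': "B ((lie_op D' X ^^ N) creation z' \<phi>', \<phi>) = (lie X ^^ N) (\<lambda>y. B (creation y \<phi>', \<phi>)) z' \<and>
      (lie X ^^ N) (\<lambda>y. B (creation y \<phi>', \<phi>)) z' = - (lie X ^^ N) (\<lambda>y. B (\<phi>', annihilation D y \<phi>)) z' \<and>
      - (lie X ^^ N) (\<lambda>y. B (\<phi>', annihilation D y \<phi>)) z' = - B (\<phi>', (lie_op D X ^^ N) (annihilation D) z' \<phi>)"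
      using h by (intro chain'(2)) (auto simp: right key')
    show "B ((lie_op D' X ^^ N) creation z' \<phi>', \<phi>) = (lie X ^^ N) (\<lambda>y. B (creation y \<phi>', \<phi>)) z'"
      "(lie X ^^ N) (\<lambda>y. B (creation y \<phi>', \<phi>)) z' = - (lie X ^^ N) (\<lambda>y. B (\<phi>', annihilation D y \<phi>)) z'"
      "- (lie X ^^ N) (\<lambda>y. B (\<phi>', annihilation D y \<phi>)) z' = - B (\<phi>', (lie_op D X ^^ N) (annihilation D) z' \<phi>)"
      using c' by blast+
  next
    fix C
    assume C: "?Q C"
    \<comment> \<open>Condition (iii) quantifies over a point of each domain at once, so extracting
      either half of it requires a point of the other domain.\<close>
    obtain z0 z0' where z0: "z0 \<in> D" "z0' \<in> D'" using dd by (auto simp: dual_domains_def)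
    have addl: "C (x + x', y) = C (x, y) + C (x', y)" if "x \<in> ?W'" "x' \<in> ?W'" "y \<in> ?W" for x x' y
      using C that unfolding bilinear_on_def by blast
    have scalel: "C (sconst c * x, y) = c * C (x, y)" if "x \<in> ?W'" "y \<in> ?W" for x y c
      using C that unfolding bilinear_on_def by blast
    have addr: "C (x, y + y') = C (x, y) + C (x, y')" if "x \<in> ?W'" "y \<in> ?W" "y' \<in> ?W" for x y y'
      using C that unfolding bilinear_on_def by blast
    have scaler: "C (x, sconst c * y) = c * C (x, y)" if "x \<in> ?W'" "y \<in> ?W" for x y c
      using C that unfolding bilinear_on_def by blast
    have adj: "C (x, (lie_op D X ^^ N) creation z y) = - C ((lie_op D' X ^^ N) (annihilation D') z x, y)"
      if "regular_vector_field X" "z \<in> D" "x \<in> ?W'" "y \<in> ?W" for X N z x y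
      using C[THEN conjunct2, THEN conjunct2, THEN conjunct2, THEN bspec, OF that(4), THEN bspec, OF that(3),
        THEN conjunct2, THEN conjunct2, THEN spec, THEN spec[of _ N], THEN mp, OF that(1), THEN bspec, OF that(2), THEN bspec, OF z0(2)]
      by (elim conjE) (erule trans, erule trans, assumption)
    have adj': "C ((lie_op D' X ^^ N) creation z x, y) = - C (x, (lie_op D X ^^ N) (annihilation D) z y)"
      if "regular_vector_field X" "z \<in> D'" "y \<in> ?W" "x \<in> ?W'" for X N z x y
      using C[THEN conjunct2, THEN conjunct2, THEN conjunct2, THEN bspec, OF that(3), THEN bspec, OF that(4),
        THEN conjunct2, THEN conjunct2, THEN spec, THEN spec[of _ N], THEN mp, OF that(1), THEN bspec, OF z0(1), THEN bspec, OF that(2)]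
      by (elim conjE) (erule trans, erule trans, assumption)
    have det: "C (x, sgen v * y) = C (dfun (\<lambda>u. b u v) x, y)"
      if "v \<in> forms_K D" "x \<in> ?W'" "y \<in> ?W" for v x y
      by (rule adjoint_determined[OF dd b jet, where P = "\<lambda>x y. C (x, y)"])
        (fact addl scalel addr scaler adj that | assumption)+
    have det': "C (sgen u * x, y) = C (x, dfun (b u) y)"
      if "u \<in> forms_K D'" "y \<in> ?W" "x \<in> ?W'" for u x y
      by (rule adjoint_determined[OF dd' bilinear_form_swap[OF b] jet', where P = "\<lambda>x y. C (y, x)"])
        (assumption | rule addl scalel addr scaler adj' that)+
    \<comment> \<open>Start of the induction on the right argument: against the vacuum, a generator
      on the left is moved to the right by \<open>det'\<close>, where it contracts 1 to 0.\<close>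
    have one: "C (x, 1) = pairing x 1" if "x \<in> ?W'" for x
      using that[unfolded space_W_def]
    proof (induction rule: Sym_induct_left)
      case (sconst c)
      show ?case using C scalel[of 1 1 c] pairing_scale_left[of c 1 1] by (simp add: space_W_simps pairing_1)
    next
      case (add x x')
      then show ?case using addl[of x x' 1] by (simp add: space_W_def[symmetric] space_W_simps pairing_add_left)
    next
      case (sgen_mult u x)
      then have "C (sgen u * x, 1) = C (x, dfun (b u) 1)"
        by (intro det') (simp_all add: space_W_def[symmetric] space_W_simps)
      also have "\<dots> = 0"
        using scaler[of x 1 0] sgen_mult by (simp add: contract_simps space_W_def[symmetric] space_W_simps)
      also have "0 = pairing (sgen u * x) 1"
        using pairing_scale_right[of x 0 1] by (simp add: pairing_sgen_left contract_simps)
      finally show ?case .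
    next
      case (sconst_mult c x)
      then show ?case using scalel[of x 1 c] by (simp add: space_W_def[symmetric] space_W_simps pairing_scale_left)
    qed
    \<comment> \<open>Generators move from right to left by \<open>det\<close>. The left argument is
      quantified inside the induction because the contraction changes it.\<close>
    have eq: "\<forall>x\<in>?W'. C (x, y) = pairing x y" if "y \<in> ?W" for y
      using that[unfolded space_W_def]
    proof (induction rule: Sym_induct_left)
      case (sconst c)
      show ?case
        using one scaler[of _ 1 c] pairing_scale_right[of _ c 1] by (simp add: space_W_simps)
    next
      case (add y y')
      then show ?case using addr[of _ y y'] by (simp add: space_W_def[symmetric] pairing_add_right)
    next
      case (sgen_mult v y)
      then show ?case
        using det[of v _ y] lin_left by (simp add: space_W_def[symmetric] pairing_sgen_right dfun_in_W)
    next
      case (sconst_mult c y)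
      then show ?case using scaler[of _ y c] by (simp add: space_W_def[symmetric] pairing_scale_right)
    qed
    show "C = B"
    proof (rule PiE_ext[of C "?W' \<times> ?W" "\<lambda>_. UNIV" B])
      fix p assume "p \<in> ?W' \<times> ?W"
      then show "C p = B p" using eq B by auto
    qed (use C in \<open>auto simp: B_def\<close>)
  qed
qed

end
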